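(* Let $g \colon \mathbb{R}^{+} \to \mathbb{R}^{+}$ be a continuous function such that $g(0)=0$, $g(s)>0$ for all $s>0$, $\lim_{s\to0^{+}} g(s)/s = 0$ and $\lim_{s\to+\infty} g(s)/s = 0$. Let $a \colon \mathbb{R} \to \mathbb{R}$ be a locally integrable periodic function of minimal period $T>0$ for which there exist $2m+1$ points (with $m\geq 1$) $0=\sigma_{1}<\tau_{1}<\ldots<\sigma_{m}<\tau_{m}<\sigma_{m+1}=T$ such that, for $i=1,\ldots,m$, $a\succ0$ on $I^{+}_{i}:=[\sigma_{i},\tau_{i}]$ and $a\prec0$ on $I^{-}_{i}:=[\tau_{i},\sigma_{i+1}]$. Let $\rho>0$, let $\lambda>\lambda^{*}(\rho)$ and let $(r,R)$ be an admissible pair for $(\rho,\lambda)$ (see context). Then there exists $\mu^{*}(\lambda)=\mu^{*}(\lambda,r,R)>0$ such that for every $\mu>\mu^{*}(\lambda)$ the map $\pi\colon Y_{0}\to\Sigma_{3^{m}}$ described in the context is well defined, continuous, surjective and satisfies $$\pi\circ\psi=\sigma\circ\pi\quad\text{on }Y_{0}.$$ Furthermore, for every integer $k\geq1$, the counterimage under $\pi$ of any $k$-periodic sequence in $\Sigma_{3^{m}}$ contains at least a point $(u,y)\in Y_{0}$ such that $u(t)$ is a $kT$-periodic solution of $$u''+\bigl(\lambda a^{+}(t)-\mu a^{-}(t)\bigr)g(u)=0.$$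
   Context: Notation. $\mathbb{R}^{+}:=[0,+\infty)$; $a^{\pm}$ are the positive and negative parts of $a$. On an interval, $w\succ0$ means $w\geq0$ a.e. and $w$ not a.e. zero; $w\prec0$ means $-w\succ0$. Solutions are in the Carathéodory sense. $|I|$ is the length of an interval $I$; $I^{\pm}_{i,\ell}:=I^{\pm}_{i}+\ell T$ for $\ell\in\mathbb{Z}$; $\|a\|_{+,i}:=\int_{I^{+}_{i}}a^{+}(t)\,dt$; $\zeta(d):=\max_{d/2\leq s\leq d}g(s)/s$ for $d>0$. Constants. Fix $\varepsilon>0$ such that, for all $i=1,\ldots,m$, $\varepsilon<(\tau_{i}-\sigma_{i})/2$ and $\int_{\sigma_{i}+\varepsilon}^{\tau_{i}-\varepsilon}a^{+}(t)\,dt>0$, and set $\nu_{\varepsilon}:=\min_{i}\int_{\sigma_{i}+\varepsilon}^{\tau_{i}-\varepsilon}a^{+}(t)\,dt$. For $\rho>0$ set $\eta_{\varepsilon,\rho}:=\min\{g(s)\colon \varepsilon\rho/\max_{i}|I^{+}_{i}|\leq s\leq\rho\}$ and $\lambda^{*}(\rho):=2\rho/(\varepsilon\nu_{\varepsilon}\eta_{\varepsilon,\rho})$. A pair $(r,R)$ is called admissible for $(\rho,\lambda)$ if $0<r<\rho<R$ and $\zeta(s)<\bigl(2\lambda\max_{i=1,\ldots,m}(|I^{+}_{i}|+|I^{-}_{i}|)\|a\|_{+,i}\bigr)^{-1}$ for all $0<s\leq r$ and all $s\geq R$. Dynamics. $X$ is the space of continuous functions $z=(x,y)\colon\mathbb{R}\to\mathbb{R}^{2}$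 with the (complete) metric $\mathrm{dist}(z_{1},z_{2})=\sum_{N\geq1}2^{-N}\vartheta_{N}(z_{1},z_{2})/(1+\vartheta_{N}(z_{1},z_{2}))$, where $\vartheta_{N}(z_{1},z_{2})=\max_{|t|\leq N}(|x_{1}(t)-x_{2}(t)|+|y_{1}(t)-y_{2}(t)|)$ (uniform convergence on compact sets). The map $\psi\colon X\to X$ is $(\psi z)(t):=z(t+T)$. Extend $g$ by $g(s)=0$ for $s\leq0$. $Y_{0}\subseteq X$ is the set of globally defined solutions $(x,y)$ of the system $x'=y$, $y'=-(\lambda a^{+}(t)-\mu a^{-}(t))g(x)$ such that $0\leq x(t)\leq R$ for all $t\in\mathbb{R}$; it is invariant under $\psi$. Let $\mathscr{B}:=\{0,1,2\}^{m}$ (an alphabet of $3^{m}$ symbols, with the discrete topology), $\Sigma_{3^{m}}:=\mathscr{B}^{\mathbb{Z}}$ with the product topology, and $\sigma\colon\Sigma_{3^{m}}\to\Sigma_{3^{m}}$ the Bernoulli shift, $\sigma(\mathcal{T})=\mathcal{T}'$ with $\mathcal{T}'_{\ell}=\mathcal{T}_{\ell+1}$. The map $\pi$ associates to $z=(x,y)\in Y_{0}$ the sequence $\mathcal{T}=(\mathcal{T}_{\ell})_{\ell\in\mathbb{Z}}$, $\mathcal{T}_{\ell}=(\mathcal{T}_{\ell}^{1},\ldots,\mathcal{T}_{\ell}^{m})\in\mathscr{B}$, where $\mathcal{T}_{\ell}^{i}=0$ if $\max_{I^{+}_{i,\ell}}x<r$; $\mathcal{T}_{\ell}^{i}=1$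 if $r<\max_{I^{+}_{i,\ell}}x<\rho$; $\mathcal{T}_{\ell}^{i}=2$ if $\rho<\max_{I^{+}_{i,\ell}}x<R$. That $\pi$ is well defined means that for every $(x,y)\in Y_0$, $i$ and $\ell$ one of these three alternatives holds. *)

theory Defs
  imports "HOL-Analysis.Analysis"
begin

section \<open>Weight function\<close>

definition pos_part :: "(real \<Rightarrow> real) \<Rightarrow> real \<Rightarrow> real" where
  "pos_part a t = max (a t) 0"

definition neg_part :: "(real \<Rightarrow> real) \<Rightarrow> real \<Rightarrow> real" where
  "neg_part a t = max (- a t) 0"

definition locally_integrable :: "(real \<Rightarrow> real) \<Rightarrow> bool" where
  "locally_integrable a \<longleftrightarrow> (\<forall>K. compact K \<longrightarrow> a absolutely_integrable_on K)"

definition minimal_period :: "(real \<Rightarrow> real) \<Rightarrow> real \<Rightarrow> bool" where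
  "minimal_period a T \<longleftrightarrow>
     T > 0 \<and> (\<forall>t. a (t + T) = a t) \<and> (\<forall>p. 0 < p \<and> p < T \<longrightarrow> \<not> (\<forall>t. a (t + p) = a t))"

definition succ_zero_on :: "real set \<Rightarrow> (real \<Rightarrow> real) \<Rightarrow> bool" where
  "succ_zero_on J w \<longleftrightarrow>
     (AE t in lebesgue_on J. w t \<ge> 0) \<and> \<not> (AE t in lebesgue_on J. w t = 0)"

definition prec_zero_on :: "real set \<Rightarrow> (real \<Rightarrow> real) \<Rightarrow> bool" where
  "prec_zero_on J w \<longleftrightarrow> succ_zero_on J (\<lambda>t. - w t)"

text \<open>The points are given by two sequences, of which only \<open>\<sigma> 1, \<dots>, \<sigma> (m + 1)\<close> and
  \<open>\<tau> 1, \<dots>, \<tau> m\<close> are relevant.\<close>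

definition sign_pattern ::
    "nat \<Rightarrow> real \<Rightarrow> (nat \<Rightarrow> real) \<Rightarrow> (nat \<Rightarrow> real) \<Rightarrow> (real \<Rightarrow> real) \<Rightarrow> bool" where
  "sign_pattern m T \<sigma> \<tau> a \<longleftrightarrow>
     \<sigma> 1 = 0 \<and> \<sigma> (m + 1) = T \<and>
     (\<forall>i\<in>{1..m}. \<sigma> i < \<tau> i \<and> \<tau> i < \<sigma> (i + 1) \<and>
        succ_zero_on {\<sigma> i..\<tau> i} a \<and> prec_zero_on {\<tau> i..\<sigma> (i + 1)} a)"

section \<open>Constants\<close>

definition norm_plus :: "(nat \<Rightarrow> real) \<Rightarrow> (nat \<Rightarrow> real) \<Rightarrow> (real \<Rightarrow> real) \<Rightarrow> nat \<Rightarrow> real" where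
  "norm_plus \<sigma> \<tau> a i = (LINT t:{\<sigma> i..\<tau> i}|lebesgue. pos_part a t)"

text \<open>Below, \<open>SUP\<close> and \<open>INF\<close> are taken of continuous functions over nonempty compact
  intervals, so they are a maximum and a minimum.\<close>

definition zeta :: "(real \<Rightarrow> real) \<Rightarrow> real \<Rightarrow> real" where
  "zeta g d = (SUP s\<in>{d/2..d}. g s / s)"

definition eps_suitable ::
    "nat \<Rightarrow> (nat \<Rightarrow> real) \<Rightarrow> (nat \<Rightarrow> real) \<Rightarrow> (real \<Rightarrow> real) \<Rightarrow> real \<Rightarrow> bool" where
  "eps_suitable m \<sigma> \<tau> a \<epsilon> \<longleftrightarrow>
     \<epsilon> > 0 \<and>
     (\<forall>i\<in>{1..m}. \<epsilon> < (\<tau> i - \<sigma> i) / 2 \<and>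
        (LINT t:{\<sigma> i + \<epsilon>..\<tau> i - \<epsilon>}|lebesgue. pos_part a t) > 0)"

definition nu ::
    "nat \<Rightarrow> (nat \<Rightarrow> real) \<Rightarrow> (nat \<Rightarrow> real) \<Rightarrow> (real \<Rightarrow> real) \<Rightarrow> real \<Rightarrow> real" where
  "nu m \<sigma> \<tau> a \<epsilon> =
     Min ((\<lambda>i. LINT t:{\<sigma> i + \<epsilon>..\<tau> i - \<epsilon>}|lebesgue. pos_part a t) ` {1..m})"

definition eta ::
    "nat \<Rightarrow> (nat \<Rightarrow> real) \<Rightarrow> (nat \<Rightarrow> real) \<Rightarrow> (real \<Rightarrow> real) \<Rightarrow> real \<Rightarrow> real \<Rightarrow> real" where
  "eta m \<sigma> \<tau> g \<epsilon> \<rho> =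
     (INF s\<in>{\<epsilon> * \<rho> / Max ((\<lambda>i. \<tau> i - \<sigma> i) ` {1..m})..\<rho>}. g s)"

definition lambda_star ::
    "nat \<Rightarrow> (nat \<Rightarrow> real) \<Rightarrow> (nat \<Rightarrow> real) \<Rightarrow> (real \<Rightarrow> real) \<Rightarrow> (real \<Rightarrow> real) \<Rightarrow> real \<Rightarrow> real \<Rightarrow> real" where
  "lambda_star m \<sigma> \<tau> a g \<epsilon> \<rho> = 2 * \<rho> / (\<epsilon> * nu m \<sigma> \<tau> a \<epsilon> * eta m \<sigma> \<tau> g \<epsilon> \<rho>)"

definition admissible ::
    "nat \<Rightarrow> (nat \<Rightarrow> real) \<Rightarrow> (nat \<Rightarrow> real) \<Rightarrow> (real \<Rightarrow> real) \<Rightarrow> (real \<Rightarrow> real) \<Rightarrow>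
      real \<Rightarrow> real \<Rightarrow> real \<Rightarrow> real \<Rightarrow> bool" where
  "admissible m \<sigma> \<tau> a g \<rho> lam r R \<longleftrightarrow>
     0 < r \<and> r < \<rho> \<and> \<rho> < R \<and>
     (\<forall>s. (0 < s \<and> s \<le> r) \<or> R \<le> s \<longrightarrow>
        zeta g s < inverse (2 * lam *
          Max ((\<lambda>i. ((\<tau> i - \<sigma> i) + (\<sigma> (i + 1) - \<tau> i)) * norm_plus \<sigma> \<tau> a i) ` {1..m})))"

section \<open>Caratheodory solutions\<close>

definition abs_continuous_on :: "real set \<Rightarrow> (real \<Rightarrow> real) \<Rightarrow> bool" where
  "abs_continuous_on S f \<longleftrightarrow>
     (\<forall>e>0. \<exists>d>0. \<forall>D :: (real \<times> real) set.
        finite D \<and> (\<forall>(u, v)\<in>D. u \<le> v \<and> {u..v} \<subseteq> S) \<and>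
        pairwise (\<lambda>p q. disjnt {fst p<..<snd p} {fst q<..<snd q}) D \<and>
        (\<Sum>(u, v)\<in>D. v - u) < d
        \<longrightarrow> (\<Sum>(u, v)\<in>D. \<bar>f v - f u\<bar>) < e)"

definition locally_abs_continuous :: "(real \<Rightarrow> real) \<Rightarrow> bool" where
  "locally_abs_continuous f \<longleftrightarrow> (\<forall>c d. abs_continuous_on {c..d} f)"

text \<open>Solutions on the whole real line of \<open>x' = y, y' = - q(t) h(x)\<close>.\<close>

definition system_solution ::
    "(real \<Rightarrow> real) \<Rightarrow> (real \<Rightarrow> real) \<Rightarrow> (real \<Rightarrow> real) \<Rightarrow> (real \<Rightarrow> real) \<Rightarrow> bool" where
  "system_solution q h x y \<longleftrightarrow>
     locally_abs_continuous x \<and> locally_abs_continuous y \<and>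
     (AE t in lebesgue. (x has_real_derivative y t) (at t)) \<and>
     (AE t in lebesgue. (y has_real_derivative - (q t * h (x t))) (at t))"

text \<open>Solutions on the whole real line of \<open>u'' + q(t) h(u) = 0\<close>.\<close>

definition second_order_solution ::
    "(real \<Rightarrow> real) \<Rightarrow> (real \<Rightarrow> real) \<Rightarrow> (real \<Rightarrow> real) \<Rightarrow> bool" where
  "second_order_solution q h u \<longleftrightarrow>
     (\<forall>t. u differentiable at t) \<and> locally_abs_continuous (deriv u) \<and>
     (AE t in lebesgue. \<exists>D. (deriv u has_real_derivative D) (at t) \<and> D + q t * h (u t) = 0)"

definition weight :: "(real \<Rightarrow> real) \<Rightarrow> real \<Rightarrow> real \<Rightarrow> real \<Rightarrow> real" where
  "weight a lam \<mu> t = lam * pos_part a t - \<mu> * neg_part a t"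

definition zero_extension :: "(real \<Rightarrow> real) \<Rightarrow> real \<Rightarrow> real" where
  "zero_extension g s = (if s \<le> 0 then 0 else g s)"

section \<open>The phase space\<close>

definition X_space :: "(real \<Rightarrow> real \<times> real) set" where
  "X_space = {z. continuous_on UNIV z}"

definition vartheta :: "nat \<Rightarrow> (real \<Rightarrow> real \<times> real) \<Rightarrow> (real \<Rightarrow> real \<times> real) \<Rightarrow> real" where
  "vartheta N z1 z2 =
     (SUP t\<in>{- real N..real N}. \<bar>fst (z1 t) - fst (z2 t)\<bar> + \<bar>snd (z1 t) - snd (z2 t)\<bar>)"

text \<open>The value \<open>0\<close> outside \<open>X_space\<close> only serves the locale \<^locale>\<open>Metric_space\<close>, which asks
  for nonnegativity on the whole type.\<close>

definition X_dist :: "(real \<Rightarrow> real \<times> real) \<Rightarrow> (real \<Rightarrow> real \<times> real) \<Rightarrow> real" where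
  "X_dist z1 z2 =
     (if z1 \<in> X_space \<and> z2 \<in> X_space
      then \<Sum>n. (1/2) ^ Suc n * (vartheta (Suc n) z1 z2 / (1 + vartheta (Suc n) z1 z2))
      else 0)"

definition X_topology :: "(real \<Rightarrow> real \<times> real) topology" where
  "X_topology = Metric_space.mtopology X_space X_dist"

definition psi :: "real \<Rightarrow> (real \<Rightarrow> real \<times> real) \<Rightarrow> real \<Rightarrow> real \<times> real" where
  "psi T z = (\<lambda>t. z (t + T))"

definition Y0 ::
    "(real \<Rightarrow> real) \<Rightarrow> (real \<Rightarrow> real) \<Rightarrow> real \<Rightarrow> real \<Rightarrow> real \<Rightarrow> (real \<Rightarrow> real \<times> real) set" where
  "Y0 a g lam \<mu> R =
     {z \<in> X_space.
        system_solution (weight a lam \<mu>) (zero_extension g) (\<lambda>t. fst (z t)) (\<lambda>t. snd (z t)) \<and>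
        (\<forall>t. 0 \<le> fst (z t) \<and> fst (z t) \<le> R)}"

section \<open>The symbolic space and the coding map\<close>

definition alphabet :: "nat \<Rightarrow> (nat \<Rightarrow> nat) set" where
  "alphabet m = {1..m} \<rightarrow>\<^sub>E {0, 1, 2}"

definition Sigma_topology :: "nat \<Rightarrow> (int \<Rightarrow> nat \<Rightarrow> nat) topology" where
  "Sigma_topology m = product_topology (\<lambda>_. discrete_topology (alphabet m)) UNIV"

definition bernoulli_shift :: "(int \<Rightarrow> 'b) \<Rightarrow> int \<Rightarrow> 'b" where
  "bernoulli_shift S = (\<lambda>l. S (l + 1))"

definition max_on_hump ::
    "real \<Rightarrow> (nat \<Rightarrow> real) \<Rightarrow> (nat \<Rightarrow> real) \<Rightarrow> (real \<Rightarrow> real \<times> real) \<Rightarrow> nat \<Rightarrow> int \<Rightarrow> real" where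
  "max_on_hump T \<sigma> \<tau> z i l = (SUP t\<in>{\<sigma> i + of_int l * T..\<tau> i + of_int l * T}. fst (z t))"

text \<open>The last branch of \<open>coding\<close> is excluded exactly when \<open>coding_well_defined\<close> holds.\<close>

definition coding ::
    "nat \<Rightarrow> real \<Rightarrow> (nat \<Rightarrow> real) \<Rightarrow> (nat \<Rightarrow> real) \<Rightarrow> real \<Rightarrow> real \<Rightarrow> real \<Rightarrow>
      (real \<Rightarrow> real \<times> real) \<Rightarrow> int \<Rightarrow> nat \<Rightarrow> nat" where
  "coding m T \<sigma> \<tau> r \<rho> R z =
     (\<lambda>l. \<lambda>i\<in>{1..m}.
        let M = max_on_hump T \<sigma> \<tau> z i l in
        if M < r then 0
        else if r < M \<and> M < \<rho> then 1
        else if \<rho> < M \<and> M < R then 2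
        else undefined)"

definition coding_well_defined ::
    "nat \<Rightarrow> real \<Rightarrow> (nat \<Rightarrow> real) \<Rightarrow> (nat \<Rightarrow> real) \<Rightarrow> real \<Rightarrow> real \<Rightarrow> real \<Rightarrow>
      (real \<Rightarrow> real \<times> real) set \<Rightarrow> bool" where
  "coding_well_defined m T \<sigma> \<tau> r \<rho> R Y \<longleftrightarrow>
     (\<forall>z\<in>Y. \<forall>i\<in>{1..m}. \<forall>l.
        max_on_hump T \<sigma> \<tau> z i l < r \<or>
        (r < max_on_hump T \<sigma> \<tau> z i l \<and> max_on_hump T \<sigma> \<tau> z i l < \<rho>) \<or>
        (\<rho> < max_on_hump T \<sigma> \<tau> z i l \<and> max_on_hump T \<sigma> \<tau> z i l < R))"

section \<open>The metric on the phase space, and invariance of the solution set\<close>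

lemma X_diff_continuous:
  assumes "z1 \<in> X_space" "z2 \<in> X_space"
  shows "continuous_on S (\<lambda>t. \<bar>fst (z1 t) - fst (z2 t)\<bar> + \<bar>snd (z1 t) - snd (z2 t)\<bar>)"
  using assms unfolding X_space_def
  by (auto intro!: continuous_intros elim: continuous_on_subset)

lemma vartheta_bdd:
  assumes "z1 \<in> X_space" "z2 \<in> X_space"
  shows "bdd_above ((\<lambda>t. \<bar>fst (z1 t) - fst (z2 t)\<bar> + \<bar>snd (z1 t) - snd (z2 t)\<bar>) ` {- real N..real N})"
  by (rule bounded_imp_bdd_above, rule compact_imp_bounded, rule compact_continuous_image)
    (use X_diff_continuous[OF assms] in auto)

lemma vartheta_upper:
  assumes "z1 \<in> X_space" "z2 \<in> X_space" "\<bar>t\<bar> \<le> real N"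
  shows "\<bar>fst (z1 t) - fst (z2 t)\<bar> + \<bar>snd (z1 t) - snd (z2 t)\<bar> \<le> vartheta N z1 z2"
  unfolding vartheta_def by (rule cSUP_upper) (use assms vartheta_bdd in auto)

lemma vartheta_nonneg:
  assumes "z1 \<in> X_space" "z2 \<in> X_space"
  shows "0 \<le> vartheta N z1 z2"
proof -
  have "0 \<le> \<bar>fst (z1 0) - fst (z2 0)\<bar> + \<bar>snd (z1 0) - snd (z2 0)\<bar>" by simp
  also have "\<dots> \<le> vartheta N z1 z2" by (rule vartheta_upper) (use assms in auto)
  finally show ?thesis .
qed

lemma vartheta_triangle:
  assumes "z1 \<in> X_space" "z2 \<in> X_space" "z3 \<in> X_space"
  shows "vartheta N z1 z3 \<le> vartheta N z1 z2 + vartheta N z2 z3"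
proof -
  have "\<bar>fst (z1 t) - fst (z3 t)\<bar> + \<bar>snd (z1 t) - snd (z3 t)\<bar> \<le> vartheta N z1 z2 + vartheta N z2 z3"
    if "t \<in> {- real N..real N}" for t
  proof -
    have "\<bar>t\<bar> \<le> real N" using that by auto
    with vartheta_upper[OF assms(1,2) this] vartheta_upper[OF assms(2,3) this]
    show ?thesis by linarith
  qed
  then show ?thesis
    unfolding vartheta_def[of N z1 z3] by (intro cSUP_least) auto
qed

lemma X_dist_summable:
  assumes "z1 \<in> X_space" "z2 \<in> X_space"
  shows "summable (\<lambda>n. (1/2) ^ Suc n * (vartheta (Suc n) z1 z2 / (1 + vartheta (Suc n) z1 z2)))"
proof (rule summable_comparison_test')
  show "summable (\<lambda>n. (1/2::real) ^ Suc n)"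
    using summable_geometric[of "1/2::real"] by (simp add: summable_Suc_iff)
  fix n :: nat
  have "vartheta (Suc n) z1 z2 / (1 + vartheta (Suc n) z1 z2) \<le> 1"
    using vartheta_nonneg[OF assms, of "Suc n"] by (simp add: divide_simps)
  moreover have "0 \<le> vartheta (Suc n) z1 z2 / (1 + vartheta (Suc n) z1 z2)"
    using vartheta_nonneg[OF assms, of "Suc n"] by simp
  ultimately show "norm ((1/2) ^ Suc n * (vartheta (Suc n) z1 z2 / (1 + vartheta (Suc n) z1 z2)))
      \<le> (1/2) ^ Suc n"
    using mult_left_mono[of "vartheta (Suc n) z1 z2 / (1 + vartheta (Suc n) z1 z2)" 1 "(1/2) ^ Suc n"]
    unfolding real_norm_def abs_mult by (simp only: abs_of_nonneg mult_1_right) simp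
qed

lemma bounded_transform_subadditive:
  fixes p q s :: real
  assumes "0 \<le> p" "0 \<le> q" "0 \<le> s" "s \<le> p + q"
  shows "s / (1 + s) \<le> p / (1 + p) + q / (1 + q)"
proof -
  have "s / (1 + s) \<le> (p + q) / (1 + (p + q))"
    using assms by (simp add: divide_simps algebra_simps)
  also have "\<dots> = p / (1 + (p + q)) + q / (1 + (p + q))"
    by (simp add: add_divide_distrib)
  also have "\<dots> \<le> p / (1 + p) + q / (1 + q)"
    by (intro add_mono divide_left_mono) (use assms in auto)
  finally show ?thesis .
qed

lemma X_dist_eq:
  assumes "z1 \<in> X_space" "z2 \<in> X_space"
  shows "X_dist z1 z2 =
    (\<Sum>n. (1/2) ^ Suc n * (vartheta (Suc n) z1 z2 / (1 + vartheta (Suc n) z1 z2)))"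
  unfolding X_dist_def by (rule if_P) (use assms in blast)

lemma Metric_space_X: "Metric_space X_space X_dist"
proof
  let ?w = "\<lambda>n z1 z2. (1/2) ^ Suc n * (vartheta (Suc n) z1 z2 / (1 + vartheta (Suc n) z1 z2))"
  have nn: "0 \<le> ?w n z1 z2" if "z1 \<in> X_space" "z2 \<in> X_space" for n z1 z2
    using vartheta_nonneg[OF that, of "Suc n"] by simp
  show "0 \<le> X_dist z1 z2" for z1 z2
  proof (cases "z1 \<in> X_space \<and> z2 \<in> X_space")
    case True
    then have "0 \<le> (\<Sum>n. ?w n z1 z2)"
      using nn by (intro suminf_nonneg X_dist_summable) blast+
    with X_dist_eq[of z1 z2] True show ?thesis by presburger
  next
    case False
    then have "X_dist z1 z2 = 0" unfolding X_dist_def by (rule if_not_P)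
    then show ?thesis by simp
  qed
  show "X_dist z1 z2 = X_dist z2 z1" for z1 z2
  proof -
    have "vartheta N z1 z2 = vartheta N z2 z1" for N
      unfolding vartheta_def
      by (subst abs_minus_commute[of "fst (z1 _)"], subst abs_minus_commute[of "snd (z1 _)"]) (rule refl)
    then show ?thesis unfolding X_dist_def by (simp only: conj_commute)
  qed
  show "X_dist z1 z2 = 0 \<longleftrightarrow> z1 = z2" if z: "z1 \<in> X_space" "z2 \<in> X_space" for z1 z2
  proof
    assume "X_dist z1 z2 = 0"
    then have "(\<Sum>n. ?w n z1 z2) = 0" unfolding X_dist_eq[OF z] .
    then have w0: "?w n z1 z2 = 0" for n
      using suminf_eq_zero_iff[OF X_dist_summable[OF z]] nn[OF z] by blast
    have v0: "vartheta (Suc n) z1 z2 = 0" for n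
    proof -
      have "vartheta (Suc n) z1 z2 = 0 \<or> 1 + vartheta (Suc n) z1 z2 = 0"
        using w0[of n] unfolding mult_eq_0_iff divide_eq_0_iff by simp
      then show ?thesis using vartheta_nonneg[OF z, of "Suc n"] by linarith
    qed
    have "z1 t = z2 t" for t
    proof -
      obtain n where "\<bar>t\<bar> \<le> real n" using real_arch_simple by blast
      then have "\<bar>t\<bar> \<le> real (Suc n)" by simp
      from vartheta_upper[OF z this] v0[of n]
      have "fst (z1 t) = fst (z2 t)" "snd (z1 t) = snd (z2 t)" by linarith+
      then show ?thesis by (rule prod_eqI)
    qed
    then show "z1 = z2" by blast
  next
    assume "z1 = z2"
    then have "vartheta N z1 z2 = 0" for N by (simp add: vartheta_def)
    then show "X_dist z1 z2 = 0" unfolding X_dist_eq[OF z] by simp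
  qed
  show "X_dist z1 z3 \<le> X_dist z1 z2 + X_dist z2 z3"
    if z: "z1 \<in> X_space" "z2 \<in> X_space" "z3 \<in> X_space" for z1 z2 z3
  proof -
    have "?w n z1 z3 \<le> ?w n z1 z2 + ?w n z2 z3" for n
    proof -
      have "vartheta (Suc n) z1 z3 / (1 + vartheta (Suc n) z1 z3)
          \<le> vartheta (Suc n) z1 z2 / (1 + vartheta (Suc n) z1 z2)
            + vartheta (Suc n) z2 z3 / (1 + vartheta (Suc n) z2 z3)"
        using z by (intro bounded_transform_subadditive vartheta_nonneg vartheta_triangle)
      then have "?w n z1 z3 \<le> (1/2) ^ Suc n * (vartheta (Suc n) z1 z2 / (1 + vartheta (Suc n) z1 z2)
            + vartheta (Suc n) z2 z3 / (1 + vartheta (Suc n) z2 z3))"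
        by (intro mult_left_mono) auto
      then show ?thesis by (simp only: distrib_left)
    qed
    then have "(\<Sum>n. ?w n z1 z3) \<le> (\<Sum>n. ?w n z1 z2 + ?w n z2 z3)"
      using z by (intro suminf_le summable_add X_dist_summable)
    also have "\<dots> = (\<Sum>n. ?w n z1 z2) + (\<Sum>n. ?w n z2 z3)"
      using z by (intro suminf_add[symmetric] X_dist_summable)
    finally show ?thesis unfolding X_dist_eq[OF z(1,2)] X_dist_eq[OF z(2,3)] X_dist_eq[OF z(1,3)] .
  qed
qed

lemma AE_lebesgue_shift:
  fixes P :: "real \<Rightarrow> bool"
  assumes "AE t in lebesgue. P t"
  shows "AE t in lebesgue. P (t + T)"
proof -
  from assms obtain N where N: "negligible N" "{t. \<not> P t} \<subseteq> N"
    unfolding eventually_ae_filter negligible_iff_null_sets by auto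
  have "negligible ((\<lambda>t. - T + t) ` N)" using N(1) by (rule negligible_translation)
  moreover have "{t. \<not> P (t + T)} \<subseteq> (\<lambda>t. - T + t) ` N"
  proof
    fix t assume "t \<in> {t. \<not> P (t + T)}"
    then have "t + T \<in> N" using N(2) by auto
    then show "t \<in> (\<lambda>t. - T + t) ` N" by (intro image_eqI[of _ _ "t + T"]) auto
  qed
  ultimately show ?thesis
    unfolding eventually_ae_filter negligible_iff_null_sets by auto
qed

lemma abs_continuous_on_shift:
  assumes "abs_continuous_on {c + T..d + T} f"
  shows "abs_continuous_on {c..d} (\<lambda>t. f (t + T))"
  unfolding abs_continuous_on_def
proof (intro allI impI)
  fix e :: real assume "e > 0"
  with assms obtain \<delta> where \<delta>: "\<delta> > 0"
    "\<And>D. finite D \<Longrightarrow> (\<forall>(u, v)\<in>D. u \<le> v \<and> {u..v} \<subseteq> {c + T..d + T}) \<Longrightarrow>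
        pairwise (\<lambda>p q. disjnt {fst p<..<snd p} {fst q<..<snd q}) D \<Longrightarrow>
        (\<Sum>(u, v)\<in>D. v - u) < \<delta> \<Longrightarrow> (\<Sum>(u, v)\<in>D. \<bar>f v - f u\<bar>) < e"
    unfolding abs_continuous_on_def by meson
  show "\<exists>\<delta>>0. \<forall>D. finite D \<and> (\<forall>(u, v)\<in>D. u \<le> v \<and> {u..v} \<subseteq> {c..d}) \<and>
        pairwise (\<lambda>p q. disjnt {fst p<..<snd p} {fst q<..<snd q}) D \<and>
        (\<Sum>(u, v)\<in>D. v - u) < \<delta> \<longrightarrow> (\<Sum>(u, v)\<in>D. \<bar>f (v + T) - f (u + T)\<bar>) < e"
  proof (intro exI[of _ \<delta>] conjI allI impI \<delta>(1))
    fix D :: "(real \<times> real) set"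
    assume D: "finite D \<and> (\<forall>(u, v)\<in>D. u \<le> v \<and> {u..v} \<subseteq> {c..d}) \<and>
        pairwise (\<lambda>p q. disjnt {fst p<..<snd p} {fst q<..<snd q}) D \<and>
        (\<Sum>(u, v)\<in>D. v - u) < \<delta>"
    let ?h = "\<lambda>(u, v). (u + T, v + T)"
    have inj: "inj_on ?h D" by (auto simp: inj_on_def)
    have sums: "(\<Sum>(u, v)\<in>?h ` D. F u v) = (\<Sum>(u, v)\<in>D. F (u + T) (v + T))" for F :: "real \<Rightarrow> real \<Rightarrow> real"
      by (subst sum.reindex[OF inj]) (auto intro!: sum.cong)
    have "(\<Sum>(u, v)\<in>?h ` D. \<bar>f v - f u\<bar>) < e"
    proof (rule \<delta>(2))
      show "pairwise (\<lambda>p q. disjnt {fst p<..<snd p} {fst q<..<snd q}) (?h ` D)"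
      proof (rule pairwise_imageI)
        fix p q assume pq: "p \<in> D" "q \<in> D" "p \<noteq> q"
        then have dj: "disjnt {fst p<..<snd p} {fst q<..<snd q}"
          using D by (auto simp: pairwise_def)
        show "disjnt {fst (?h p)<..<snd (?h p)} {fst (?h q)<..<snd (?h q)}"
          unfolding disjnt_iff
        proof (intro allI notI)
          fix s assume "s \<in> {fst (?h p)<..<snd (?h p)} \<and> s \<in> {fst (?h q)<..<snd (?h q)}"
          then have "s - T \<in> {fst p<..<snd p}" "s - T \<in> {fst q<..<snd q}"
            by (auto simp: split_beta)
          with dj show False by (auto simp: disjnt_iff)
        qed
      qed
      show "finite (?h ` D)" using D by blast
      show "\<forall>(u, v)\<in>?h ` D. u \<le> v \<and> {u..v} \<subseteq> {c + T..d + T}"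
      proof
        fix p assume "p \<in> ?h ` D"
        then obtain u v where uv: "(u, v) \<in> D" "p = (u + T, v + T)" by auto
        with D have "u \<le> v \<and> {u..v} \<subseteq> {c..d}" by blast
        then show "case p of (u, v) \<Rightarrow> u \<le> v \<and> {u..v} \<subseteq> {c + T..d + T}"
          by (simp add: uv(2))
      qed
      show "(\<Sum>(u, v)\<in>?h ` D. v - u) < \<delta>" using D by (simp add: sums)
    qed
    then show "(\<Sum>(u, v)\<in>D. \<bar>f (v + T) - f (u + T)\<bar>) < e" by (simp add: sums)
  qed
qed

lemma psi_Y0:
  assumes per: "\<And>t. a (t + T) = a t" and z: "z \<in> Y0 a g lam \<mu> R"
  shows "psi T z \<in> Y0 a g lam \<mu> R"
proof -
  let ?q = "weight a lam \<mu>" and ?h = "zero_extension g"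
  have w: "?q (t + T) = ?q t" for t
    by (simp add: weight_def pos_part_def neg_part_def per)
  have "continuous_on UNIV z" using z by (simp add: Y0_def X_space_def)
  then have "continuous_on UNIV (\<lambda>t. z (t + T))"
    by (rule continuous_on_compose2[of UNIV z]) (auto intro!: continuous_on_add continuous_on_id continuous_on_const)
  then have X: "psi T z \<in> X_space" by (simp add: X_space_def psi_def)
  have ac: "locally_abs_continuous (\<lambda>t. fst (z t))" "locally_abs_continuous (\<lambda>t. snd (z t))"
    and d1: "AE t in lebesgue. ((\<lambda>t. fst (z t)) has_real_derivative snd (z t)) (at t)"
    and d2: "AE t in lebesgue. ((\<lambda>t. snd (z t)) has_real_derivative - (?q t * ?h (fst (z t)))) (at t)"
    using z unfolding Y0_def system_solution_def by blast+
  have ac': "locally_abs_continuous (\<lambda>t. fst (psi T z t))" "locally_abs_continuous (\<lambda>t. snd (psi T z t))"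
    using ac unfolding locally_abs_continuous_def psi_def
    by (auto intro: abs_continuous_on_shift[of _ _ _ "\<lambda>t. fst (z t)"]
        abs_continuous_on_shift[of _ _ _ "\<lambda>t. snd (z t)"])
  have d1': "AE t in lebesgue. ((\<lambda>t. fst (psi T z t)) has_real_derivative snd (psi T z t)) (at t)"
    using AE_lebesgue_shift[OF d1, of T] unfolding psi_def
    by (rule eventually_mono) (simp only: DERIV_shift)
  have d2': "AE t in lebesgue. ((\<lambda>t. snd (psi T z t)) has_real_derivative
      - (?q t * ?h (fst (psi T z t)))) (at t)"
    using AE_lebesgue_shift[OF d2, of T] unfolding psi_def
    by (rule eventually_mono) (simp only: DERIV_shift w)
  have b: "\<And>t. 0 \<le> fst (psi T z t) \<and> fst (psi T z t) \<le> R" using z by (auto simp: Y0_def psi_def)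
  show ?thesis unfolding Y0_def system_solution_def using X ac' d1' d2' b by blast
qed

end

(*
  The nonlinearity is only continuous, so there is no Poincare map and no uniqueness. Periodic
  solutions with a prescribed itinerary are found as solutions of a larger problem: for each
  positivity interval there are two extra unknowns, a coefficient p and a target height d. The
  coefficient replaces lam (values p > lam act as an additive forcing, which excludes the zero
  solution), and a complementarity condition forces the maximum of the solution on that interval
  to equal d. The condition p = lam then becomes a scalar equation in d, and the estimates at the
  levels r, rho, R (p > lam is needed to sustain a hump of height r or R, p < lam one of height
  rho) say that p - lam has opposite signs at the two ends of [r, rho] and of [rho, R]. So the
  unstable middle state is reached without computing a degree: the whole system is a variational
  inequality on a box, solvable after discretization by Kuhn's lemma, and the mesh is sent to zero
  with Arzela-Ascoli. All estimates are local in time, so mu does not depend on the period, and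
  arbitrary itineraries are limits of periodic ones.
*)
theory Submission
  imports Defs "HOL-Complex_Analysis.Great_Picard"
begin

text \<open>Two estimates on a single hump explain the constants. A concave hump of height \<rho>
  loses at most \<open>2 * \<rho> / \<epsilon>\<close> of slope between the points at distance
  \<epsilon> from its ends and stays above \<open>\<epsilon> * \<rho> / |I|\<close> there, so a
  coefficient p costs at least p times eta times nu of slope; for p at least lam this is
  unaffordable exactly because \<open>lam > lambda_star\<close>. At height d = r or d = R the force
  is so weak that the solution cannot sink below d / 2 before the next negativity interval ends:
  hence the interval [d / 2, d] in zeta, and the factor 2 and the total length of both intervals in
  admissibility. Convexity with large \<mu> then pushes the solution out of its range. The obstacle
  is that 0 solves the true equation, so existence of a solution alone says nothing about its humps;
  confining each d to [r, \<rho>] or [\<rho>, R] builds the itinerary into the problem. The price is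
  a bounded range for p with two artificial ends. The lower end p = 0 is excluded by the weak-hump
  estimate, since no force is left; for a nonzero symbol the upper end is excluded by the slope
  count for a large additive force.\<close>

section \<open>Variational inequalities on boxes\<close>

text \<open>Hartman-Stampacchia on a box, as a limit of grid cells found by Kuhn's lemma:
  \<open>F x i\<close> vanishes unless \<open>x i\<close> lies on a face, where \<open>- F x\<close>
  points outwards. Points are functions on all naturals, so continuity is phrased by sequences and
  only in coordinates below \<open>n\<close>.\<close>

lemma box_variational_inequality:
  fixes F :: "(nat \<Rightarrow> real) \<Rightarrow> nat \<Rightarrow> real" and lo hi :: "nat \<Rightarrow> real"
  assumes le: "\<And>i. i < n \<Longrightarrow> lo i \<le> hi i"
    and cont: "\<And>X x i. i < n \<Longrightarrow> (\<And>k j. j < n \<Longrightarrow> lo j \<le> X k j \<and> X k j \<le> hi j) \<Longrightarrow>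
        (\<And>j. j < n \<Longrightarrow> lo j \<le> x j \<and> x j \<le> hi j) \<Longrightarrow>
        (\<And>j. j < n \<Longrightarrow> (\<lambda>k. X k j) \<longlonglongrightarrow> x j) \<Longrightarrow> (\<lambda>k. F (X k) i) \<longlonglongrightarrow> F x i"
  obtains x where "\<And>i. i < n \<Longrightarrow> lo i \<le> x i \<and> x i \<le> hi i"
    and "\<And>i. i < n \<Longrightarrow> F x i \<le> 0 \<or> x i = lo i"
    and "\<And>i. i < n \<Longrightarrow> 0 \<le> F x i \<or> x i = hi i"
proof -
  define pt :: "nat \<Rightarrow> (nat \<Rightarrow> nat) \<Rightarrow> nat \<Rightarrow> real"
    where "pt p q i = lo i + (hi i - lo i) * (real (q i) / real (Suc p))" for p q i
  have ptbox: "lo i \<le> pt p q i \<and> pt p q i \<le> hi i" if "q i \<le> Suc p" "i < n" for p q i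
  proof -
    have "0 \<le> real (q i) / real (Suc p)" "real (q i) / real (Suc p) \<le> 1"
      using that(1) by (auto simp: divide_simps)
    then have "0 \<le> (hi i - lo i) * (real (q i) / real (Suc p))"
        "(hi i - lo i) * (real (q i) / real (Suc p)) \<le> (hi i - lo i) * 1"
      using le[OF that(2)] by (intro mult_nonneg_nonneg mult_left_mono; simp)+
    then show ?thesis unfolding pt_def mult_1_right by linarith
  qed
  \<comment> \<open>Kuhn's lemma demands 0 on lower and 1 on upper faces; in between the label
    records the sign of \<open>F\<close>. Faces are recognized by the index \<open>q i\<close> and
    not by the point, so edges of length 0 are allowed; they occur later, when a height is
    fixed.\<close>
  define lab :: "nat \<Rightarrow> (nat \<Rightarrow> nat) \<Rightarrow> nat \<Rightarrow> nat"
    where "lab p q i = (if q i = 0 then 0 else if q i = Suc p then 1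
      else if F (pt p q) i \<le> 0 then 0 else 1)" for p q i
  define good where "good p q r s \<longleftrightarrow> (\<forall>i<n. q i < Suc p) \<and>
      (\<forall>i<n. (\<forall>j<n. q j \<le> r i j \<and> r i j \<le> q j + 1) \<and> (\<forall>j<n. q j \<le> s i j \<and> s i j \<le> q j + 1) \<and>
        lab p (r i) i = 0 \<and> lab p (s i) i = 1)" for p q r s
  have "\<exists>q r s. good p q r s" for p
  proof -
    obtain q where q: "\<forall>i<n. q i < Suc p"
      "\<forall>i<n. \<exists>r s. (\<forall>j<n. q j \<le> r j \<and> r j \<le> q j + 1) \<and> (\<forall>j<n. q j \<le> s j \<and> s j \<le> q j + 1)
        \<and> lab p r i \<noteq> lab p s i"
      by (rule kuhn_lemma[of "Suc p" n "lab p"]) (auto simp: lab_def)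
    have "\<exists>r s. (\<forall>j<n. q j \<le> r j \<and> r j \<le> q j + 1) \<and> (\<forall>j<n. q j \<le> s j \<and> s j \<le> q j + 1)
        \<and> lab p r i = 0 \<and> lab p s i = 1" if i: "i < n" for i
    proof -
      obtain r s where rs: "\<forall>j<n. q j \<le> r j \<and> r j \<le> q j + 1" "\<forall>j<n. q j \<le> s j \<and> s j \<le> q j + 1"
        "lab p r i \<noteq> lab p s i" using q(2) i by blast
      have "lab p r i \<in> {0,1}" "lab p s i \<in> {0,1}" by (auto simp: lab_def)
      with rs(3) consider "lab p r i = 0" "lab p s i = 1" | "lab p s i = 0" "lab p r i = 1" by auto
      then show ?thesis using rs(1,2) by cases blast+
    qed
    then have "\<exists>r s. \<forall>i<n. (\<forall>j<n. q j \<le> r i j \<and> r i j \<le> q j + 1) \<and>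
        (\<forall>j<n. q j \<le> s i j \<and> s i j \<le> q j + 1) \<and> lab p (r i) i = 0 \<and> lab p (s i) i = 1" by metis
    then show ?thesis using q(1) unfolding good_def by blast
  qed
  then obtain q r s where "good p (q p) (r p) (s p)" for p by metis
  then have q: "\<And>p i. i < n \<Longrightarrow> q p i < Suc p"
    and r: "\<And>p i j. i < n \<Longrightarrow> j < n \<Longrightarrow> q p j \<le> r p i j \<and> r p i j \<le> q p j + 1"
    and s: "\<And>p i j. i < n \<Longrightarrow> j < n \<Longrightarrow> q p j \<le> s p i j \<and> s p i j \<le> q p j + 1"
    and lr: "\<And>p i. i < n \<Longrightarrow> lab p (r p i) i = 0" and ls: "\<And>p i. i < n \<Longrightarrow> lab p (s p i) i = 1"
    by (auto simp: good_def)
  define B where "B = (\<Sum>i<n. \<bar>lo i\<bar> + \<bar>hi i\<bar>)"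
  have qB: "norm (pt p (q p) i) \<le> B" if "i \<in> {..<n}" for p i
  proof -
    have "lo i \<le> pt p (q p) i" "pt p (q p) i \<le> hi i"
      using ptbox[of "q p" i p] q[of i p] that by auto
    moreover have "\<bar>lo i\<bar> + \<bar>hi i\<bar> \<le> B"
      unfolding B_def using that by (intro member_le_sum) auto
    ultimately show ?thesis unfolding real_norm_def by linarith
  qed
  obtain k :: "nat \<Rightarrow> nat" where k: "strict_mono k"
    and kl: "\<And>i. i \<in> {..<n} \<Longrightarrow> \<exists>l. (\<lambda>p. pt (k p) (q (k p)) i) \<longlonglongrightarrow> l"
    by (rule function_convergent_subsequence[of "{..<n}" "\<lambda>p. pt p (q p)" B]) (use qB in auto)
  then obtain x where x: "\<And>i. i < n \<Longrightarrow> (\<lambda>p. pt (k p) (q (k p)) i) \<longlonglongrightarrow> x i"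
    by (metis lessThan_iff)
  \<comment> \<open>Every corner of the chosen cells has the same limit, as the edges shrink like
    \<open>1 / Suc p\<close>.\<close>
  have near: "(\<lambda>p. pt (k p) (v p) j) \<longlonglongrightarrow> x j"
    if v: "\<And>p. q (k p) j \<le> v p j \<and> v p j \<le> q (k p) j + 1" and j: "j < n" for v j
  proof -
    have z: "(\<lambda>p. (hi j - lo j) * (1 / real (Suc (k p)))) \<longlonglongrightarrow> (hi j - lo j) * 0"
      using LIMSEQ_subseq_LIMSEQ[OF lim_1_over_n[THEN LIMSEQ_Suc] k]
      by (intro tendsto_mult tendsto_const) (simp add: o_def)
    have "(\<lambda>p. pt (k p) (v p) j - pt (k p) (q (k p)) j) \<longlonglongrightarrow> 0"
    proof (rule real_tendsto_sandwich)
      have *: "pt (k p) (v p) j - pt (k p) (q (k p)) j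
          = (hi j - lo j) * ((real (v p j) - real (q (k p) j)) / real (Suc (k p)))" for p
        by (simp add: pt_def right_diff_distrib diff_divide_distrib)
      have **: "0 \<le> real (v p j) - real (q (k p) j)" "real (v p j) - real (q (k p) j) \<le> 1" for p
        using v[of p] by linarith+
      show "\<forall>\<^sub>F p in sequentially. 0 \<le> pt (k p) (v p) j - pt (k p) (q (k p)) j"
        unfolding * using ** le[OF j] by (intro always_eventually allI mult_nonneg_nonneg divide_nonneg_nonneg) auto
      show "\<forall>\<^sub>F p in sequentially. pt (k p) (v p) j - pt (k p) (q (k p)) j \<le> (hi j - lo j) * (1 / real (Suc (k p)))"
        unfolding * using ** le[OF j] by (intro always_eventually allI mult_left_mono divide_right_mono) auto
      show "(\<lambda>p. 0::real) \<longlonglongrightarrow> 0" by simp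
      show "(\<lambda>p. (hi j - lo j) * (1 / real (Suc (k p)))) \<longlonglongrightarrow> 0" using z by simp
    qed
    from tendsto_add[OF this x[OF j]] show ?thesis by simp
  qed
  have xbox: "lo i \<le> x i \<and> x i \<le> hi i" if "i < n" for i
  proof
    have *: "lo i \<le> pt (k p) (q (k p)) i \<and> pt (k p) (q (k p)) i \<le> hi i" for p
      using ptbox[of "q (k p)" i "k p"] q[of i "k p"] that by auto
    show "lo i \<le> x i" by (rule LIMSEQ_le_const[OF x[OF that]]) (use * in blast)
    show "x i \<le> hi i" by (rule LIMSEQ_le_const2[OF x[OF that]]) (use * in blast)
  qed
  have lim: "(\<lambda>p. F (pt (k p) (v p)) i) \<longlonglongrightarrow> F x i" and limi: "(\<lambda>p. pt (k p) (v p) i) \<longlonglongrightarrow> x i"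
    if i: "i < n" and v: "\<And>p j. j < n \<Longrightarrow> q (k p) j \<le> v p j \<and> v p j \<le> q (k p) j + 1" for v i
  proof -
    show "(\<lambda>p. F (pt (k p) (v p)) i) \<longlonglongrightarrow> F x i"
    proof (rule cont[OF i])
      show "lo j \<le> pt (k p) (v p) j \<and> pt (k p) (v p) j \<le> hi j" if "j < n" for p j
        using ptbox[of "v p" j "k p"] v[OF that, of p] q[OF that, of "k p"] that by auto
    qed (use xbox near v in auto)
    show "(\<lambda>p. pt (k p) (v p) i) \<longlonglongrightarrow> x i" using near v i by blast
  qed
  show ?thesis
  proof (rule that[of x])
    fix i assume i: "i < n"
    show "lo i \<le> x i \<and> x i \<le> hi i" by (rule xbox[OF i])
    \<comment> \<open>The corners \<open>r\<close> carry label 0, which away from the lower face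
      means that \<open>F\<close> is nonpositive. The corners \<open>s\<close> with label 1 give the
      opposite inequality.\<close>
    show "F x i \<le> 0 \<or> x i = lo i"
    proof (rule ccontr)
      assume "\<not> ?thesis"
      then have c: "F x i > 0" "x i > lo i" using xbox[OF i] by auto
      note L = lim[OF i, of "\<lambda>p. r (k p) i"] limi[OF i, of "\<lambda>p. r (k p) i"]
      have "\<forall>\<^sub>F p in sequentially. F (pt (k p) (r (k p) i)) i > 0"
        "\<forall>\<^sub>F p in sequentially. pt (k p) (r (k p) i) i > lo i"
        using order_tendstoD(1)[OF L(1) c(1)] order_tendstoD(1)[OF L(2) c(2)] r[OF i] by blast+
      then have "\<forall>\<^sub>F p in sequentially. False"
      proof eventually_elim
        case (elim p)
        have "r (k p) i i \<noteq> 0"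
        proof
          assume "r (k p) i i = 0"
          then show False using elim(2) by (simp add: pt_def)
        qed
        then show False using lr[OF i, of "k p"] elim(1) by (auto simp: lab_def split: if_splits)
      qed
      then show False by simp
    qed
    show "0 \<le> F x i \<or> x i = hi i"
    proof (rule ccontr)
      assume "\<not> ?thesis"
      then have c: "F x i < 0" "x i < hi i" using xbox[OF i] by auto
      note L = lim[OF i, of "\<lambda>p. s (k p) i"] limi[OF i, of "\<lambda>p. s (k p) i"]
      have "\<forall>\<^sub>F p in sequentially. F (pt (k p) (s (k p) i)) i < 0"
        "\<forall>\<^sub>F p in sequentially. pt (k p) (s (k p) i) i < hi i"
        using order_tendstoD(2)[OF L(1) c(1)] order_tendstoD(2)[OF L(2) c(2)] s[OF i] by blast+
      then have "\<forall>\<^sub>F p in sequentially. False"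
      proof eventually_elim
        case (elim p)
        have "s (k p) i i \<noteq> Suc (k p)"
        proof
          assume *: "s (k p) i i = Suc (k p)"
          have "real (Suc (k p)) / real (Suc (k p)) = 1" by simp
          then show False using elim(2) unfolding pt_def * by simp
        qed
        then show False using ls[OF i, of "k p"] elim(1) by (auto simp: lab_def split: if_splits)
      qed
      then show False by simp
    qed
  qed
qed

section \<open>Absolute continuity and indefinite integrals\<close>

text \<open>The gauge integral allows a direct proof: tags outside \<open>N\<close> are handled by
  differentiability, and the intervals with tags in \<open>N\<close> have small total length, so
  absolute continuity bounds the increments of \<open>f\<close> over them.\<close>

lemma abs_continuous_has_integral:
  assumes ac: "abs_continuous_on {a..b} f" and ab: "a \<le> b" and N: "negligible N"
    and D: "\<And>t. t \<in> {a..b} - N \<Longrightarrow> (f has_real_derivative f' t) (at t)"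
  shows "(f' has_integral f b - f a) {a..b}"
proof -
  define g where "g t = (if t \<in> N then 0 else f' t)" for t
  have "(g has_integral f b - f a) (cbox a b)"
    unfolding has_integral
  proof (intro allI impI)
    fix e :: real assume e: "e > 0"
    define e' where "e' = e / (2 * (b - a + 1))"
    have e': "e' > 0" "e' * (b - a) < e / 2"
      using e ab by (auto simp: e'_def field_simps)
    have "e / 2 > 0" using e by simp
    then obtain d where d: "d > 0"
      "\<And>P. finite P \<Longrightarrow> (\<forall>(u, v)\<in>P. u \<le> v \<and> {u..v} \<subseteq> {a..b}) \<Longrightarrow>
        pairwise (\<lambda>p q. disjnt {fst p<..<snd p} {fst q<..<snd q}) P \<Longrightarrow>
        (\<Sum>(u, v)\<in>P. v - u) < d \<Longrightarrow> (\<Sum>(u, v)\<in>P. \<bar>f v - f u\<bar>) < e / 2"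
      using ac unfolding abs_continuous_on_def by meson
    obtain G where G: "open G" "N \<subseteq> G" "G - N \<in> lmeasurable" "emeasure lebesgue (G - N) < ennreal d"
      using sets_lebesgue_outer_open[OF negligible_imp_sets[OF N] d(1)] by metis
    have Gm: "G \<in> lmeasurable" "measure lebesgue G < d"
    proof -
      have G_eq: "G = (G - N) \<union> N" using G(2) by auto
      have Nm: "N \<in> lmeasurable" using N by (rule negligible_imp_measurable)
      show Gl: "G \<in> lmeasurable" using fmeasurable.Un[OF G(3) Nm] G_eq by simp
      have "measure lebesgue G = measure lebesgue (G - N)"
        by (rule measure_negligible_symdiff[OF G(3)])
          (use N negligible_subset in \<open>auto intro: negligible_subset[OF N]\<close>)
      also have "\<dots> < d"
        using G(3,4) d(1) by (simp add: emeasure_eq_measure2 ennreal_less_iff)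
      finally show "measure lebesgue G < d" .
    qed
    \<comment> \<open>The gauge traps intervals tagged in \<open>N\<close> inside the open set
      \<open>G\<close>, whose measure is below the modulus \<open>d\<close> of absolute continuity,
      and yields the first-order expansion at all other tags.\<close>
    have "\<exists>\<delta>>0. (t \<in> N \<longrightarrow> ball t \<delta> \<subseteq> G) \<and>
        (t \<in> {a..b} - N \<longrightarrow> (\<forall>s. \<bar>s - t\<bar> < \<delta> \<longrightarrow> \<bar>f s - f t - g t * (s - t)\<bar> \<le> e' * \<bar>s - t\<bar>))" for t
    proof (cases "t \<in> N")
      case True
      then show ?thesis using G(1,2) by (meson open_contains_ball subsetD DiffE)
    next
      case False
      show ?thesis
      proof (cases "t \<in> {a..b}")
        case True
        then have "(f has_derivative (\<lambda>h. h * f' t)) (at t)"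
          using D[of t] False unfolding has_field_derivative_def
          by (metis (no_types, lifting) Diff_iff ext mult.commute)
        then have "\<exists>\<delta>>0. \<forall>s. norm (s - t) < \<delta> \<longrightarrow> norm (f s - f t - (s - t) * f' t) \<le> e' * norm (s - t)"
          using e'(1) unfolding has_derivative_at_alt by blast
        then obtain \<delta> where "\<delta> > 0"
          "\<And>s. \<bar>s - t\<bar> < \<delta> \<Longrightarrow> \<bar>f s - f t - (s - t) * f' t\<bar> \<le> e' * \<bar>s - t\<bar>" by auto
        then show ?thesis using False by (intro exI[of _ \<delta>]) (auto simp: g_def mult.commute)
      qed (use False in \<open>auto intro: exI[of _ 1]\<close>)
    qed
    then obtain \<delta> where \<delta>: "\<And>t. \<delta> t > 0" "\<And>t. t \<in> N \<Longrightarrow> ball t (\<delta> t) \<subseteq> G"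
      "\<And>t s. t \<in> {a..b} - N \<Longrightarrow> \<bar>s - t\<bar> < \<delta> t \<Longrightarrow> \<bar>f s - f t - g t * (s - t)\<bar> \<le> e' * \<bar>s - t\<bar>"
      by metis
    show "\<exists>\<gamma>. gauge \<gamma> \<and> (\<forall>\<D>. \<D> tagged_division_of cbox a b \<and> \<gamma> fine \<D> \<longrightarrow>
        norm ((\<Sum>(x, k)\<in>\<D>. measure lborel k *\<^sub>R g x) - (f b - f a)) < e)"
    proof (intro exI conjI allI impI)
      show "gauge (\<lambda>t. ball t (\<delta> t))" using \<delta>(1) by (auto simp: gauge_def)
      fix P assume "P tagged_division_of cbox a b \<and> (\<lambda>t. ball t (\<delta> t)) fine P"
      then have P: "P tagged_division_of cbox a b" and fine: "\<And>x K. (x, K) \<in> P \<Longrightarrow> K \<subseteq> ball x (\<delta> x)"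
        by (auto simp: fine_def)
      note Pd = tagged_division_ofD[OF P]
      have K: "x \<in> {a..b} \<and> Inf K \<le> x \<and> x \<le> Sup K \<and> K = {Inf K..Sup K} \<and> measure lborel K = Sup K - Inf K \<and>
          \<bar>Sup K - x\<bar> < \<delta> x \<and> \<bar>Inf K - x\<bar> < \<delta> x \<and> Inf K \<le> Sup K \<and> {Inf K..Sup K} \<subseteq> {a..b}"
        if xK: "(x, K) \<in> P" for x K
      proof -
        obtain u v where uv: "K = {u..v}" using Pd(4)[OF xK] by auto
        have "x \<in> K" "K \<subseteq> {a..b}" using Pd(2,3)[OF xK] by auto
        moreover from this uv have "u \<le> v" by auto
        moreover from this uv have "u \<in> K" "v \<in> K" by auto
        with fine[OF xK] have "u \<in> ball x (\<delta> x)" "v \<in> ball x (\<delta> x)" by auto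
        ultimately show ?thesis using uv by (auto simp: dist_real_def abs_minus_commute)
      qed
      have Kl: "measure lebesgue K = Sup K - Inf K" "K \<in> lmeasurable" if xK: "(x, K) \<in> P" for x K
      proof -
        obtain u v where uv: "K = {u..v}" using Pd(4)[OF xK] by auto
        moreover have "u \<le> v" using Pd(2)[OF xK] uv by auto
        ultimately show "measure lebesgue K = Sup K - Inf K" "K \<in> lmeasurable" by auto
      qed
      have fb: "f b - f a = (\<Sum>(x, K)\<in>P. f (Sup K) - f (Inf K))"
        using additive_tagged_division_1[of a b P f] ab P by simp
      \<comment> \<open>Degenerate intervals are left out: an interval with interior occurs in
        \<open>P\<close> with one tag only, which makes the passage from tagged intervals to pairs
        of end points injective.\<close>
      define Q where "Q = {(x, K) \<in> P. x \<in> N \<and> Inf K < Sup K}"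
      have Qf: "finite Q" using Pd(1) by (auto simp: Q_def intro: finite_subset)
      have est: "\<bar>measure lborel K * g x - (f (Sup K) - f (Inf K))\<bar> \<le> e' * measure lborel K +
          (if (x, K) \<in> Q then \<bar>f (Sup K) - f (Inf K)\<bar> else 0)" if xK: "(x, K) \<in> P" for x K
      proof (cases "x \<in> N")
        case True
        have "0 \<le> e' * measure lborel K" using e'(1) by simp
        moreover have "Inf K = Sup K" if "\<not> Inf K < Sup K" using K[OF xK] that by linarith
        ultimately show ?thesis using True xK by (auto simp: Q_def g_def)
      next
        case False
        have cK: "measure lborel K = Sup K - Inf K" using K[OF xK] by blast
        have "\<bar>Sup K - x\<bar> = Sup K - x" "\<bar>Inf K - x\<bar> = x - Inf K" using K[OF xK] by auto
        then have "\<bar>f (Sup K) - f x - g x * (Sup K - x)\<bar> \<le> e' * (Sup K - x)"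
          "\<bar>f (Inf K) - f x - g x * (Inf K - x)\<bar> \<le> e' * (x - Inf K)"
          using \<delta>(3)[of x "Sup K"] \<delta>(3)[of x "Inf K"] K[OF xK] False by (metis Diff_iff)+
        moreover have "measure lborel K * g x = g x * (Sup K - x) - g x * (Inf K - x)"
          unfolding cK by (simp add: algebra_simps)
        moreover have "e' * measure lborel K = e' * (Sup K - x) + e' * (x - Inf K)"
          unfolding cK by (simp add: algebra_simps)
        ultimately have "\<bar>measure lborel K * g x - (f (Sup K) - f (Inf K))\<bar> \<le> e' * measure lborel K" by linarith
        then show ?thesis using False by (simp add: Q_def)
      qed
      define h where "h = (\<lambda>(x::real, K::real set). (Inf K, Sup K))"
      have inj: "inj_on h Q"
      proof (rule inj_onI, clarify)
        fix x K x' K' assume *: "(x, K) \<in> Q" "(x', K') \<in> Q" "h (x, K) = h (x', K')"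
        then have "K = K'" using K[of x K] K[of x' K'] by (auto simp: Q_def h_def)
        moreover have "interior K \<noteq> {}"
        proof -
          have "K = {Inf K..Sup K}" "Inf K < Sup K" using * K[of x K] by (auto simp: Q_def)
          then show ?thesis by (metis greaterThanLessThan_empty_iff interior_atLeastAtMost_real not_le)
        qed
        ultimately show "x = x' \<and> K = K'" using Pd(5)[of x K x' K'] * by (auto simp: Q_def)
      qed
      have sums: "(\<Sum>(u, v)\<in>h ` Q. F u v) = (\<Sum>(x, K)\<in>Q. F (Inf K) (Sup K))" for F :: "real \<Rightarrow> real \<Rightarrow> real"
        by (subst sum.reindex[OF inj]) (auto simp: h_def intro!: sum.cong)
      have "(\<Sum>(u, v)\<in>h ` Q. \<bar>f v - f u\<bar>) < e / 2"
      proof (rule d(2))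
        show "finite (h ` Q)" using Qf by simp
        show "\<forall>(u, v)\<in>h ` Q. u \<le> v \<and> {u..v} \<subseteq> {a..b}"
          using K by (auto simp: Q_def h_def)
        have disj: "disjnt {Inf K<..<Sup K} {Inf K'<..<Sup K'}"
          if "(x, K) \<in> Q" "(x', K') \<in> Q" "(x, K) \<noteq> (x', K')" for x K x' K'
        proof -
          have "interior K \<inter> interior K' = {}" using Pd(5)[of x K x' K'] that by (auto simp: Q_def)
          moreover have "K = {Inf K..Sup K}" "K' = {Inf K'..Sup K'}"
            using K[of x K] K[of x' K'] that by (auto simp: Q_def)
          ultimately show ?thesis unfolding disjnt_def by (metis interior_atLeastAtMost_real)
        qed
        show "pairwise (\<lambda>p q. disjnt {fst p<..<snd p} {fst q<..<snd q}) (h ` Q)"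
        proof (rule pairwise_imageI)
          fix p q assume "p \<in> Q" "q \<in> Q" "p \<noteq> q"
          then show "disjnt {fst (h p)<..<snd (h p)} {fst (h q)<..<snd (h q)}"
            using disj[of "fst p" "snd p" "fst q" "snd q"] by (simp add: h_def split_beta)
        qed
        have "(\<Sum>(x, K)\<in>Q. Sup K - Inf K) = (\<Sum>p\<in>Q. measure lebesgue (snd p))"
          using Kl(1) by (intro sum.cong refl) (auto simp: Q_def)
        also have "\<dots> = measure lebesgue (\<Union>(snd ` Q))"
        proof (rule measure_negligible_finite_Union_image[symmetric, OF Qf])
          show "snd p \<in> lmeasurable" if "p \<in> Q" for p
            using Kl(2) that by (auto simp: Q_def)
          show "pairwise (\<lambda>p q. negligible (snd p \<inter> snd q)) Q"
          proof (rule pairwiseI)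
            fix p q assume pq: "p \<in> Q" "q \<in> Q" "p \<noteq> q"
            have Kp: "snd p = {Inf (snd p)..Sup (snd p)}" "snd q = {Inf (snd q)..Sup (snd q)}"
              using K[of "fst p" "snd p"] K[of "fst q" "snd q"] pq by (auto simp: Q_def)
            have "snd p \<inter> snd q \<subseteq> {Inf (snd p), Sup (snd p), Inf (snd q), Sup (snd q)}"
            proof
              fix s assume s: "s \<in> snd p \<inter> snd q"
              have "\<not> (s \<in> {Inf (snd p)<..<Sup (snd p)} \<and> s \<in> {Inf (snd q)<..<Sup (snd q)})"
                using disj[of "fst p" "snd p" "fst q" "snd q"] pq by (auto simp: disjnt_iff)
              moreover have "s \<in> {Inf (snd p)..Sup (snd p)}" "s \<in> {Inf (snd q)..Sup (snd q)}"
                using s Kp by auto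
              ultimately show "s \<in> {Inf (snd p), Sup (snd p), Inf (snd q), Sup (snd q)}" by auto
            qed
            then show "negligible (snd p \<inter> snd q)"
              by (rule negligible_subset[rotated]) (auto intro: negligible_finite)
          qed
        qed
        also have "\<dots> \<le> measure lebesgue G"
        proof (rule measure_mono_fmeasurable)
          show "\<Union>(snd ` Q) \<subseteq> G"
          proof (clarsimp simp: Q_def)
            fix s x K assume "s \<in> K" "(x, K) \<in> P" "x \<in> N"
            then show "s \<in> G" using fine \<delta>(2) by blast
          qed
          show "\<Union>(snd ` Q) \<in> sets lebesgue"
          proof (rule sets.finite_Union)
            show "snd ` Q \<subseteq> sets lebesgue" using Pd(4) by (fastforce simp: Q_def)
          qed (use Qf in simp)
        qed (rule Gm)
        also have "\<dots> < d" by (rule Gm)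
        finally show "(\<Sum>(u, v)\<in>h ` Q. v - u) < d" by (simp add: sums)
      qed
      then have small: "(\<Sum>(x, K)\<in>Q. \<bar>f (Sup K) - f (Inf K)\<bar>) < e / 2" by (simp add: sums)
      have "norm ((\<Sum>(x, K)\<in>P. measure lborel K *\<^sub>R g x) - (f b - f a))
          = \<bar>\<Sum>(x, K)\<in>P. measure lborel K * g x - (f (Sup K) - f (Inf K))\<bar>"
        by (simp add: fb sum_subtractf split_beta)
      also have "\<dots> \<le> (\<Sum>(x, K)\<in>P. \<bar>measure lborel K * g x - (f (Sup K) - f (Inf K))\<bar>)"
        unfolding split_beta by (rule sum_abs)
      also have "\<dots> \<le> (\<Sum>(x, K)\<in>P. e' * measure lborel K + (if (x, K) \<in> Q then \<bar>f (Sup K) - f (Inf K)\<bar> else 0))"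
        using est by (intro sum_mono) auto
      also have "\<dots> = e' * (\<Sum>(x, K)\<in>P. measure lborel K) +
          (\<Sum>(x, K)\<in>P. (if (x, K) \<in> Q then \<bar>f (Sup K) - f (Inf K)\<bar> else 0))"
        by (simp add: split_beta sum.distrib sum_distrib_left)
      also have "(\<Sum>(x, K)\<in>P. measure lborel K) = b - a"
        using additive_content_tagged_division[OF P] ab by simp
      also have "(\<Sum>(x, K)\<in>P. (if (x, K) \<in> Q then \<bar>f (Sup K) - f (Inf K)\<bar> else 0))
          = (\<Sum>(x, K)\<in>Q. \<bar>f (Sup K) - f (Inf K)\<bar>)"
        by (rule sum.mono_neutral_cong_right) (use Pd(1) in \<open>auto simp: Q_def split: if_splits\<close>)
      finally show "norm ((\<Sum>(x, K)\<in>P. measure lborel K *\<^sub>R g x) - (f b - f a)) < e"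
        using small e'(2) by linarith
    qed
  qed
  then show ?thesis
    using has_integral_spike_eq[OF N, of "{a..b}" g f' "f b - f a"] by (auto simp: g_def)
qed

text \<open>Lebesgue differentiation is available for right difference quotients. Applied to
  \<open>f\<close> and to its reflection at 0 it gives both one-sided derivatives off a null
  set.\<close>

lemma indefinite_integral_derivative_AE:
  fixes f F :: "real \<Rightarrow> real"
  assumes F: "\<And>s t. s \<le> t \<Longrightarrow> (f has_integral F t - F s) {s..t}"
  shows "AE t in lebesgue. (F has_real_derivative f t) (at t)"
proof -
  have right: "\<exists>N. negligible N \<and> (\<forall>t e. t \<notin> N \<longrightarrow> e > 0 \<longrightarrow>
      (\<exists>d>0. \<forall>h. 0 < h \<and> h < d \<longrightarrow> \<bar>(H (t + h) - H t) / h - k t\<bar> < e))"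
    if H: "\<And>s t. s \<le> t \<Longrightarrow> (k has_integral H t - H s) {s..t}" for k H :: "real \<Rightarrow> real"
  proof -
    have "k integrable_on cbox a b" for a b
      by (cases "a \<le> b") (use H in auto)
    then obtain N where N: "negligible N"
      "\<And>t e. t \<notin> N \<Longrightarrow> 0 < e \<Longrightarrow> \<exists>d>0. \<forall>h. 0 < h \<and> h < d \<longrightarrow>
        norm (integral (cbox t (t + h *\<^sub>R One)) k /\<^sub>R h ^ DIM(real) - k t) < e"
      by (rule integrable_ccontinuous_explicit[of k]) blast
    have "integral {t..t + h} k = H (t + h) - H t" if "0 < h" for t h
      using H[of t "t + h"] that by (intro integral_unique) auto
    then show ?thesis using N by (intro exI[of _ N]) (fastforce simp: divide_inverse mult.commute)
  qed
  obtain N1 where N1: "negligible N1" "\<And>t e. t \<notin> N1 \<Longrightarrow> e > 0 \<Longrightarrow>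
      \<exists>d>0. \<forall>h. 0 < h \<and> h < d \<longrightarrow> \<bar>(F (t + h) - F t) / h - f t\<bar> < e"
    using right[OF F] by blast
  have "((\<lambda>t. f (- t)) has_integral (- F (- t)) - (- F (- s))) {s..t}" if "s \<le> t" for s t
    using F[of "- t" "- s"] that has_integral_reflect_real[of f "F (- s) - F (- t)" "- s" "- t"] by simp
  from right[OF this] obtain N2 where N2: "negligible N2" "\<And>t e. t \<notin> N2 \<Longrightarrow> e > 0 \<Longrightarrow>
      \<exists>d>0. \<forall>h. 0 < h \<and> h < d \<longrightarrow> \<bar>(- F (- (t + h)) - (- F (- t))) / h - f (- t)\<bar> < e"
    by blast
  have "negligible (uminus ` N2)" 
    by (rule negligible_differentiable_image_negligible[OF order_refl N2(1)])
      (auto intro!: differentiable_on_minus differentiable_on_id)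
  then have N: "negligible (N1 \<union> uminus ` N2)" using N1(1) by (rule negligible_Un[rotated])
  have "(F has_real_derivative f t) (at t)" if t: "t \<notin> N1 \<union> uminus ` N2" for t
    unfolding DERIV_def LIM_def
  proof (intro allI impI)
    fix e :: real assume e: "e > 0"
    have t2: "- t \<notin> N2" using t by (metis UnCI image_eqI minus_minus)
    obtain d1 where d1: "d1 > 0" "\<And>h. 0 < h \<Longrightarrow> h < d1 \<Longrightarrow> \<bar>(F (t + h) - F t) / h - f t\<bar> < e"
      using N1(2)[of t e] t e by auto
    obtain d2 where d2: "d2 > 0" "\<And>h. 0 < h \<Longrightarrow> h < d2 \<Longrightarrow> \<bar>(- F (- (- t + h)) - (- F (- (- t)))) / h - f (- (- t))\<bar> < e"
      using N2(2)[OF t2 e] by auto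
    have "dist ((F (t + h) - F t) / h) (f t) < e" if h: "h \<noteq> 0" "dist h 0 < min d1 d2" for h
    proof (cases "h > 0")
      case True
      then show ?thesis using d1(2)[of h] h by (simp add: dist_real_def)
    next
      case False
      then have "\<bar>(- F (t - (- h)) + F t) / (- h) - f t\<bar> < e"
        using d2(2)[of "- h"] h by (simp add: dist_real_def add.commute)
      moreover have "(- F (t - (- h)) + F t) / (- h) = (F (t + h) - F t) / h" using h(1) by (simp add: divide_simps)
      ultimately show ?thesis unfolding dist_real_def by metis
    qed
    then show "\<exists>d>0. \<forall>h. h \<noteq> 0 \<and> dist h 0 < d \<longrightarrow> dist ((F (t + h) - F t) / h) (f t) < e"
      using d1(1) d2(1) by (intro exI[of _ "min d1 d2"]) auto
  qed
  then show ?thesis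
    using N unfolding eventually_ae_filter negligible_iff_null_sets by (intro bexI[of _ "N1 \<union> uminus ` N2"]) auto
qed

text \<open>Truncation: \<open>|f|\<close> is a part bounded by \<open>n\<close>, which contributes
  at most \<open>n\<close> times the total length, plus a remainder \<open>h\<close> whose whole
  integral is small by dominated convergence.\<close>

lemma indefinite_integral_abs_continuous:
  fixes f F :: "real \<Rightarrow> real"
  assumes f: "f absolutely_integrable_on {a..b}"
    and F: "\<And>s t. a \<le> s \<Longrightarrow> s \<le> t \<Longrightarrow> t \<le> b \<Longrightarrow> (f has_integral F t - F s) {s..t}"
  shows "abs_continuous_on {a..b} F"
  unfolding abs_continuous_on_def
proof (intro allI impI)
  fix e :: real assume e: "e > 0"
  define g where "g n t = min \<bar>f t\<bar> (real n)" for n t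
  have af: "(\<lambda>t. \<bar>f t\<bar>) absolutely_integrable_on {a..b}"
    using absolutely_integrable_norm[OF f] by (simp add: o_def)
  have g: "(g n) absolutely_integrable_on {a..b}" for n
    unfolding g_def using absolutely_integrable_min_1[OF af, of "\<lambda>_. real n"] by (simp add: absolutely_integrable_on_const)
  have gi: "g n integrable_on {a..b}" "(\<lambda>t. \<bar>f t\<bar>) integrable_on {a..b}" for n
    using g af by (auto simp: absolutely_integrable_on_def)
  have "(\<lambda>n. integral {a..b} (g n)) \<longlonglongrightarrow> integral {a..b} (\<lambda>t. \<bar>f t\<bar>)"
  proof (rule dominated_convergence(2))
    show "norm (g n t) \<le> \<bar>f t\<bar>" for n t by (simp add: g_def)
    show "(\<lambda>n. g n t) \<longlonglongrightarrow> \<bar>f t\<bar>" for t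
    proof (rule tendsto_eventually)
      obtain N where "\<bar>f t\<bar> \<le> real N" using real_arch_simple by blast
      then show "\<forall>\<^sub>F n in sequentially. g n t = \<bar>f t\<bar>"
        by (intro eventually_sequentiallyI[of N]) (simp add: g_def min_def)
    qed
  qed (use gi in auto)
  then have "\<forall>\<^sub>F n in sequentially. dist (integral {a..b} (g n)) (integral {a..b} (\<lambda>t. \<bar>f t\<bar>)) < e / 2"
    using e by (intro tendstoD) auto
  from eventually_happens'[OF sequentially_bot this]
  obtain n where n: "\<bar>integral {a..b} (g n) - integral {a..b} (\<lambda>t. \<bar>f t\<bar>)\<bar> < e / 2"
    by (auto simp: dist_real_def)
  define h where "h t = \<bar>f t\<bar> - g n t" for t
  have h0: "0 \<le> h t" for t by (simp add: h_def g_def)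
  have hi: "h integrable_on {a..b}" unfolding h_def by (intro integrable_diff gi)
  have hI: "integral {a..b} h < e / 2"
    using n integral_diff[OF gi(2) gi(1)[of n]] unfolding h_def by linarith
  define d where "d = e / (2 * (real n + 1))"
  have d: "d > 0" "real n * d < e / 2" using e by (auto simp: d_def field_simps)
  show "\<exists>d>0. \<forall>D. finite D \<and> (\<forall>(u, v)\<in>D. u \<le> v \<and> {u..v} \<subseteq> {a..b}) \<and>
      pairwise (\<lambda>p q. disjnt {fst p<..<snd p} {fst q<..<snd q}) D \<and> (\<Sum>(u, v)\<in>D. v - u) < d
      \<longrightarrow> (\<Sum>(u, v)\<in>D. \<bar>F v - F u\<bar>) < e"
  proof (intro exI[of _ d] conjI allI impI d(1))
    fix D :: "(real \<times> real) set"
    assume "finite D \<and> (\<forall>(u, v)\<in>D. u \<le> v \<and> {u..v} \<subseteq> {a..b}) \<and>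
      pairwise (\<lambda>p q. disjnt {fst p<..<snd p} {fst q<..<snd q}) D \<and> (\<Sum>(u, v)\<in>D. v - u) < d"
    then have D: "finite D" "\<And>u v. (u, v) \<in> D \<Longrightarrow> u \<le> v \<and> {u..v} \<subseteq> {a..b}"
      "pairwise (\<lambda>p q. disjnt {fst p<..<snd p} {fst q<..<snd q}) D" "(\<Sum>(u, v)\<in>D. v - u) < d"
      by auto
    have each: "\<bar>F v - F u\<bar> \<le> integral {u..v} h + real n * (v - u)" and hint: "h integrable_on {u..v}"
      if uv: "(u, v) \<in> D" for u v
    proof -
      have sub: "{u..v} \<subseteq> {a..b}" and le: "u \<le> v" using D(2)[OF uv] by auto
      then have "a \<le> u" "v \<le> b" by auto
      note I = F[OF \<open>a \<le> u\<close> le \<open>v \<le> b\<close>]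
      show hint: "h integrable_on {u..v}" using integrable_on_subinterval[OF hi sub] .
      have "norm (integral {u..v} f) \<le> integral {u..v} (\<lambda>t. h t + real n)"
      proof (rule integral_norm_bound_integral)
        show "f integrable_on {u..v}" using I by auto
        show "(\<lambda>t. h t + real n) integrable_on {u..v}" by (intro integrable_add hint) auto
        show "norm (f t) \<le> h t + real n" for t by (simp add: h_def g_def)
      qed
      also have "\<dots> = integral {u..v} h + real n * (v - u)"
        using le by (subst integral_add[OF hint]) auto
      finally show "\<bar>F v - F u\<bar> \<le> integral {u..v} h + real n * (v - u)"
        using integral_unique[OF I] by simp
    qed
    have U: "(h has_integral (\<Sum>p\<in>D. integral {fst p..snd p} h)) (\<Union>p\<in>D. {fst p..snd p})"
    proof (rule has_integral_UN[OF D(1)])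
      show "(h has_integral integral {fst p..snd p} h) {fst p..snd p}" if "p \<in> D" for p
        using hint[of "fst p" "snd p"] that by (simp add: integrable_integral)
      show "pairwise (\<lambda>p q. negligible ({fst p..snd p} \<inter> {fst q..snd q})) D"
      proof (rule pairwiseI)
        fix p q assume pq: "p \<in> D" "q \<in> D" "p \<noteq> q"
        then have dj: "disjnt {fst p<..<snd p} {fst q<..<snd q}" using D(3) by (auto simp: pairwise_def)
        have "{fst p..snd p} \<inter> {fst q..snd q} \<subseteq> {fst p, snd p, fst q, snd q}"
        proof
          fix s assume s: "s \<in> {fst p..snd p} \<inter> {fst q..snd q}"
          have "\<not> (s \<in> {fst p<..<snd p} \<and> s \<in> {fst q<..<snd q})" using dj by (auto simp: disjnt_iff)
          then show "s \<in> {fst p, snd p, fst q, snd q}" using s by auto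
        qed
        then show "negligible ({fst p..snd p} \<inter> {fst q..snd q})"
          by (rule negligible_subset[rotated]) (auto intro: negligible_finite)
      qed
    qed
    have "(\<Sum>p\<in>D. integral {fst p..snd p} h) \<le> integral {a..b} h"
    proof (rule has_integral_subset_le[OF _ U integrable_integral[OF hi]])
      show "(\<Union>p\<in>D. {fst p..snd p}) \<subseteq> {a..b}" using D(2) by fastforce
    qed (use h0 in auto)
    moreover have "(\<Sum>(u, v)\<in>D. \<bar>F v - F u\<bar>) \<le> (\<Sum>(u, v)\<in>D. integral {u..v} h + real n * (v - u))"
      using each by (intro sum_mono) auto
    moreover have "(\<Sum>(u, v)\<in>D. integral {u..v} h + real n * (v - u))
        = (\<Sum>p\<in>D. integral {fst p..snd p} h) + real n * (\<Sum>(u, v)\<in>D. v - u)"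
      by (simp add: split_beta sum.distrib sum_distrib_left)
    moreover have "real n * (\<Sum>(u, v)\<in>D. v - u) \<le> real n * d" using D(4) by (intro mult_left_mono) auto
    ultimately show "(\<Sum>(u, v)\<in>D. \<bar>F v - F u\<bar>) < e" using hI d(2) by linarith
  qed
qed

section \<open>Solutions in integrated form\<close>

text \<open>This form passes to limits by dominated convergence, survives changes of
  \<open>f\<close> on null sets and can be glued at end points. The force is a function of time
  alone, so the same notion covers the modified equations.\<close>

definition integral_solution :: "(real \<Rightarrow> real) \<Rightarrow> (real \<Rightarrow> real) \<Rightarrow> (real \<Rightarrow> real) \<Rightarrow> bool" where
  "integral_solution f x y \<longleftrightarrow> (\<forall>s t. s \<le> t \<longrightarrow>
     (y has_integral x t - x s) {s..t} \<and> (f has_integral y t - y s) {s..t})"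

lemma has_integral_imp_continuous_on:
  fixes f F :: "real \<Rightarrow> real"
  assumes F: "\<And>s t. s \<le> t \<Longrightarrow> (f has_integral F t - F s) {s..t}"
  shows "continuous_on S F"
proof -
  have "isCont F t" for t
  proof -
    have fi: "f integrable_on {t - 1..t + 1}" using F[of "t - 1" "t + 1"] by auto
    have "continuous_on {t - 1..t + 1} (\<lambda>s. F (t - 1) + integral {t - 1..s} f)"
      by (intro continuous_intros indefinite_integral_continuous_1 fi)
    moreover have "F (t - 1) + integral {t - 1..s} f = F s" if "s \<in> {t - 1..t + 1}" for s
      using integral_unique[OF F[of "t - 1" s]] that by simp
    ultimately have "continuous_on {t - 1..t + 1} F" by (rule continuous_on_eq)
    then have "continuous_on {t - 1<..<t + 1} F" by (rule continuous_on_subset) auto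
    then show ?thesis by (simp add: continuous_on_eq_continuous_at)
  qed
  then show ?thesis by (simp add: continuous_at_imp_continuous_on)
qed

lemma integral_solutionD:
  assumes "integral_solution f x y"
  shows "\<And>s t. s \<le> t \<Longrightarrow> (y has_integral x t - x s) {s..t}"
    and "\<And>s t. s \<le> t \<Longrightarrow> (f has_integral y t - y s) {s..t}"
    and "continuous_on S x" and "continuous_on S y"
  using assms has_integral_imp_continuous_on[of y x S] has_integral_imp_continuous_on[of f y S]
  unfolding integral_solution_def by auto

text \<open>Continuity of \<open>y\<close> makes \<open>x\<close> continuously differentiable, so
  the derivative exists at every time, as \<open>second_order_solution\<close> demands.\<close>

lemma integral_solution_deriv:
  assumes "integral_solution f x y"
  shows "(x has_real_derivative y t) (at t)"
proof -
  note D = integral_solutionD[OF assms]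
  have "((\<lambda>s. integral {t - 1..s} y) has_real_derivative y t) (at t within {t - 1..t + 1})"
    by (rule integral_has_real_derivative[OF D(4)]) auto
  then have "((\<lambda>s. x (t - 1) + integral {t - 1..s} y) has_real_derivative y t) (at t within {t - 1..t + 1})"
    using DERIV_add[OF DERIV_const] by fastforce
  then have "(x has_real_derivative y t) (at t within {t - 1..t + 1})"
  proof (rule has_field_derivative_transform_within[OF _ zero_less_one])
    show "x (t - 1) + integral {t - 1..s} y = x s" if "s \<in> {t - 1..t + 1}" for s
      using integral_unique[OF D(1)[of "t - 1" s]] that by simp
  qed auto
  then show ?thesis
    by (subst (asm) at_within_interior) (auto simp: interior_atLeastAtMost_real)
qed

lemma system_solution_imp_integral:
  assumes "system_solution q h x y"
  shows "integral_solution (\<lambda>t. - (q t * h (x t))) x y"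
proof -
  have *: "(f' has_integral f t - f s) {s..t}"
    if st: "s \<le> t" and lac: "locally_abs_continuous f" and ae: "AE t in lebesgue. (f has_real_derivative f' t) (at t)" for f f' s t
  proof -
    obtain N where N: "negligible N" "{t. \<not> (f has_real_derivative f' t) (at t)} \<subseteq> N"
      using ae unfolding eventually_ae_filter negligible_iff_null_sets by auto
    show ?thesis
      by (rule abs_continuous_has_integral[OF _ st N(1)])
        (use lac N(2) in \<open>auto simp: locally_abs_continuous_def\<close>)
  qed
  show ?thesis
    using assms unfolding integral_solution_def system_solution_def by (auto intro: *)
qed

text \<open>Two nonlinearities appear because the system uses the extension of \<open>g\<close> by
  zero and the scalar equation uses \<open>g\<close> itself; they only have to agree along
  \<open>x\<close>.\<close>

lemma integral_imp_system_solution: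
  assumes sol: "integral_solution (\<lambda>t. - (q t * h (x t))) x y"
    and q: "\<And>a b. q absolutely_integrable_on {a..b}" and h: "continuous_on UNIV h"
  shows "system_solution q h x y"
    and "\<And>g. (\<And>t. h (x t) = g (x t)) \<Longrightarrow> second_order_solution q g x"
proof -
  note D = integral_solutionD[OF sol]
  have abs: "(\<lambda>t. - (q t * h (x t))) absolutely_integrable_on {a..b}" for a b
  proof -
    have c: "continuous_on {a..b} (\<lambda>t. - h (x t))"
      by (intro continuous_on_minus continuous_on_compose2[OF h D(3)]) auto
    have "(\<lambda>t. - h (x t) * q t) absolutely_integrable_on {a..b}"
    proof (rule absolutely_integrable_bounded_measurable_product_real)
      show "(\<lambda>t. - h (x t)) \<in> borel_measurable (lebesgue_on {a..b})"
        using c by (intro continuous_imp_measurable_on_sets_lebesgue) auto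
      show "bounded ((\<lambda>t. - h (x t)) ` {a..b})"
        using c by (intro compact_imp_bounded compact_continuous_image) auto
    qed (use q in auto)
    then show ?thesis by (simp add: mult.commute)
  qed
  have ac: "locally_abs_continuous x" "locally_abs_continuous y"
    unfolding locally_abs_continuous_def
    using indefinite_integral_abs_continuous[OF absolutely_integrable_continuous_real[OF D(4)] D(1)]
      indefinite_integral_abs_continuous[OF abs D(2)] by blast+
  have ae: "AE t in lebesgue. (y has_real_derivative - (q t * h (x t))) (at t)"
    by (rule indefinite_integral_derivative_AE[OF D(2)])
  have dx: "(x has_real_derivative y t) (at t)" for t by (rule integral_solution_deriv[OF sol])
  show "system_solution q h x y"
    unfolding system_solution_def using ac ae dx by auto
  have dy: "deriv x = y" using dx by (auto intro: DERIV_imp_deriv)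
  show "second_order_solution q g x" if g: "\<And>t. h (x t) = g (x t)" for g
    unfolding second_order_solution_def dy
  proof (intro conjI allI)
    show "x differentiable at t" for t using dx[of t] real_differentiable_def by blast
    show "locally_abs_continuous y" by (rule ac)
    show "AE t in lebesgue. \<exists>D. (y has_real_derivative D) (at t) \<and> D + q t * g (x t) = 0"
      using ae by eventually_elim (use g in auto)
  qed
qed

lemma weight_absolutely_integrable:
  assumes "locally_integrable a"
  shows "pos_part a absolutely_integrable_on {c..d}" "neg_part a absolutely_integrable_on {c..d}"
    "weight a lam \<mu> absolutely_integrable_on {c..d}"
proof -
  have a: "a absolutely_integrable_on {c..d}" using assms by (auto simp: locally_integrable_def)
  have aa: "(\<lambda>t. \<bar>a t\<bar>) absolutely_integrable_on {c..d}"
    using absolutely_integrable_norm[OF a] by (simp add: o_def)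
  have p: "pos_part a = (\<lambda>t. (1/2) * (\<bar>a t\<bar> + a t))" and n: "neg_part a = (\<lambda>t. (1/2) * (\<bar>a t\<bar> - a t))"
    by (auto simp: fun_eq_iff pos_part_def neg_part_def)
  show P: "pos_part a absolutely_integrable_on {c..d}"
    unfolding p by (intro set_integrable_mult_right set_integral_add(1) aa a)
  show N: "neg_part a absolutely_integrable_on {c..d}"
    unfolding n by (intro set_integrable_mult_right set_integral_diff(1) aa a)
  have w: "weight a lam \<mu> = (\<lambda>t. lam * pos_part a t - \<mu> * neg_part a t)" by (auto simp: weight_def)
  show "weight a lam \<mu> absolutely_integrable_on {c..d}"
    unfolding w by (intro set_integral_diff(1) set_integrable_mult_right P N)
qed

section \<open>A discretized periodic problem\<close>

text \<open>The index \<open>j < n\<close> of the cell \<open>(j L / n, (j + 1) L / n]\<close> that contains \<open>t\<close>; lattice functions carry at \<open>j\<close>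
  the value at the right end of that cell.\<close>

definition node :: "nat \<Rightarrow> real \<Rightarrow> real \<Rightarrow> nat" where
  "node n L t = min (n - 1) (nat (\<lceil>t * real n / L\<rceil> - 1))"

lemma node_less: "n \<ge> 1 \<Longrightarrow> node n L t < n"
  by (auto simp: node_def min_def)

lemma node_eq:
  assumes "L > 0" "n \<ge> 1" "j < n" "real j * (L / real n) < t" "t \<le> real (Suc j) * (L / real n)"
  shows "node n L t = j"
proof -
  have "\<lceil>t * real n / L\<rceil> = int j + 1"
    using assms by (intro ceiling_unique) (auto simp: field_simps)
  then show ?thesis using assms(3) by (auto simp: node_def)
qed

lemma node_cell:
  assumes "L > 0" "n \<ge> 1" "0 < t" "t \<le> L"
  shows "real (node n L t) * (L / real n) < t" "t \<le> real (Suc (node n L t)) * (L / real n)"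
proof -
  define z where "z = \<lceil>t * real n / L\<rceil>"
  have z: "of_int z - 1 < t * real n / L" "t * real n / L \<le> of_int z"
    unfolding z_def using ceiling_correct by auto
  have "0 < t * real n / L" "t * real n / L \<le> real n" using assms by (auto simp: field_simps)
  then have "z > 0" "z \<le> int n" using z by (simp_all add: z_def ceiling_le_iff)
  then have "node n L t = nat (z - 1)" using assms(2) by (auto simp: node_def z_def[symmetric] min_def)
  then have nz: "real (node n L t) = of_int z - 1" using \<open>z > 0\<close> by simp
  show "real (node n L t) * (L / real n) < t" "t \<le> real (Suc (node n L t)) * (L / real n)"
    using z assms unfolding of_nat_Suc nz by (auto simp: field_simps)
qed

lemma node_measurable: "(\<lambda>t. G (node n L t)) \<in> borel_measurable borel" for G :: "nat \<Rightarrow> real"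
proof -
  have "(\<lambda>t. \<lceil>t * real n / L\<rceil>) \<in> borel \<rightarrow>\<^sub>M count_space UNIV"
    by (rule measurable_compose[OF _ measurable_real_ceiling]) measurable
  then have "(\<lambda>t. (\<lambda>z. G (min (n - 1) (nat (z - 1)))) \<lceil>t * real n / L\<rceil>) \<in> borel_measurable borel"
    by (rule measurable_compose) simp
  then show ?thesis by (simp add: node_def)
qed

text \<open>An \<open>L\<close>-periodic problem \<open>- u'' = force\<close> coupled to
  \<open>N\<close> scalar unknowns \<open>c\<close> that satisfy a variational inequality. The signs
  of \<open>f\<close> at 0 and \<open>M\<close> make these constants a sub- and a supersolution,
  which replaces a priori bounds. Integrable weights \<open>w\<close> are separated from continuous
  factors \<open>f\<close> for the sake of dominated convergence. The continuity of
  \<open>\<Phi>\<close> is stated for uniform limits of arbitrary functions, because the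
  approximations are step functions.\<close>

locale periodic_problem =
  fixes L M C :: real and K N :: nat and w :: "nat \<Rightarrow> real \<Rightarrow> real"
    and f :: "nat \<Rightarrow> real \<Rightarrow> (nat \<Rightarrow> real) \<Rightarrow> real"
    and \<Phi> :: "nat \<Rightarrow> (real \<Rightarrow> real) \<Rightarrow> (nat \<Rightarrow> real) \<Rightarrow> real"
    and lo hi :: "nat \<Rightarrow> real" and box :: "(nat \<Rightarrow> real) \<Rightarrow> bool"
  assumes box_def: "\<And>c. box c \<longleftrightarrow> (\<forall>i<N. lo i \<le> c i \<and> c i \<le> hi i)"
    and L: "0 < L" and M: "0 < M"
    and w: "\<And>k. k < K \<Longrightarrow> w k absolutely_integrable_on {0..L}" "\<And>k t. k < K \<Longrightarrow> 0 \<le> w k t"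
    and lohi: "\<And>i. i < N \<Longrightarrow> lo i \<le> hi i"
    and f_bound: "\<And>k s c. k < K \<Longrightarrow> 0 \<le> s \<Longrightarrow> s \<le> M \<Longrightarrow> box c \<Longrightarrow> \<bar>f k s c\<bar> \<le> C"
    and f_zero: "\<And>k c. k < K \<Longrightarrow> box c \<Longrightarrow> 0 \<le> f k 0 c"
    and f_top: "\<And>k c. k < K \<Longrightarrow> box c \<Longrightarrow> f k M c \<le> 0"
    and f_cont: "\<And>k s s0 c c0. k < K \<Longrightarrow> (\<And>n. 0 \<le> s n \<and> s n \<le> M) \<Longrightarrow> (\<And>n. box (c n)) \<Longrightarrow>
        0 \<le> s0 \<and> s0 \<le> M \<Longrightarrow> box c0 \<Longrightarrow> s \<longlonglongrightarrow> s0 \<Longrightarrow> (\<And>i. i < N \<Longrightarrow> (\<lambda>n. c n i) \<longlonglongrightarrow> c0 i) \<Longrightarrow>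
        (\<lambda>n. f k (s n) (c n)) \<longlonglongrightarrow> f k s0 c0"
    and \<Phi>_cont: "\<And>i u u0 c c0. i < N \<Longrightarrow> (\<And>n t. 0 \<le> u n t \<and> u n t \<le> M) \<Longrightarrow> (\<And>n. box (c n)) \<Longrightarrow>
        (\<And>t. t \<in> {0..L} \<Longrightarrow> 0 \<le> u0 t \<and> u0 t \<le> M) \<Longrightarrow> box c0 \<Longrightarrow>
        uniform_limit {0..L} u u0 sequentially \<Longrightarrow> (\<And>i. i < N \<Longrightarrow> (\<lambda>n. c n i) \<longlonglongrightarrow> c0 i) \<Longrightarrow>
        (\<lambda>n. \<Phi> i (u n) (c n)) \<longlonglongrightarrow> \<Phi> i u0 c0"
begin

text \<open>Increments of \<open>H\<close> dominate those of the velocity of every approximation, so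
  \<open>H\<close> serves as their common modulus of continuity, whatever the mesh.\<close>

definition H :: "real \<Rightarrow> real" where "H t = C * integral {0..t} (\<lambda>s. \<Sum>k<K. w k s)"

definition force :: "(real \<Rightarrow> real) \<Rightarrow> (nat \<Rightarrow> real) \<Rightarrow> real \<Rightarrow> real" where
  "force u c t = (\<Sum>k<K. w k t * f k (u t) c)"

lemma w_integrable: "k < K \<Longrightarrow> 0 \<le> s \<Longrightarrow> t \<le> L \<Longrightarrow> w k integrable_on {s..t}"
  using w(1)[of k] by (auto intro: integrable_on_subinterval simp: absolutely_integrable_on_def)

lemma w_sum_integrable: "0 \<le> s \<Longrightarrow> t \<le> L \<Longrightarrow> (\<lambda>s. \<Sum>k<K. w k s) integrable_on {s..t}"
  by (intro integrable_sum w_integrable) auto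

text \<open>On the faces \<open>U j = 0\<close> and \<open>U j = M\<close> the sign of the difference equation is the one that turns the
  variational inequality for \<open>U j\<close> into an equation.\<close>

lemma lattice_system:
  assumes n: "n \<ge> 1"
  obtains U c where "\<And>j. j < n \<Longrightarrow> 0 \<le> U j \<and> U j \<le> M" "box c"
    "\<And>j. j < n \<Longrightarrow> 2 * U j - U (Suc j mod n) - U ((j + n - 1) mod n) =
       (L / real n) * (\<Sum>k<K. integral {real j * (L / real n)..real (Suc j) * (L / real n)} (w k) * f k (U j) c)"
    "\<And>i. i < N \<Longrightarrow> \<Phi> i (\<lambda>t. U (node n L t)) c \<le> 0 \<or> c i = lo i"
    "\<And>i. i < N \<Longrightarrow> 0 \<le> \<Phi> i (\<lambda>t. U (node n L t)) c \<or> c i = hi i"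
proof -
  define W where "W k j = integral {real j * (L / real n)..real (Suc j) * (L / real n)} (w k)" for k j
  have W0: "0 \<le> W k j" if "k < K" "j < n" for k j
  proof -
    have "real (Suc j) * (L / real n) \<le> real n * (L / real n)"
      using that L by (intro mult_right_mono) auto
    then show ?thesis
      unfolding W_def using that L n w(2) by (intro integral_nonneg w_integrable) auto
  qed
  \<comment> \<open>With mesh \<open>h = L / n\<close>, the factor is \<open>h^2\<close> from the
    second difference times \<open>1 / h\<close> from averaging the weight over a cell. Indices are
    cyclic, which encodes the periodic boundary condition.\<close>
  define E where "E X j = 2 * X j - X (Suc j mod n) - X ((j + n - 1) mod n)
      - (L / real n) * (\<Sum>k<K. W k j * f k (X j) (\<lambda>i. X (n + i)))" for X j
  define F where "F X j = (if j < n then E X j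
      else \<Phi> (j - n) (\<lambda>t. X (node n L t)) (\<lambda>i. X (n + i)))" for X j
  define lo' hi' where "lo' j = (if j < n then 0 else lo (j - n))" and "hi' j = (if j < n then M else hi (j - n))" for j
  have mods: "Suc j mod n < n" "(j + n - 1) mod n < n" for j using n by auto
  obtain X where X: "\<And>i. i < n + N \<Longrightarrow> lo' i \<le> X i \<and> X i \<le> hi' i"
    and X1: "\<And>i. i < n + N \<Longrightarrow> F X i \<le> 0 \<or> X i = lo' i"
    and X2: "\<And>i. i < n + N \<Longrightarrow> 0 \<le> F X i \<or> X i = hi' i"
  proof (rule box_variational_inequality[of "n + N" lo' hi' F])
    show "lo' i \<le> hi' i" if "i < n + N" for i using M lohi that by (auto simp: lo'_def hi'_def)
    fix X :: "nat \<Rightarrow> nat \<Rightarrow> real" and x i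
    assume i: "i < n + N" and Xb: "\<And>k j. j < n + N \<Longrightarrow> lo' j \<le> X k j \<and> X k j \<le> hi' j"
      and xb: "\<And>j. j < n + N \<Longrightarrow> lo' j \<le> x j \<and> x j \<le> hi' j"
      and lim: "\<And>j. j < n + N \<Longrightarrow> (\<lambda>k. X k j) \<longlonglongrightarrow> x j"
    have Xr: "0 \<le> X k j \<and> X k j \<le> M" "0 \<le> x j \<and> x j \<le> M" if "j < n" for k j
      using Xb[of j k] xb[of j] that by (auto simp: lo'_def hi'_def)
    have bx: "box (\<lambda>i. X k (n + i))" "box (\<lambda>i. x (n + i))" for k
      using Xb[of "n + _" k] xb[of "n + _"] by (auto simp: lo'_def hi'_def box_def)
    have cl: "(\<lambda>k. X k (n + i)) \<longlonglongrightarrow> x (n + i)" if "i < N" for i using lim[of "n + i"] that by simp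
    show "(\<lambda>k. F (X k) i) \<longlonglongrightarrow> F x i"
    proof (cases "i < n")
      case True
      have "(\<lambda>m. f k (X m i) (\<lambda>i. X m (n + i))) \<longlonglongrightarrow> f k (x i) (\<lambda>i. x (n + i))" if "k < K" for k
        by (rule f_cont[OF that]) (use Xr[OF True] bx cl lim[of i] i in auto)
      then have "(\<lambda>m. E (X m) i) \<longlonglongrightarrow> E x i"
        unfolding E_def using lim[of i] lim[of "Suc i mod n"] lim[of "(i + n - 1) mod n"] i mods[of i]
        by (intro tendsto_intros) auto
      then show ?thesis using True by (simp add: F_def)
    next
      case False
      have "uniform_limit {0..L} (\<lambda>k t. X k (node n L t)) (\<lambda>t. x (node n L t)) sequentially"
      proof (rule uniform_limitI)
        fix e :: real assume e: "e > 0"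
        have "\<forall>\<^sub>F k in sequentially. \<forall>j\<in>{..<n}. dist (X k j) (x j) < e"
          using lim e by (intro eventually_ball_finite ballI tendstoD) auto
        then show "\<forall>\<^sub>F k in sequentially. \<forall>t\<in>{0..L}. dist (X k (node n L t)) (x (node n L t)) < e"
          by eventually_elim (use node_less[OF n] in auto)
      qed
      then have "(\<lambda>k. \<Phi> (i - n) (\<lambda>t. X k (node n L t)) (\<lambda>i. X k (n + i))) \<longlonglongrightarrow>
          \<Phi> (i - n) (\<lambda>t. x (node n L t)) (\<lambda>i. x (n + i))"
        using i False Xr bx cl node_less[OF n] by (intro \<Phi>_cont) auto
      then show ?thesis using False by (simp add: F_def)
    qed
  qed blast
  have Xr: "0 \<le> X j \<and> X j \<le> M" if "j < n" for j
    using X[of j] that by (auto simp: lo'_def hi'_def)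
  have bx: "box (\<lambda>i. X (n + i))" using X[of "n + _"] by (auto simp: lo'_def hi'_def box_def)
  have E0: "E X j = 0" if j: "j < n" for j
  proof (rule antisym)
    have S: "0 \<le> (\<Sum>k<K. W k j * f k (X j) (\<lambda>i. X (n + i)))" if "X j = 0"
      using W0 j f_zero bx that by (intro sum_nonneg mult_nonneg_nonneg) auto
    have "X j = 0 \<Longrightarrow> E X j \<le> 0"
      using Xr[OF mods(1)[of j]] Xr[OF mods(2)[of j]] mult_nonneg_nonneg[OF _ S, of "L / real n"] L
      unfolding E_def by fastforce
    then show "E X j \<le> 0" using X1[of j] j by (auto simp: F_def lo'_def)
    have S: "(\<Sum>k<K. W k j * f k (X j) (\<lambda>i. X (n + i))) \<le> 0" if "X j = M"
      using W0 j f_top bx that by (intro sum_nonpos mult_nonneg_nonpos) auto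
    have "X j = M \<Longrightarrow> 0 \<le> E X j"
      using Xr[OF mods(1)[of j]] Xr[OF mods(2)[of j]] mult_nonneg_nonpos[OF _ S, of "L / real n"] L
      unfolding E_def by fastforce
    then show "0 \<le> E X j" using X2[of j] j by (auto simp: F_def hi'_def)
  qed
  show ?thesis
  proof (rule that[of X "\<lambda>i. X (n + i)"])
    show "2 * X j - X (Suc j mod n) - X ((j + n - 1) mod n) =
       (L / real n) * (\<Sum>k<K. integral {real j * (L / real n)..real (Suc j) * (L / real n)} (w k) * f k (X j) (\<lambda>i. X (n + i)))"
      if "j < n" for j
      using E0[OF that] unfolding E_def W_def by linarith
    show "\<Phi> i (\<lambda>t. X (node n L t)) (\<lambda>i. X (n + i)) \<le> 0 \<or> X (n + i) = lo i" if "i < N" for i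
      using X1[of "n + i"] that by (auto simp: F_def lo'_def)
    show "0 \<le> \<Phi> i (\<lambda>t. X (node n L t)) (\<lambda>i. X (n + i)) \<or> X (n + i) = hi i" if "i < N" for i
      using X2[of "n + i"] that by (auto simp: F_def hi'_def)
  qed (use Xr bx in auto)
qed

lemma C_nonneg: "0 < K \<Longrightarrow> 0 \<le> C"
  using f_bound[of 0 0 lo] M lohi by (force simp: box_def)

lemma force_bound:
  assumes "box c" "0 \<le> u t" "u t \<le> M"
  shows "\<bar>force u c t\<bar> \<le> C * (\<Sum>k<K. w k t)"
proof -
  have "\<bar>force u c t\<bar> \<le> (\<Sum>k<K. \<bar>w k t * f k (u t) c\<bar>)" unfolding force_def by (rule sum_abs)
  also have "\<dots> \<le> (\<Sum>k<K. w k t * C)"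
    using assms w(2) f_bound by (intro sum_mono) (auto simp: abs_mult intro!: mult_left_mono)
  finally show ?thesis by (simp add: sum_distrib_left mult.commute)
qed

lemma force_node_integrable:
  assumes n: "n \<ge> 1" and U: "\<And>j. j < n \<Longrightarrow> 0 \<le> U j \<and> U j \<le> M" and c: "box c" and st: "0 \<le> s" "t \<le> L"
  shows "force (\<lambda>t. U (node n L t)) c integrable_on {s..t}"
proof -
  have "(\<lambda>t. f k (U (node n L t)) c * w k t) absolutely_integrable_on {0..L}" if k: "k < K" for k
  proof (rule absolutely_integrable_bounded_measurable_product_real)
    show "(\<lambda>t. f k (U (node n L t)) c) \<in> borel_measurable (lebesgue_on {0..L})"
      using node_measurable[of "\<lambda>j. f k (U j) c" n L]
      by (intro measurable_restrict_space1 measurable_completion) simp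
    show "bounded ((\<lambda>t. f k (U (node n L t)) c) ` {0..L})"
      by (rule boundedI[of _ C]) (use U node_less[OF n] f_bound[OF k] c in auto)
  qed (use w(1)[OF k] in auto)
  then have "force (\<lambda>t. U (node n L t)) c integrable_on {0..L}"
    unfolding force_def by (intro integrable_sum) (auto simp: absolutely_integrable_on_def mult.commute)
  then show ?thesis by (rule integrable_on_subinterval) (use st in auto)
qed

lemma H_diff:
  assumes "0 \<le> s" "s \<le> t" "t \<le> L"
  shows "H t - H s = integral {s..t} (\<lambda>r. C * (\<Sum>k<K. w k r))"
proof -
  have "integral {0..s} (\<lambda>s. \<Sum>k<K. w k s) + integral {s..t} (\<lambda>s. \<Sum>k<K. w k s) = integral {0..t} (\<lambda>s. \<Sum>k<K. w k s)"
    using assms by (intro Henstock_Kurzweil_Integration.integral_combine w_sum_integrable) auto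
  from arg_cong[OF this, of "\<lambda>x. C * x"] show ?thesis
    unfolding H_def by (simp add: algebra_simps)
qed

lemma H_continuous: "continuous_on {0..L} H"
  unfolding H_def by (intro continuous_intros indefinite_integral_continuous_1 w_sum_integrable) auto

lemma H_mono:
  assumes "0 \<le> s" "s \<le> t" "t \<le> L"
  shows "H s \<le> H t"
proof (cases "K = 0")
  case False
  then have "0 \<le> integral {s..t} (\<lambda>r. C * (\<Sum>k<K. w k r))"
    using C_nonneg assms w(2) w_sum_integrable
    by (intro integral_nonneg) (auto intro!: integrable_on_mult_right mult_nonneg_nonneg sum_nonneg)
  then show ?thesis using H_diff[OF assms] by simp
next
  case True
  then show ?thesis unfolding H_def by simp
qed

lemma force_integral_bound:
  assumes "force u c integrable_on {s..t}" "box c" "\<And>r. 0 \<le> u r \<and> u r \<le> M" "0 \<le> s" "s \<le> t" "t \<le> L"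
  shows "\<bar>integral {s..t} (force u c)\<bar> \<le> H t - H s"
proof -
  have "norm (integral {s..t} (force u c)) \<le> integral {s..t} (\<lambda>r. C * (\<Sum>k<K. w k r))"
    using assms force_bound by (intro integral_norm_bound_integral integrable_on_mult_right w_sum_integrable) auto
  then show ?thesis using H_diff[of s t] assms by simp
qed

text \<open>The second equation, for the velocity \<open>V\<close>, holds exactly; all
  discretization error sits in the relation between \<open>S\<close> and the integral of
  \<open>V\<close>. There \<open>\<omega>\<close> is any bound for the oscillation of
  \<open>H\<close> over one mesh width.\<close>

definition approximate_solution :: "nat \<Rightarrow> (real \<Rightarrow> real) \<Rightarrow> (real \<Rightarrow> real) \<Rightarrow> (nat \<Rightarrow> real) \<Rightarrow> bool" where
  "approximate_solution n S V c \<longleftrightarrow> (\<forall>t. 0 \<le> S t \<and> S t \<le> M) \<and> box c \<and>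
    (\<forall>t\<in>{0..L}. V t = V 0 - integral {0..t} (force S c)) \<and> force S c integrable_on {0..L} \<and>
    V L = V 0 \<and> \<bar>V 0\<bar> \<le> H L \<and>
    (\<forall>\<omega>. (\<forall>s\<in>{0..L}. \<forall>t\<in>{0..L}. \<bar>s - t\<bar> \<le> L / real n \<longrightarrow> \<bar>H s - H t\<bar> \<le> \<omega>) \<longrightarrow>
       (\<forall>t\<in>{0..L}. \<bar>S t - (S L + integral {0..t} V)\<bar> \<le> L * \<omega> + 2 * H L * (L / real n))) \<and>
    (\<forall>i<N. (\<Phi> i S c \<le> 0 \<or> c i = lo i) \<and> (0 \<le> \<Phi> i S c \<or> c i = hi i))"

lemma approximate_solution_exists:
  assumes n: "n \<ge> 1"
  shows "\<exists>S V c. approximate_solution n S V c"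
proof -
  obtain U c where U: "\<And>j. j < n \<Longrightarrow> 0 \<le> U j \<and> U j \<le> M" and c: "box c"
    and E: "\<And>j. j < n \<Longrightarrow> 2 * U j - U (Suc j mod n) - U ((j + n - 1) mod n) =
       (L / real n) * (\<Sum>k<K. integral {real j * (L / real n)..real (Suc j) * (L / real n)} (w k) * f k (U j) c)"
    and \<Phi>: "\<And>i. i < N \<Longrightarrow> \<Phi> i (\<lambda>t. U (node n L t)) c \<le> 0 \<or> c i = lo i"
      "\<And>i. i < N \<Longrightarrow> 0 \<le> \<Phi> i (\<lambda>t. U (node n L t)) c \<or> c i = hi i"
    by (rule lattice_system[OF n]) blast
  define h where "h = L / real n"
  have h: "h > 0" "real n * h = L" using L n by (auto simp: h_def)
  define S where "S t = U (node n L t)" for t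
  have S: "0 \<le> S t \<and> S t \<le> M" for t using U node_less[OF n] by (simp add: S_def)
  have Qi: "force S c integrable_on {s..t}" if "0 \<le> s" "t \<le> L" for s t
    using force_node_integrable[OF n U c that] unfolding S_def .
  have tn: "real j * h \<le> L" if "j \<le> n" for j
    using that h mult_right_mono[of "real j" "real n" h] by auto
  \<comment> \<open>Backward difference quotients. The lattice equation says that they change from
    node to node by the integral of the force over a cell, so \<open>V\<close> interpolates them
    exactly; by cyclicity \<open>D n = D 0\<close>, hence \<open>V\<close> is periodic.\<close>
  define D where "D j = (U (j mod n) - U ((j + n - 1) mod n)) / h" for j
  define V where "V t = D 0 - integral {0..t} (force S c)" for t
  have V0: "V 0 = D 0" by (simp add: V_def)
  have cell: "integral {real j * h..real (Suc j) * h} (force S c)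
      = (\<Sum>k<K. integral {real j * h..real (Suc j) * h} (w k) * f k (U j) c)" if j: "j < n" for j
  proof -
    have "integral {real j * h..real (Suc j) * h} (force S c)
        = integral {real j * h..real (Suc j) * h} (\<lambda>t. \<Sum>k<K. w k t * f k (U j) c)"
    proof (rule integral_spike[of "{real j * h}"])
      fix t assume t: "t \<in> {real j * h..real (Suc j) * h} - {real j * h}"
      then have "node n L t = j" using node_eq[OF L n j] by (auto simp: h_def)
      then show "(\<Sum>k<K. w k t * f k (U j) c) = force S c t" by (simp add: force_def S_def)
    qed auto
    also have "\<dots> = (\<Sum>k<K. integral {real j * h..real (Suc j) * h} (\<lambda>t. w k t * f k (U j) c))"
      using h(1) tn[of "Suc j"] j by (intro integral_sum integrable_on_mult_left w_integrable) auto
    finally show ?thesis by (simp add: integral_mult_left)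
  qed
  have VD: "V (real j * h) = D j" if "j \<le> n" for j
    using that
  proof (induction j)
    case 0
    then show ?case by (simp add: V0)
  next
    case (Suc j)
    then have j: "j < n" by simp
    have "integral {0..real j * h} (force S c) + integral {real j * h..real (Suc j) * h} (force S c)
        = integral {0..real (Suc j) * h} (force S c)"
      using h(1) tn[of "Suc j"] j by (intro Henstock_Kurzweil_Integration.integral_combine Qi) (auto simp: algebra_simps)
    then have V: "V (real (Suc j) * h) = V (real j * h) - integral {real j * h..real (Suc j) * h} (force S c)"
      by (simp add: V_def)
    have e: "(Suc j + n - 1) mod n = j mod n" using n by simp
    have "(2 * U j - U (Suc j mod n) - U ((j + n - 1) mod n)) / h
        = integral {real j * h..real (Suc j) * h} (force S c)"
      unfolding cell[OF j] E[OF j] h_def[symmetric] using h(1) by simp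
    moreover have "D (Suc j) = D j - (2 * U j - U (Suc j mod n) - U ((j + n - 1) mod n)) / h"
      unfolding D_def e using j h(1) by (simp add: field_simps)
    ultimately show ?case using V Suc by simp
  qed
  have "(n + n - 1) mod n = (0 + n - 1) mod n"
    using n by (metis Nat.add_diff_assoc2 add_0 mod_add_self2)
  then have Dn: "D n = D 0" unfolding D_def by simp
  have VL: "V L = V 0" using VD[of n] h(2) Dn V0 by simp
  have Vdiff: "\<bar>V t - V s\<bar> \<le> H t - H s" if "0 \<le> s" "s \<le> t" "t \<le> L" for s t
  proof -
    have "integral {0..s} (force S c) + integral {s..t} (force S c) = integral {0..t} (force S c)"
      using that by (intro Henstock_Kurzweil_Integration.integral_combine Qi) auto
    then have "V t - V s = - integral {s..t} (force S c)" by (simp add: V_def)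
    then show ?thesis using force_integral_bound[OF Qi c S] that by simp
  qed
  have H0: "H 0 = 0" by (simp add: H_def)
  have HL: "H t \<le> H L" "0 \<le> H t" if "t \<in> {0..L}" for t
    using H_mono[of t L] H_mono[of 0 t] that H0 by auto
  have Usum: "U j = U (n - 1) + h * (\<Sum>i\<le>j. D i)" if "j < n" for j
    using that
  proof (induction j)
    case 0
    then show ?case using h(1) by (simp add: D_def)
  next
    case (Suc j)
    have "h * D (Suc j) = U (Suc j) - U j" using Suc.prems h(1) by (simp add: D_def)
    then show ?case using Suc by (simp add: algebra_simps)
  qed
  have "(\<Sum>i\<le>n-1. D i) = 0" using Usum[of "n - 1"] n h(1) by simp
  then have sum0: "(\<Sum>i<n. D i) = 0" using n by (metis One_nat_def Suc_le_eq Suc_pred lessThan_Suc_atMost)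
  have DV: "\<bar>D i - V 0\<bar> \<le> H L" if "i < n" for i
    using Vdiff[of 0 "real i * h"] VD[of i] tn[of i] that h(1) HL[of "real i * h"] H0 by simp
  \<comment> \<open>The quotients \<open>D i\<close> have mean zero and all lie within
    \<open>H L\<close> of \<open>V 0\<close>, so \<open>V 0\<close> itself is at most
    \<open>H L\<close> in absolute value.\<close>
  have V0H: "\<bar>V 0\<bar> \<le> H L"
  proof -
    have "\<bar>(\<Sum>i<n. D i - V 0)\<bar> \<le> (\<Sum>i<n. H L)"
      by (rule order_trans[OF sum_abs sum_mono]) (use DV in auto)
    then have "real n * \<bar>V 0\<bar> \<le> real n * H L" using sum0 by (simp add: sum_subtractf abs_mult)
    then show ?thesis using n by simp
  qed
  have Vb: "\<bar>V t\<bar> \<le> 2 * H L" if "t \<in> {0..L}" for t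
    using Vdiff[of 0 t] that HL[OF that] V0H H0 by simp
  have Vc: "continuous_on {0..L} V"
    unfolding V_def by (intro continuous_intros indefinite_integral_continuous_1 Qi) auto
  have Vi: "V integrable_on {s..t}" if "0 \<le> s" "t \<le> L" for s t
    using integrable_continuous_interval[OF continuous_on_subset[OF Vc, of "{s..t}"]] that by auto
  have SL: "S L = U (n - 1)"
  proof -
    have "node n L L = n - 1"
      using node_eq[OF L n, of "n - 1" L] n L h by (auto simp: h_def field_simps)
    then show ?thesis by (simp add: S_def)
  qed
  \<comment> \<open>\<open>S\<close> carries right-end values, so \<open>V\<close> is first
    integrated up to the right end of the cell of \<open>t\<close>, with error at most
    \<open>\<omega> * h\<close> per cell; the surplus piece of that last cell costs
    \<open>2 * H L * h\<close>.\<close>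
  have close: "\<bar>S t - (S L + integral {0..t} V)\<bar> \<le> L * \<omega> + 2 * H L * h"
    if \<omega>: "\<And>s t. s \<in> {0..L} \<Longrightarrow> t \<in> {0..L} \<Longrightarrow> \<bar>s - t\<bar> \<le> h \<Longrightarrow> \<bar>H s - H t\<bar> \<le> \<omega>" and t: "t \<in> {0..L}" for \<omega> t
  proof -
    have \<omega>0: "0 \<le> \<omega>" using \<omega>[of 0 0] L h by simp
    have est: "\<bar>h * D i - integral {real i * h..real (Suc i) * h} V\<bar> \<le> \<omega> * h" if i: "i < n" for i
    proof -
      have le: "real i * h \<le> real (Suc i) * h" "real (Suc i) * h \<le> L" "0 \<le> real i * h"
        using h(1) tn[of "Suc i"] i by (auto simp: algebra_simps)
      have "integral {real i * h..real (Suc i) * h} (\<lambda>s. D i - V s) = h * D i - integral {real i * h..real (Suc i) * h} V"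
        using le by (subst integral_diff) (auto intro!: Vi simp: algebra_simps)
      moreover have "norm (integral {real i * h..real (Suc i) * h} (\<lambda>s. D i - V s))
          \<le> integral {real i * h..real (Suc i) * h} (\<lambda>s. \<omega>)"
      proof (rule integral_norm_bound_integral)
        show "(\<lambda>s. D i - V s) integrable_on {real i * h..real (Suc i) * h}"
          using le by (intro integrable_diff Vi) auto
        fix s assume s: "s \<in> {real i * h..real (Suc i) * h}"
        have "\<bar>V s - V (real i * h)\<bar> \<le> H s - H (real i * h)" 
          by (rule Vdiff) (use s le in \<open>unfold atLeastAtMost_iff, linarith+\<close>)
        moreover have "\<bar>H s - H (real i * h)\<bar> \<le> \<omega>"
        proof (rule \<omega>)
          show "s \<in> {0..L}" "real i * h \<in> {0..L}" using s le unfolding atLeastAtMost_iff by linarith+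
          show "\<bar>s - real i * h\<bar> \<le> h" using s by (auto simp: algebra_simps)
        qed
        ultimately show "norm (D i - V s) \<le> \<omega>" using VD[of i] i by simp
      qed auto
      ultimately show ?thesis using le by (simp add: algebra_simps)
    qed
    have int: "\<bar>U j - U (n - 1) - integral {0..real (Suc j) * h} V\<bar> \<le> real (Suc j) * (\<omega> * h)" if "j < n" for j
      using that
    proof (induction j)
      case 0
      then show ?case using est[of 0] Usum[of 0] n by simp
    next
      case (Suc j)
      have "integral {0..real (Suc j) * h} V + integral {real (Suc j) * h..real (Suc (Suc j)) * h} V
          = integral {0..real (Suc (Suc j)) * h} V"
        using h(1) tn[of "Suc (Suc j)"] Suc.prems
        by (intro Henstock_Kurzweil_Integration.integral_combine Vi) (auto simp: algebra_simps)
      moreover have "U (Suc j) = U j + h * D (Suc j)"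
        using Usum[of j] Usum[of "Suc j"] Suc.prems by (simp add: algebra_simps)
      moreover have "real (Suc (Suc j)) * (\<omega> * h) = real (Suc j) * (\<omega> * h) + \<omega> * h" by (simp add: algebra_simps)
      ultimately show ?case using Suc.IH Suc.prems est[of "Suc j"] by linarith
    qed
    define j where "j = node n L t"
    have j: "j < n" using node_less[OF n] by (simp add: j_def)
    have jt: "real j * h \<le> t" "t \<le> real (Suc j) * h"
    proof -
      have "real j * h \<le> t \<and> t \<le> real (Suc j) * h"
      proof (cases "t = 0")
        case True
        then show ?thesis using h(1) by (simp add: j_def node_def)
      next
        case False
        then show ?thesis using node_cell[OF L n, of t] t by (auto simp: j_def h_def)
      qed
      then show "real j * h \<le> t" "t \<le> real (Suc j) * h" by auto
    qed
    have "real (Suc j) * (\<omega> * h) \<le> real n * (\<omega> * h)" using j \<omega>0 h(1) by (intro mult_right_mono) auto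
    also have "\<dots> = L * \<omega>" using h(2) by (simp add: algebra_simps)
    finally have 1: "\<bar>S t - S L - integral {0..real (Suc j) * h} V\<bar> \<le> L * \<omega>"
      using int[OF j] unfolding SL by (simp add: S_def j_def)
    have comb: "integral {0..t} V + integral {t..real (Suc j) * h} V = integral {0..real (Suc j) * h} V"
      using t jt tn[of "Suc j"] j by (intro Henstock_Kurzweil_Integration.integral_combine Vi) auto
    have "norm (integral {t..real (Suc j) * h} V) \<le> integral {t..real (Suc j) * h} (\<lambda>s. 2 * H L)"
      using t jt tn[of "Suc j"] j by (intro integral_norm_bound_integral Vi) (auto intro!: Vb)
    also have "\<dots> = 2 * H L * (real (Suc j) * h - t)" using jt by simp
    also have "\<dots> \<le> 2 * H L * h" using jt HL[of L] L by (intro mult_left_mono) (auto simp: algebra_simps)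
    finally show ?thesis using 1 comb by simp
  qed
  have SU: "(\<lambda>t. U (node n L t)) = S" by (simp add: S_def fun_eq_iff)
  have "\<forall>\<omega>. (\<forall>s\<in>{0..L}. \<forall>t\<in>{0..L}. \<bar>s - t\<bar> \<le> L / real n \<longrightarrow> \<bar>H s - H t\<bar> \<le> \<omega>) \<longrightarrow>
       (\<forall>t\<in>{0..L}. \<bar>S t - (S L + integral {0..t} V)\<bar> \<le> L * \<omega> + 2 * H L * (L / real n))"
    using close unfolding h_def by blast
  moreover have "\<forall>t\<in>{0..L}. V t = V 0 - integral {0..t} (force S c)" by (simp add: V_def)
  moreover have "force S c integrable_on {0..L}" by (rule Qi) auto
  ultimately have "approximate_solution n S V c"
    unfolding approximate_solution_def using S c VL V0H \<Phi>[unfolded SU] by presburger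
  then show ?thesis by blast
qed


section \<open>The limit of vanishing mesh\<close>

theorem solution_exists:
  obtains u y c where "box c" "\<And>t. t \<in> {0..L} \<Longrightarrow> 0 \<le> u t \<and> u t \<le> M" "u L = u 0" "y L = y 0"
    "\<And>s t. 0 \<le> s \<Longrightarrow> s \<le> t \<Longrightarrow> t \<le> L \<Longrightarrow> (y has_integral u t - u s) {s..t}"
    "\<And>s t. 0 \<le> s \<Longrightarrow> s \<le> t \<Longrightarrow> t \<le> L \<Longrightarrow> ((\<lambda>t. - force u c t) has_integral y t - y s) {s..t}"
    "\<And>i. i < N \<Longrightarrow> \<Phi> i u c \<le> 0 \<or> c i = lo i" "\<And>i. i < N \<Longrightarrow> 0 \<le> \<Phi> i u c \<or> c i = hi i"
proof -
  have "\<forall>n. \<exists>S V c. approximate_solution (Suc n) S V c"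
    using approximate_solution_exists by simp
  then obtain S0 V0 c0 where good: "\<And>n. approximate_solution (Suc n) (S0 n) (V0 n) (c0 n)" by metis
  have S0: "\<And>n t. 0 \<le> S0 n t \<and> S0 n t \<le> M" and c0: "\<And>n. box (c0 n)"
    and V0: "\<And>n t. t \<in> {0..L} \<Longrightarrow> V0 n t = V0 n 0 - integral {0..t} (force (S0 n) (c0 n))"
    and F0: "\<And>n. force (S0 n) (c0 n) integrable_on {0..L}"
    and VL0: "\<And>n. V0 n L = V0 n 0" and VB0: "\<And>n. \<bar>V0 n 0\<bar> \<le> H L"
    and close0: "\<And>n \<omega> t. (\<And>s t. s \<in> {0..L} \<Longrightarrow> t \<in> {0..L} \<Longrightarrow> \<bar>s - t\<bar> \<le> L / real (Suc n) \<Longrightarrow> \<bar>H s - H t\<bar> \<le> \<omega>) \<Longrightarrow>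
       t \<in> {0..L} \<Longrightarrow> \<bar>S0 n t - (S0 n L + integral {0..t} (V0 n))\<bar> \<le> L * \<omega> + 2 * H L * (L / real (Suc n))"
    and \<Phi>0: "\<And>n i. i < N \<Longrightarrow> \<Phi> i (S0 n) (c0 n) \<le> 0 \<or> c0 n i = lo i"
      "\<And>n i. i < N \<Longrightarrow> 0 \<le> \<Phi> i (S0 n) (c0 n) \<or> c0 n i = hi i"
    using good unfolding approximate_solution_def by blast+
  have H0: "H 0 = 0" by (simp add: H_def)
  have Vdiff0: "\<bar>V0 n t - V0 n s\<bar> \<le> H t - H s" if st: "0 \<le> s" "s \<le> t" "t \<le> L" for n s t
  proof -
    have i: "force (S0 n) (c0 n) integrable_on {p..q}" if "0 \<le> p" "q \<le> L" for p q
      using F0 by (rule integrable_on_subinterval) (use that in auto)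
    have "integral {0..s} (force (S0 n) (c0 n)) + integral {s..t} (force (S0 n) (c0 n)) = integral {0..t} (force (S0 n) (c0 n))"
      using st by (intro Henstock_Kurzweil_Integration.integral_combine i) auto
    then have "V0 n t - V0 n s = - integral {s..t} (force (S0 n) (c0 n))"
      using V0[of s n] V0[of t n] st by simp
    then show ?thesis using force_integral_bound[OF i c0 S0] st by simp
  qed
  have Hmod: "\<bar>V0 n t - V0 n s\<bar> \<le> \<bar>H t - H s\<bar>" if "s \<in> {0..L}" "t \<in> {0..L}" for n s t
    using Vdiff0[of s t n] Vdiff0[of t s n] that by (cases "s \<le> t") (auto simp: abs_minus_commute)
  define B where "B = M + 2 * H L + (\<Sum>i<N. \<bar>lo i\<bar> + \<bar>hi i\<bar>)"
  have HL: "0 \<le> H L" using H_mono[of 0 L] H0 L by simp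
  have Bc: "norm (if i < N then c0 n i else S0 n L) \<le> B" for n i
  proof (cases "i < N")
    case True
    have "\<bar>lo i\<bar> + \<bar>hi i\<bar> \<le> (\<Sum>i<N. \<bar>lo i\<bar> + \<bar>hi i\<bar>)" using True by (intro member_le_sum) auto
    then show ?thesis using c0[of n] True HL M unfolding box_def B_def by force
  next
    case False
    have "0 \<le> (\<Sum>i<N. \<bar>lo i\<bar> + \<bar>hi i\<bar>)" by (intro sum_nonneg) auto
    then show ?thesis using S0[of n L] False HL unfolding B_def by simp
  qed
  \<comment> \<open>One extraction serves all scalars: the coordinates below \<open>N\<close> hold
    the parameters, and the coordinate \<open>N\<close> holds the end value
    \<open>S0 n L\<close>.\<close>
  obtain k1 :: "nat \<Rightarrow> nat" where k1: "strict_mono k1"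
    and "\<And>i. i \<in> {..N} \<Longrightarrow> \<exists>l. (\<lambda>n. if i < N then c0 (k1 n) i else S0 (k1 n) L) \<longlonglongrightarrow> l"
    by (rule function_convergent_subsequence[of "{..N}" "\<lambda>n i. if i < N then c0 n i else S0 n L" B]) (use Bc in auto)
  then obtain c where c1: "\<And>i. i \<in> {..N} \<Longrightarrow> (\<lambda>n. if i < N then c0 (k1 n) i else S0 (k1 n) L) \<longlonglongrightarrow> c i"
    by metis
  obtain y k2 where y: "continuous_on {0..L} y" and k2: "strict_mono (k2 :: nat \<Rightarrow> nat)"
    and yu: "\<And>e. 0 < e \<Longrightarrow> \<exists>n0. \<forall>n x. n \<ge> n0 \<and> x \<in> {0..L} \<longrightarrow> norm (V0 (k1 (k2 n)) x - y x) < e"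
  proof (rule Arzela_Ascoli[of "{0..L}" "\<lambda>n. V0 (k1 n)" "2 * H L"])
    show "compact {0..L}" by simp
    show "norm (V0 (k1 n) x) \<le> 2 * H L" if "x \<in> {0..L}" for n x
      using Vdiff0[of 0 x "k1 n"] VB0[of "k1 n"] H_mono[of x L] H0 that by simp
    fix x e :: real assume x: "x \<in> {0..L}" and e: "0 < e"
    obtain d where d: "d > 0" "\<And>z. z \<in> {0..L} \<Longrightarrow> dist z x < d \<Longrightarrow> dist (H z) (H x) < e"
      using H_continuous x e unfolding continuous_on_iff by metis
    show "\<exists>d>0. \<forall>n z. z \<in> {0..L} \<and> norm (x - z) < d \<longrightarrow> norm (V0 (k1 n) x - V0 (k1 n) z) < e"
    proof (intro exI[of _ d] conjI allI impI d(1))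
      fix n z assume z: "z \<in> {0..L} \<and> norm (x - z) < d"
      then have "\<bar>H x - H z\<bar> < e" using d(2)[of z] by (simp add: dist_real_def abs_minus_commute)
      then show "norm (V0 (k1 n) x - V0 (k1 n) z) < e" using Hmod[of z x "k1 n"] z x by simp
    qed
  qed blast
  define k where "k n = k1 (k2 n)" for n
  have k: "strict_mono k" using strict_mono_o[OF k1 k2] by (simp add: k_def[abs_def] o_def)
  define S V cc where "S n = S0 (k n)" and "V n = V0 (k n)" and "cc n = c0 (k n)" for n
  have clim: "(\<lambda>n. cc n i) \<longlonglongrightarrow> c i" if "i < N" for i
    using LIMSEQ_subseq_LIMSEQ[OF c1[of i] k2] that by (simp add: cc_def k_def o_def)
  have SLlim: "(\<lambda>n. S n L) \<longlonglongrightarrow> c N"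
    using LIMSEQ_subseq_LIMSEQ[OF c1[of N] k2] by (simp add: S_def k_def o_def)
  have Vu: "uniform_limit {0..L} V y sequentially"
    unfolding uniform_limit_sequentially_iff V_def k_def dist_norm using yu by blast
  \<comment> \<open>The step functions themselves are not equicontinuous; the limit is built from
    the limit velocity, and the closeness estimate then gives uniform convergence of
    \<open>S\<close> to it.\<close>
  define u where "u t = c N + integral {0..t} y" for t
  have yi: "y integrable_on {s..t}" if "0 \<le> s" "t \<le> L" for s t
    using integrable_continuous_interval[OF continuous_on_subset[OF y, of "{s..t}"]] that by auto
  have Vc: "continuous_on {0..L} (V n)" for n
  proof -
    have "continuous_on {0..L} (\<lambda>t. V0 (k n) 0 - integral {0..t} (force (S0 (k n)) (c0 (k n))))"
      by (intro continuous_intros indefinite_integral_continuous_1 F0)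
    then show ?thesis unfolding V_def by (rule continuous_on_eq) (rule V0[symmetric])
  qed
  have Vi: "V n integrable_on {s..t}" if "0 \<le> s" "t \<le> L" for n s t
    using integrable_continuous_interval[OF continuous_on_subset[OF Vc, of "{s..t}"]] that by auto
  have Su: "uniform_limit {0..L} S u sequentially"
  proof (rule uniform_limitI)
    fix e :: real assume e: "e > 0"
    \<comment> \<open>Four errors of size \<open>e / 5\<close> arise: oscillation of
      \<open>H\<close>, mesh width, end value, and velocity integrated over a length of at most
      \<open>L\<close>.\<close>
    define \<omega> where "\<omega> = e / (5 * L)"
    have \<omega>: "\<omega> > 0" "L * \<omega> = e / 5" using e L by (auto simp: \<omega>_def)
    have "uniformly_continuous_on {0..L} H"
      using H_continuous by (rule compact_uniformly_continuous) simp
    then obtain d where d: "d > 0" "\<And>s t. s \<in> {0..L} \<Longrightarrow> t \<in> {0..L} \<Longrightarrow> dist s t < d \<Longrightarrow> dist (H s) (H t) < \<omega>"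
      using \<omega>(1) unfolding uniformly_continuous_on_def by (metis dist_commute)
    have lim0: "(\<lambda>n. L / real (Suc (k n))) \<longlonglongrightarrow> 0"
      using LIMSEQ_subseq_LIMSEQ[OF LIMSEQ_Suc[OF lim_const_over_n[of L]] k] by (simp add: o_def)
    have ev1: "\<forall>\<^sub>F n in sequentially. L / real (Suc (k n)) < d"
      using lim0 d(1) by (rule order_tendstoD)
    have "(\<lambda>n. 2 * H L * (L / real (Suc (k n)))) \<longlonglongrightarrow> 2 * H L * 0" by (intro tendsto_mult_left lim0)
    then have ev2: "\<forall>\<^sub>F n in sequentially. 2 * H L * (L / real (Suc (k n))) < e / 5"
      by (rule order_tendstoD) (use e in simp)
    have ev3: "\<forall>\<^sub>F n in sequentially. dist (S n L) (c N) < e / 5"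
      using SLlim by (rule tendstoD) (use e in simp)
    have ev4: "\<forall>\<^sub>F n in sequentially. \<forall>t\<in>{0..L}. dist (V n t) (y t) < \<omega>"
      using uniform_limitD[OF Vu \<omega>(1)] .
    show "\<forall>\<^sub>F n in sequentially. \<forall>t\<in>{0..L}. dist (S n t) (u t) < e"
      using ev1 ev2 ev3 ev4
    proof eventually_elim
      case (elim n)
      show ?case
      proof
        fix t assume t: "t \<in> {0..L}"
        have "\<bar>S n t - (S n L + integral {0..t} (V n))\<bar> \<le> L * \<omega> + 2 * H L * (L / real (Suc (k n)))"
          unfolding S_def V_def
        proof (rule close0[OF _ t])
          fix s t assume st: "s \<in> {0..L}" "t \<in> {0..L}" "\<bar>s - t\<bar> \<le> L / real (Suc (k n))"
          then show "\<bar>H s - H t\<bar> \<le> \<omega>" using d(2)[of s t] elim(1) by (simp add: dist_real_def)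
        qed
        moreover have "\<bar>integral {0..t} (V n) - integral {0..t} y\<bar> \<le> L * \<omega>"
        proof -
          have "norm (integral {0..t} (\<lambda>s. V n s - y s)) \<le> integral {0..t} (\<lambda>s. \<omega>)"
            using t elim(4) by (intro integral_norm_bound_integral integrable_diff Vi yi)
              (auto simp: dist_real_def intro: less_imp_le)
          also have "\<dots> = \<omega> * t" using t by simp
          also have "\<dots> \<le> \<omega> * L" using t \<omega>(1) by (intro mult_left_mono) auto
          finally show ?thesis using t by (simp add: integral_diff Vi yi mult.commute)
        qed
        ultimately show "dist (S n t) (u t) < e"
          using elim(2,3) \<omega>(2) unfolding dist_real_def u_def by linarith
      qed
    qed
  qed
  have Slim: "(\<lambda>n. S n t) \<longlonglongrightarrow> u t" if "t \<in> {0..L}" for t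
    using tendsto_uniform_limitI[OF Su that] .
  have uL: "u L = u 0"
    using LIMSEQ_unique[OF SLlim Slim[of L]] L by (simp add: u_def)
  have u_range: "0 \<le> u t \<and> u t \<le> M" if "t \<in> {0..L}" for t
    using LIMSEQ_le_const[OF Slim[OF that]] LIMSEQ_le_const2[OF Slim[OF that]] S0 unfolding S_def by blast
  have cb: "box c"
    unfolding box_def
  proof (intro allI impI conjI)
    fix i assume i: "i < N"
    show "lo i \<le> c i" by (rule LIMSEQ_le_const[OF clim[OF i]]) (use c0 i in \<open>auto simp: cc_def box_def\<close>)
    show "c i \<le> hi i" by (rule LIMSEQ_le_const2[OF clim[OF i]]) (use c0 i in \<open>auto simp: cc_def box_def\<close>)
  qed
  have force_lim: "(\<lambda>n. force (S n) (cc n) t) \<longlonglongrightarrow> force u c t" if t: "t \<in> {0..L}" for t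
    unfolding force_def
  proof (intro tendsto_sum tendsto_mult_left)
    fix k assume "k \<in> {..<K}"
    then show "(\<lambda>n. f k (S n t) (cc n)) \<longlonglongrightarrow> f k (u t) c"
      using S0 c0 u_range[OF t] cb Slim[OF t] clim by (intro f_cont) (auto simp: S_def cc_def)
  qed
  have Fi: "force (S n) (cc n) integrable_on {s..t}" if "0 \<le> s" "t \<le> L" for n s t
    unfolding S_def cc_def using F0 by (rule integrable_on_subinterval) (use that in auto)
  have F_lim: "force u c integrable_on {s..t}"
    "(\<lambda>n. integral {s..t} (force (S n) (cc n))) \<longlonglongrightarrow> integral {s..t} (force u c)" if "0 \<le> s" "t \<le> L" for s t
  proof -
    have 1: "(\<lambda>r. C * (\<Sum>k<K. w k r)) integrable_on {s..t}"
      using that by (intro integrable_on_mult_right w_sum_integrable)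
    have 2: "norm (force (S n) (cc n) r) \<le> C * (\<Sum>k<K. w k r)" for n r
      using force_bound[of "cc n" "S n" r] c0 S0 by (simp add: S_def cc_def)
    note 3 = dominated_convergence[OF Fi[OF that] 1 2 force_lim]
    show "force u c integrable_on {s..t}" by (rule 3(1)) (use that in auto)
    show "(\<lambda>n. integral {s..t} (force (S n) (cc n))) \<longlonglongrightarrow> integral {s..t} (force u c)"
      by (rule 3(2)) (use that in auto)
  qed
  have ylim: "(\<lambda>n. V n t) \<longlonglongrightarrow> y t" if "t \<in> {0..L}" for t
    using tendsto_uniform_limitI[OF Vu that] .
  have yeq: "y t = y 0 - integral {0..t} (force u c)" if t: "t \<in> {0..L}" for t
  proof (rule LIMSEQ_unique[OF ylim[OF t]])
    have "(\<lambda>n. V n 0 - integral {0..t} (force (S n) (cc n))) \<longlonglongrightarrow> y 0 - integral {0..t} (force u c)"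
      using t L by (intro tendsto_diff ylim F_lim(2)) auto
    moreover have "V n t = V n 0 - integral {0..t} (force (S n) (cc n))" for n
      unfolding V_def S_def cc_def by (rule V0[OF t])
    ultimately show "(\<lambda>n. V n t) \<longlonglongrightarrow> y 0 - integral {0..t} (force u c)" by presburger
  qed
  have y_diff: "((\<lambda>t. - force u c t) has_integral y t - y s) {s..t}" if st: "0 \<le> s" "s \<le> t" "t \<le> L" for s t
  proof -
    have "integral {0..s} (force u c) + integral {s..t} (force u c) = integral {0..t} (force u c)"
      using st by (intro Henstock_Kurzweil_Integration.integral_combine F_lim(1)) auto
    then have "- integral {s..t} (force u c) = y t - y s" using yeq[of s] yeq[of t] st by simp
    then show ?thesis using has_integral_neg[OF integrable_integral[OF F_lim(1)[OF st(1,3)]]] by simp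
  qed
  have u_diff: "(y has_integral u t - u s) {s..t}" if st: "0 \<le> s" "s \<le> t" "t \<le> L" for s t
  proof -
    have "integral {0..s} y + integral {s..t} y = integral {0..t} y"
      using st by (intro Henstock_Kurzweil_Integration.integral_combine yi) auto
    then have "integral {s..t} y = u t - u s" by (simp add: u_def)
    then show ?thesis using integrable_integral[OF yi[OF st(1,3)]] by simp
  qed
  have yL: "y L = y 0"
    using LIMSEQ_unique[OF ylim[of L]] ylim[of 0] VL0 L unfolding V_def by simp
  have \<Phi>lim: "(\<lambda>n. \<Phi> i (S n) (cc n)) \<longlonglongrightarrow> \<Phi> i u c" if "i < N" for i
  proof (rule \<Phi>_cont[OF that _ _ u_range cb Su clim])
    show "0 \<le> S n t \<and> S n t \<le> M" "box (cc n)" for n t using S0 c0 by (auto simp: S_def cc_def)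
  qed
  show ?thesis
  proof (rule that[of c u y])
    fix i assume i: "i < N"
    have ci: "lo i \<le> c i" "c i \<le> hi i" using cb i by (auto simp: box_def)
    show "\<Phi> i u c \<le> 0 \<or> c i = lo i"
    proof (rule ccontr)
      assume "\<not> ?thesis"
      then have "0 < \<Phi> i u c" "lo i < c i" using ci by auto
      then have "\<forall>\<^sub>F n in sequentially. 0 < \<Phi> i (S n) (cc n)" "\<forall>\<^sub>F n in sequentially. lo i < cc n i"
        using order_tendstoD(1)[OF \<Phi>lim[OF i]] order_tendstoD(1)[OF clim[OF i]] by blast+
      then have "\<forall>\<^sub>F n in sequentially. False"
      proof eventually_elim
        case (elim n)
        then show False using \<Phi>0(1)[OF i, of "k n"] by (auto simp: S_def cc_def)
      qed
      then show False by simp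
    qed
    show "0 \<le> \<Phi> i u c \<or> c i = hi i"
    proof (rule ccontr)
      assume "\<not> ?thesis"
      then have "\<Phi> i u c < 0" "c i < hi i" using ci by auto
      then have "\<forall>\<^sub>F n in sequentially. \<Phi> i (S n) (cc n) < 0" "\<forall>\<^sub>F n in sequentially. cc n i < hi i"
        using order_tendstoD(2)[OF \<Phi>lim[OF i]] order_tendstoD(2)[OF clim[OF i]] by blast+
      then have "\<forall>\<^sub>F n in sequentially. False"
      proof eventually_elim
        case (elim n)
        then show False using \<Phi>0(2)[OF i, of "k n"] by (auto simp: S_def cc_def)
      qed
      then show False by simp
    qed
  qed (use cb u_range uL yL u_diff y_diff in blast)+
qed

end

section \<open>Estimates for convex and concave pieces\<close>

text \<open>Periodicity of the primitive \<open>F\<close>, that is, zero mean of \<open>f\<close>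
  over a period, is what allows the relation on one period to be copied and glued.\<close>

lemma periodic_has_integral:
  fixes f F :: "real \<Rightarrow> real"
  assumes L: "0 < L" and f: "\<And>t. f (t + L) = f t" and F: "\<And>t. F (t + L) = F t"
    and I: "\<And>s t. 0 \<le> s \<Longrightarrow> s \<le> t \<Longrightarrow> t \<le> L \<Longrightarrow> (f has_integral F t - F s) {s..t}"
    and st: "s \<le> t"
  shows "(f has_integral F t - F s) {s..t}"
proof -
  have shift: "h (t + of_int j * L) = h t" if h: "\<And>t. h (t + L) = h t" for h :: "real \<Rightarrow> real" and t j
  proof (induction j rule: int_induct[of _ 0])
    case (step1 i)
    then show ?case using h[of "t + of_int i * L"] by (simp add: algebra_simps)
  next
    case (step2 i)
    then show ?case using h[of "t + of_int (i - 1) * L"] by (simp add: algebra_simps)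
  qed simp
  have cell: "(f has_integral F t - F s) {s..t}"
    if "of_int j * L \<le> s" "s \<le> t" "t \<le> of_int (j + 1) * L" for s t and j :: int
  proof -
    have "(f has_integral F (t - of_int j * L) - F (s - of_int j * L)) {s - of_int j * L..t - of_int j * L}"
      using that by (intro I) (auto simp: algebra_simps)
    from has_integral_shift_real_ivl[OF this, of "- of_int j * L"]
    show ?thesis using shift[of f _ "- j", OF f] shift[of F _ "- j", OF F] by simp
  qed
  have "(f has_integral F t - F s) {s..t}"
    if "of_int j * L \<le> s" "s \<le> of_int (j + 1) * L" "s \<le> t" "t \<le> of_int (j + 1 + int n) * L" for s t j n
    using that
  proof (induction n arbitrary: t)
    case 0
    then show ?case using cell[of j s t] by simp
  next
    case (Suc n)
    define p where "p = of_int (j + 1 + int n) * L"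
    show ?case
    proof (cases "t \<le> p")
      case True
      then show ?thesis using Suc.IH Suc.prems by (simp add: p_def)
    next
      case False
      have "of_int (j + 1) * L \<le> p" unfolding p_def using L by (intro mult_right_mono) auto
      then have sp: "s \<le> p" using Suc.prems(2) by linarith
      have "(f has_integral F p - F s) {s..p}" using Suc.IH[of p] Suc.prems sp by (simp add: p_def)
      moreover have "(f has_integral F t - F p) {p..t}"
        using cell[of "j + 1 + int n" p t] False Suc.prems(4) by (simp add: p_def algebra_simps)
      ultimately have "(f has_integral (F p - F s) + (F t - F p)) {s..t}"
        using sp False by (intro has_integral_combine[of s p t]) auto
      then show ?thesis by simp
    qed
  qed
  moreover have "of_int \<lfloor>s / L\<rfloor> * L \<le> s" "s \<le> of_int (\<lfloor>s / L\<rfloor> + 1) * L"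
    using floor_divide_lower[OF L, of s] floor_divide_upper[OF L, of s] by (auto simp: algebra_simps)
  moreover have "t \<le> of_int (\<lfloor>s / L\<rfloor> + 1 + int (nat \<lceil>(t - s) / L\<rceil>)) * L"
  proof -
    have "(t - s) / L \<le> of_int (int (nat \<lceil>(t - s) / L\<rceil>))"
      by (metis le_of_int_ceiling of_int_of_nat_eq of_nat_ceiling)
    then have "t - s \<le> of_int (int (nat \<lceil>(t - s) / L\<rceil>)) * L" using L by (simp add: divide_le_eq)
    moreover have "s \<le> of_int (\<lfloor>s / L\<rfloor> + 1) * L"
      using floor_divide_upper[OF L, of s] by (auto simp: algebra_simps)
    ultimately show ?thesis by (simp add: algebra_simps)
  qed
  ultimately show ?thesis using st by blast
qed

text \<open>The lower bound on \<open>G\<close> is integrated twice. The gain is linear in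
  \<open>\<mu>\<close>, so with a lower bound on the initial slope and bounded \<open>x\<close> it
  fails for large \<open>\<mu>\<close>.\<close>

lemma convex_gain_right:
  fixes x y w G :: "real \<Rightarrow> real"
  assumes pq: "p \<le> q" and X: "(y has_integral x q - x p) {p..q}"
    and Y: "\<And>t. t \<in> {p..q} \<Longrightarrow> ((\<lambda>r. \<mu> * (w r * G r)) has_integral y t - y p) {p..t}"
    and w: "w integrable_on {p..q}" "\<And>t. 0 \<le> w t" and G: "\<And>t. t \<in> {p..q} \<Longrightarrow> \<gamma> \<le> G t" and \<mu>: "0 \<le> \<mu>"
  shows "y p * (q - p) + \<mu> * \<gamma> * integral {p..q} (\<lambda>t. integral {p..t} w) \<le> x q - x p"
proof -
  have wi: "w integrable_on {p..t}" if "t \<in> {p..q}" for t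
    using w(1) by (rule integrable_on_subinterval) (use that in auto)
  have yt: "y p + \<mu> * \<gamma> * integral {p..t} w \<le> y t" if t: "t \<in> {p..q}" for t
  proof -
    have "((\<lambda>r. \<mu> * \<gamma> * w r) has_integral \<mu> * \<gamma> * integral {p..t} w) {p..t}"
      by (intro has_integral_mult_right integrable_integral wi t)
    moreover have "\<mu> * \<gamma> * w r \<le> \<mu> * (w r * G r)" if "r \<in> {p..t}" for r
    proof -
      have "w r * \<gamma> \<le> w r * G r" using G[of r] w(2)[of r] that t by (intro mult_left_mono) auto
      from mult_left_mono[OF this \<mu>] show ?thesis by (simp add: ac_simps)
    qed
    ultimately show ?thesis using has_integral_le[OF _ Y[OF t]] by fastforce
  qed
  have "continuous_on {p..q} (\<lambda>t. integral {p..t} w)" by (rule indefinite_integral_continuous_1[OF w(1)])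
  then have "(\<lambda>t. integral {p..t} w) integrable_on {p..q}" by (rule integrable_continuous_interval)
  then have "((\<lambda>t. y p + \<mu> * \<gamma> * integral {p..t} w) has_integral
      (q - p) *\<^sub>R y p + \<mu> * \<gamma> * integral {p..q} (\<lambda>t. integral {p..t} w)) {p..q}"
    using pq has_integral_const_real[of "y p" p q]
    by (intro has_integral_add has_integral_mult_right integrable_integral) auto
  from has_integral_le[OF this X yt] show ?thesis by (simp add: mult.commute)
qed

lemma convex_gain_left:
  fixes x y w G :: "real \<Rightarrow> real"
  assumes pq: "p \<le> q" and X: "(y has_integral x q - x p) {p..q}"
    and Y: "\<And>t. t \<in> {p..q} \<Longrightarrow> ((\<lambda>r. \<mu> * (w r * G r)) has_integral y q - y t) {t..q}"
    and w: "w integrable_on {p..q}" "\<And>t. 0 \<le> w t" and G: "\<And>t. t \<in> {p..q} \<Longrightarrow> \<gamma> \<le> G t" and \<mu>: "0 \<le> \<mu>"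
  shows "x q - x p \<le> y q * (q - p) - \<mu> * \<gamma> * integral {p..q} (\<lambda>t. integral {t..q} w)"
proof -
  have r: "((\<lambda>t. h (- t)) has_integral i) {- t..- s}" if "(h has_integral i) {s..t}" for h :: "real \<Rightarrow> real" and i s t
    using that by (rule has_integral_reflect_lemma_real)
  \<comment> \<open>Time reversal: \<open>x\<close> keeps its values and \<open>y\<close> changes
    sign.\<close>
  have "- y (- (- q)) * (- p - - q) + \<mu> * \<gamma> * integral {- q..- p} (\<lambda>t. integral {- q..t} (\<lambda>r. w (- r)))
      \<le> x (- (- p)) - x (- (- q))"
  proof (rule convex_gain_right[where y = "\<lambda>t. - y (- t)" and x = "\<lambda>t. x (- t)" and G = "\<lambda>t. G (- t)" and w = "\<lambda>r. w (- r)"])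
    show "((\<lambda>t. - y (- t)) has_integral x (- (- p)) - x (- (- q))) {- q..- p}"
      using has_integral_neg[OF r[OF X]] by simp
    show "((\<lambda>s. \<mu> * (w (- s) * G (- s))) has_integral - y (- t) - - y (- (- q))) {- q..t}" if "t \<in> {- q..- p}" for t
      using r[OF Y[of "- t"]] that by simp
    show "(\<lambda>r. w (- r)) integrable_on {- q..- p}" using w(1) r by (meson integrable_on_def)
  qed (use pq w(2) G \<mu> in auto)
  moreover have "integral {- q..t} (\<lambda>r. w (- r)) = integral {- t..q} w" for t
    using Henstock_Kurzweil_Integration.integral_reflect_real[of q "- t" w] by simp
  moreover have "integral {- q..- p} (\<lambda>t. integral {- t..q} w) = integral {p..q} (\<lambda>t. integral {t..q} w)"
    using Henstock_Kurzweil_Integration.integral_reflect_real[of q p "\<lambda>t. integral {t..q} w"] by simp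
  ultimately show ?thesis by simp
qed

text \<open>A first-exit argument: the bound \<open>B\<close> on \<open>\<phi>\<close> is known only
  while \<open>x\<close> is above half of its initial value \<open>D\<close>, and the smallness
  condition says that with this bound the level \<open>D / 2\<close> cannot be reached by time
  \<open>q\<close>.\<close>

lemma slow_descent:
  fixes x y A \<phi> :: "real \<Rightarrow> real"
  assumes le: "t0 \<le> q"
    and X: "\<And>t. t \<in> {t0..q} \<Longrightarrow> (y has_integral x t - x t0) {t0..t}" and xc: "continuous_on {t0..q} x"
    and Y: "\<And>t. t \<in> {t0..q} \<Longrightarrow> ((\<lambda>r. - (A r * \<phi> r)) has_integral y t - y t0) {t0..t}"
    and A: "A integrable_on {t0..q}" "\<And>t. 0 \<le> A t" "integral {t0..q} A \<le> N"
    and B: "0 \<le> B" "\<And>t. t \<in> {t0..q} \<Longrightarrow> D / 2 \<le> x t \<Longrightarrow> \<phi> t \<le> B"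
    and y0: "0 \<le> y t0" and x0: "x t0 = D" and D: "0 < D" and S: "B * N * (q - t0) < D / 2"
  shows "- (B * N) \<le> y q" and "D - B * N * (q - t0) \<le> x q"
proof -
  have slope: "- (B * N) \<le> y t" if t: "t \<in> {t0..q}" and above: "\<And>s. s \<in> {t0..<t} \<Longrightarrow> D / 2 \<le> x s" for t
  proof -
    have Ai: "A integrable_on {t0..t}" using A(1) by (rule integrable_on_subinterval) (use t in auto)
    \<comment> \<open>The height is controlled only before \<open>t\<close>, so the comparison
      function takes the exact value of the integrand at the single point \<open>t\<close>.\<close>
    have "((\<lambda>r. if r = t then - (A t * \<phi> t) else - B * A r) has_integral - B * integral {t0..t} A) {t0..t}"
      by (rule has_integral_spike_finite[OF _ _ has_integral_mult_right[OF integrable_integral[OF Ai]], of "{t}"]) auto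
    moreover have "(if r = t then - (A t * \<phi> t) else - B * A r) \<le> - (A r * \<phi> r)" if "r \<in> {t0..t}" for r
    proof (cases "r = t")
      case False
      then have "\<phi> r \<le> B" using above[of r] B(2)[of r] that t by auto
      then show ?thesis using False mult_left_mono[OF _ A(2)[of r], of "\<phi> r" B] by (simp add: mult.commute)
    qed simp
    ultimately have "- B * integral {t0..t} A \<le> y t - y t0" using has_integral_le[OF _ Y[OF t]] by fastforce
    moreover have "integral {t0..t} A \<le> N"
      using integral_subset_le[OF _ Ai A(1)] t A(2,3) by force
    then have "B * integral {t0..t} A \<le> B * N" using B(1) by (rule mult_left_mono)
    ultimately show ?thesis using y0 by simp
  qed
  have desc: "D - B * N * (t - t0) \<le> x t"
    if t: "t \<in> {t0..q}" and above: "\<And>s. s \<in> {t0..<t} \<Longrightarrow> D / 2 \<le> x s" for t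
  proof -
    have "((\<lambda>r. - (B * N)) has_integral (t - t0) *\<^sub>R (- (B * N))) {t0..t}"
      using has_integral_const_real[of "- (B * N)" t0 t] t by simp
    moreover have "- (B * N) \<le> y r" if "r \<in> {t0..t}" for r using slope[of r] above that t by auto
    ultimately have "(t - t0) *\<^sub>R (- (B * N)) \<le> x t - x t0" using has_integral_le[OF _ X[OF t]] by fastforce
    then show ?thesis using x0 by (simp add: algebra_simps)
  qed
  have above: "D / 2 \<le> x t" if t: "t \<in> {t0..q}" for t
  proof (rule ccontr)
    assume n: "\<not> D / 2 \<le> x t"
    define Z where "Z = {t0..q} \<inter> x -` {..D / 2}"
    have "closed Z"
      unfolding Z_def by (rule continuous_closed_preimage[OF xc]) auto
    then have "compact (Z \<inter> {t0..q})" by (rule closed_Int_compact) simp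
    moreover have "Z \<inter> {t0..q} \<noteq> {}" using n t by (auto simp: Z_def)
    ultimately obtain t1 where "t1 \<in> Z \<inter> {t0..q}" and "\<And>s. s \<in> Z \<inter> {t0..q} \<Longrightarrow> t1 \<le> s"
      using compact_attains_inf by metis
    then have t1: "t1 \<in> {t0..q}" "x t1 \<le> D / 2"
      and least: "\<And>s. s \<in> {t0..q} \<Longrightarrow> x s \<le> D / 2 \<Longrightarrow> t1 \<le> s" by (auto simp: Z_def)
    have "D / 2 \<le> x s" if "s \<in> {t0..<t1}" for s using least[of s] that t1(1) by force
    from desc[OF t1(1) this] have "D - B * N * (t1 - t0) \<le> x t1" by simp
    moreover have "0 \<le> B * N"
      using B(1) A(3) integral_nonneg[OF A(1)] A(2) by (metis mult_nonneg_nonneg order_trans)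
    then have "B * N * (t1 - t0) \<le> B * N * (q - t0)" using t1(1) by (intro mult_left_mono) auto
    ultimately show False using S t1(2) by linarith
  qed
  show "- (B * N) \<le> y q" "D - B * N * (q - t0) \<le> x q"
    using slope[of q] desc[of q] above le by auto
qed

text \<open>The slope \<open>y\<close> is nonincreasing. Since \<open>x\<close> stays in
  \<open>[0, D]\<close>, the slope is at most \<open>D / e\<close> at distance \<open>e\<close> from
  the left end and at least \<open>- D / e\<close> at distance \<open>e\<close> from the right end,
  so the force in between integrates to at most \<open>2 * D / e\<close>. The second claim says that
  a concave nonnegative function lies above its chords.\<close>

lemma concave_hump:
  fixes x y A \<psi> :: "real \<Rightarrow> real"
  assumes e: "0 < e" "2 * e < q - p"
    and X: "\<And>s t. p \<le> s \<Longrightarrow> s \<le> t \<Longrightarrow> t \<le> q \<Longrightarrow> (y has_integral x t - x s) {s..t}"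
    and Y: "\<And>s t. p \<le> s \<Longrightarrow> s \<le> t \<Longrightarrow> t \<le> q \<Longrightarrow> ((\<lambda>r. - (A r * \<psi> r)) has_integral y t - y s) {s..t}"
    and A: "\<And>t. 0 \<le> A t" "A integrable_on {p..q}" and \<psi>: "\<And>t. t \<in> {p..q} \<Longrightarrow> 0 \<le> \<psi> t"
    and x: "\<And>t. t \<in> {p..q} \<Longrightarrow> 0 \<le> x t \<and> x t \<le> D"
  shows "(\<And>t. t \<in> {p + e..q - e} \<Longrightarrow> \<beta> \<le> \<psi> t) \<Longrightarrow> \<beta> * integral {p + e..q - e} A \<le> 2 * D / e"
    and "t0 \<in> {p..q} \<Longrightarrow> t \<in> {p + e..q - e} \<Longrightarrow> e * x t0 / (q - p) \<le> x t"
proof -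
  have mono: "y t \<le> y s" if "p \<le> s" "s \<le> t" "t \<le> q" for s t
  proof -
    have "((\<lambda>r. 0) has_integral (0::real)) {s..t}" by simp
    moreover have "- (A r * \<psi> r) \<le> 0" if "r \<in> {s..t}" for r
      using A(1)[of r] \<psi>[of r] that \<open>p \<le> s\<close> \<open>t \<le> q\<close> by (simp add: mult_nonneg_nonneg)
    ultimately have "y t - y s \<le> 0" by (rule has_integral_le[OF Y[OF that]])
    then show ?thesis by simp
  qed
  have up: "x t - x s \<le> y s * (t - s)" and low: "y t * (t - s) \<le> x t - x s" if "p \<le> s" "s \<le> t" "t \<le> q" for s t
  proof -
    show "x t - x s \<le> y s * (t - s)"
      using has_integral_le[OF X[OF that] has_integral_const_real[of "y s" s t]] mono that by (simp add: mult.commute)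
    show "y t * (t - s) \<le> x t - x s"
      using has_integral_le[OF has_integral_const_real[of "y t" s t] X[OF that]] mono that by (simp add: mult.commute)
  qed
  show "\<beta> * integral {p + e..q - e} A \<le> 2 * D / e" if \<beta>: "\<And>t. t \<in> {p + e..q - e} \<Longrightarrow> \<beta> \<le> \<psi> t"
  proof -
    have "y (p + e) * e \<le> D" using low[of p "p + e"] x[of p] x[of "p + e"] e by auto
    then have 1: "y (p + e) \<le> D / e" using e by (simp add: le_divide_eq)
    have "- D \<le> y (q - e) * e" using up[of "q - e" q] x[of q] x[of "q - e"] e by auto
    then have 2: "- D / e \<le> y (q - e)" using e by (subst pos_divide_le_eq) auto
    have Ai: "A integrable_on {p + e..q - e}" using A(2) by (rule integrable_on_subinterval) (use e in auto)
    have "((\<lambda>r. - (A r * \<psi> r)) has_integral y (q - e) - y (p + e)) {p + e..q - e}" using e by (intro Y) auto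
    moreover have "((\<lambda>r. - \<beta> * A r) has_integral - \<beta> * integral {p + e..q - e} A) {p + e..q - e}"
      by (intro has_integral_mult_right integrable_integral Ai)
    moreover have "- (A r * \<psi> r) \<le> - \<beta> * A r" if "r \<in> {p + e..q - e}" for r
      using mult_left_mono[OF \<beta>[OF that] A(1)[of r]] by (simp add: mult.commute)
    ultimately have "y (q - e) - y (p + e) \<le> - \<beta> * integral {p + e..q - e} A" by (rule has_integral_le)
    then show ?thesis using 1 2 by (simp add: field_simps)
  qed
  show "e * x t0 / (q - p) \<le> x t" if t0: "t0 \<in> {p..q}" and t: "t \<in> {p + e..q - e}"
  proof -
    have xt: "0 \<le> x t" "0 \<le> x p" "0 \<le> x q" "0 \<le> x t0" using x[of t] x[of p] x[of q] x[of t0] t t0 e by auto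
    \<comment> \<open>The chord joins the maximum point to the end of the interval beyond
      \<open>t\<close>: to \<open>p\<close> if \<open>t\<close> precedes \<open>t0\<close>, to
      \<open>q\<close> otherwise.\<close>
    have "e * x t0 \<le> x t * (q - p)"
    proof (cases "t \<le> t0")
      case True
      have 1: "y t * (t - p) \<le> x t" using low[of p t] xt t e by auto
      have 2: "x t0 - x t \<le> y t * (t0 - t)" using up[of t t0] True t t0 e by auto
      have "e * x t0 \<le> (t - p) * x t0" using t xt by (intro mult_right_mono) auto
      also have "\<dots> \<le> (t - p) * (x t + y t * (t0 - t))" using 2 t e by (intro mult_left_mono) auto
      also have "\<dots> = (t - p) * x t + (y t * (t - p)) * (t0 - t)" by (simp add: algebra_simps)
      also have "\<dots> \<le> (t - p) * x t + x t * (t0 - t)" using 1 True by (intro add_left_mono mult_right_mono) auto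
      also have "\<dots> = x t * (t0 - p)" by (simp add: algebra_simps)
      also have "\<dots> \<le> x t * (q - p)" using xt t0 by (intro mult_left_mono) auto
      finally show ?thesis .
    next
      case False
      have 1: "- y t * (q - t) \<le> x t" using up[of t q] xt t e by auto
      have 2: "x t0 - x t \<le> - y t * (t - t0)" using low[of t0 t] False t t0 e by auto
      have "e * x t0 \<le> (q - t) * x t0" using t xt by (intro mult_right_mono) auto
      also have "\<dots> \<le> (q - t) * (x t + - y t * (t - t0))" using 2 t e by (intro mult_left_mono) auto
      also have "\<dots> = (q - t) * x t + (- y t * (q - t)) * (t - t0)" by (simp add: algebra_simps)
      also have "\<dots> \<le> (q - t) * x t + x t * (t - t0)" using 1 False by (intro add_left_mono mult_right_mono) auto
      also have "\<dots> = x t * (q - t0)" by (simp add: algebra_simps)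
      also have "\<dots> \<le> x t * (q - p)" using xt t0 by (intro mult_left_mono) auto
      finally show ?thesis .
    qed
    then show ?thesis using e by (simp add: divide_le_eq)
  qed
qed

section \<open>The sign-changing weight\<close>

text \<open>The inner integral is continuous and nonnegative in \<open>t\<close>, and at one end of
  the interval it equals the full integral of \<open>w\<close>.\<close>

lemma nested_integral_pos:
  fixes w :: "real \<Rightarrow> real"
  assumes w: "w integrable_on {p..q}" "\<And>t. 0 \<le> w t" and pq: "p < q" and pos: "0 < integral {p..q} w"
  shows "0 < integral {p..q} (\<lambda>t. integral {p..t} w)" "0 < integral {p..q} (\<lambda>t. integral {t..q} w)"
proof -
  have wi: "w integrable_on {s..t}" if "p \<le> s" "t \<le> q" for s t
    using w(1) by (rule integrable_on_subinterval) (use that in auto)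
  have *: "0 < integral {p..q} J"
    if J: "continuous_on {p..q} J" "\<And>t. t \<in> {p..q} \<Longrightarrow> 0 \<le> J t" and t: "t \<in> {p..q}" "0 < J t" for J :: "real \<Rightarrow> real" and t
  proof -
    have Ji: "J integrable_on {p..q}" using J(1) by (rule integrable_continuous_interval)
    have "integral {p..q} J \<noteq> 0"
    proof
      assume "integral {p..q} J = 0"
      then have "(J has_integral 0) (cbox p q)" using integrable_integral[OF Ji] by simp
      then have "J t = 0"
        using J t pq by (intro has_integral_0_cbox_imp_0[of p q J]) auto
      then show False using t by simp
    qed
    moreover have "0 \<le> integral {p..q} J" using Ji J(2) by (intro integral_nonneg) auto
    ultimately show ?thesis by simp
  qed
  have c: "continuous_on {p..q} (\<lambda>t. integral {p..t} w)" by (rule indefinite_integral_continuous_1[OF w(1)])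
  show "0 < integral {p..q} (\<lambda>t. integral {p..t} w)"
    by (rule *[OF c, of q]) (use pq pos w wi in \<open>auto intro!: integral_nonneg\<close>)
  have e: "integral {p..q} w - integral {p..t} w = integral {t..q} w" if "t \<in> {p..q}" for t
    using Henstock_Kurzweil_Integration.integral_combine[of p t q w] that w(1) by auto
  have "continuous_on {p..q} (\<lambda>t. integral {p..q} w - integral {p..t} w)" by (intro continuous_intros c)
  then have c': "continuous_on {p..q} (\<lambda>t. integral {t..q} w)" by (rule continuous_on_eq) (rule e)
  show "0 < integral {p..q} (\<lambda>t. integral {t..q} w)"
    by (rule *[OF c', of p]) (use pq pos w wi in \<open>auto intro!: integral_nonneg\<close>)
qed

locale sign_changing_problem =
  fixes g a :: "real \<Rightarrow> real" and T \<epsilon> \<rho> lam r R :: real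
    and m :: nat and \<sigma> \<tau> :: "nat \<Rightarrow> real"
  assumes g_cont: "continuous_on {0..} g" and g_zero: "g 0 = 0" and g_pos: "\<And>s. s > 0 \<Longrightarrow> g s > 0"
    and a_int: "locally_integrable a" and a_per: "\<And>t. a (t + T) = a t" and T: "T > 0"
    and m: "m \<ge> 1" and pattern: "sign_pattern m T \<sigma> \<tau> a"
    and eps: "eps_suitable m \<sigma> \<tau> a \<epsilon>"
    and rho: "\<rho> > 0" and lam: "lam > lambda_star m \<sigma> \<tau> a g \<epsilon> \<rho>"
    and adm: "admissible m \<sigma> \<tau> a g \<rho> lam r R"
begin

abbreviation A where "A \<equiv> pos_part a"
abbreviation B where "B \<equiv> neg_part a"

text \<open>The intervals \<open>I\<^sup>+\<^sub>i + l T\<close> are numbered consecutively by \<open>j = (i - 1) + l m\<close>: the \<open>j\<close>-th one is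
  \<open>[lft j, mid j]\<close>, and \<open>[mid j, lft (j + 1)]\<close> is the negativity interval after it.\<close>

definition idx :: "int \<Rightarrow> nat" where "idx j = nat (j mod int m) + 1"
definition lft :: "int \<Rightarrow> real" where "lft j = \<sigma> (idx j) + of_int (j div int m) * T"
definition mid :: "int \<Rightarrow> real" where "mid j = \<tau> (idx j) + of_int (j div int m) * T"

lemma radii: "0 < r" "r < \<rho>" "\<rho> < R"
  using adm by (auto simp: admissible_def)

lemma idx_range: "idx j \<in> {1..m}"
proof -
  have "0 \<le> j mod int m" "j mod int m < int m" using m by auto
  then have "nat (j mod int m) < m" by linarith
  then show ?thesis by (simp add: idx_def)
qed

lemma points: "i \<in> {1..m} \<Longrightarrow> \<sigma> i < \<tau> i" "i \<in> {1..m} \<Longrightarrow> \<tau> i < \<sigma> (i + 1)" "\<sigma> 1 = 0" "\<sigma> (m + 1) = T"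
  using pattern by (auto simp: sign_pattern_def)

text \<open>After the last hump of a period the index jumps back to 1 while the quotient rises by 1;
  \<open>\<sigma> (m + 1) = T\<close> reconciles the two.\<close>

lemma lft_next: "\<sigma> (idx j + 1) + of_int (j div int m) * T = lft (j + 1)"
proof -
  have *: "0 \<le> j mod int m" "j mod int m < int m" using m by auto
  have j: "j = int m * (j div int m) + j mod int m" by simp
  show ?thesis
  proof (cases "j mod int m + 1 < int m")
    case True
    have "(j + 1) div int m = j div int m" "(j + 1) mod int m = j mod int m + 1"
      using int_div_pos_eq[of "j + 1" "int m" "j div int m" "j mod int m + 1"]
        int_mod_pos_eq[of "j + 1" "int m" "j div int m" "j mod int m + 1"] True * j by auto
    then show ?thesis using *(1) by (simp add: lft_def idx_def nat_add_distrib)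
  next
    case False
    then have jm: "j mod int m + 1 = int m" using * by simp
    have "int m * (j div int m + 1) = int m * (j div int m) + int m" by (simp add: distrib_left)
    then have "j + 1 = int m * (j div int m + 1) + 0" using j jm by linarith
    then have "(j + 1) div int m = j div int m + 1" "(j + 1) mod int m = 0"
      using int_div_pos_eq[of "j + 1" "int m" "j div int m + 1" 0]
        int_mod_pos_eq[of "j + 1" "int m" "j div int m + 1" 0] m by auto
    moreover have "idx j = m" using jm *(1) by (simp add: idx_def)
    ultimately show ?thesis using points(3,4) by (simp add: lft_def idx_def algebra_simps)
  qed
qed

lemma order: "lft j < mid j" "mid j < lft (j + 1)"
  using points(1,2)[OF idx_range[of j]] lft_next[of j] by (auto simp: lft_def mid_def)

lemma shift_m: "lft (j + l * int m) = lft j + of_int l * T" "mid (j + l * int m) = mid j + of_int l * T"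
  "idx (j + l * int m) = idx j"
proof -
  have "(j + l * int m) div int m = j div int m + l" "(j + l * int m) mod int m = j mod int m"
    using m by auto
  then show "lft (j + l * int m) = lft j + of_int l * T" "mid (j + l * int m) = mid j + of_int l * T"
    "idx (j + l * int m) = idx j"
    by (auto simp: lft_def mid_def idx_def algebra_simps)
qed

lemma base_hump:
  assumes "i \<in> {1..m}"
  shows "lft (int (i - 1) + l * int m) = \<sigma> i + of_int l * T" "mid (int (i - 1) + l * int m) = \<tau> i + of_int l * T"
    "idx (int (i - 1)) = i"
proof -
  obtain k where k: "i = Suc k" using assms by (cases i) auto
  then have "int (i - 1) div int m = 0" "int (i - 1) mod int m = int k" using assms by auto
  then show "lft (int (i - 1) + l * int m) = \<sigma> i + of_int l * T"
    "mid (int (i - 1) + l * int m) = \<tau> i + of_int l * T" "idx (int (i - 1)) = i"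
    unfolding shift_m using k by (auto simp: lft_def mid_def idx_def)
qed

lemma a_shift: "a (t + of_int l * T) = a t"
proof (induction l rule: int_induct[of _ 0])
  case (step1 i)
  then show ?case using a_per[of "t + of_int i * T"] by (simp add: algebra_simps)
next
  case (step2 i)
  then show ?case using a_per[of "t + of_int (i - 1) * T"] by (simp add: algebra_simps)
qed simp

lemma AB_shift: "A (t + of_int l * T) = A t" "B (t + of_int l * T) = B t"
  by (simp_all add: pos_part_def neg_part_def a_shift)

lemma AB_nonneg: "0 \<le> A t" "0 \<le> B t"
  by (simp_all add: pos_part_def neg_part_def)

lemma AB_integrable: "A integrable_on {s..t}" "B integrable_on {s..t}"
  using weight_absolutely_integrable[OF a_int] by (auto simp: absolutely_integrable_on_def)

lemma integral_shift_period:
  fixes h :: "real \<Rightarrow> real"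
  shows "integral {p + of_int l * T..q + of_int l * T} h = integral {p..q} (\<lambda>t. h (t + of_int l * T))"
  using integral_shift_real_ivl[of "p + of_int l * T" "of_int l * T" "q + of_int l * T" h] by simp

lemma negligible_shift:
  assumes "negligible {t \<in> {p..q}. P t}" "\<And>t. P (t + of_int l * T) = P t"
  shows "negligible {t \<in> {p + of_int l * T..q + of_int l * T}. P t}"
proof -
  have "negligible ((\<lambda>t. of_int l * T + t) ` {t \<in> {p..q}. P t})" using assms(1) by (rule negligible_translation)
  then show ?thesis
  proof (rule negligible_subset, intro subsetI)
    fix t assume "t \<in> {t \<in> {p + of_int l * T..q + of_int l * T}. P t}"
    then show "t \<in> (\<lambda>t. of_int l * T + t) ` {t \<in> {p..q}. P t}"
      using assms(2)[of "t - of_int l * T"] by (intro image_eqI[of _ _ "t - of_int l * T"]) auto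
  qed
qed

lemma succ_zero_on_interval:
  assumes w: "succ_zero_on {p..q} w" and i: "w absolutely_integrable_on {p..q}"
  shows "negligible {t \<in> {p..q}. w t < 0}" "0 < integral {p..q} (\<lambda>t. max (w t) 0)"
proof -
  have S: "{p..q} \<in> sets lebesgue" by simp
  have "AE t in lebesgue. t \<in> {p..q} \<longrightarrow> 0 \<le> w t"
    using w AE_restrict_space_iff[of "{p..q}" lebesgue "\<lambda>t. 0 \<le> w t"] by (simp add: succ_zero_on_def)
  then obtain N where "{t \<in> space lebesgue. \<not> (t \<in> {p..q} \<longrightarrow> 0 \<le> w t)} \<subseteq> N"
    and "emeasure lebesgue N = 0" "N \<in> sets lebesgue" by (rule AE_E)
  then have N: "negligible N" "{t. \<not> (t \<in> {p..q} \<longrightarrow> 0 \<le> w t)} \<subseteq> N"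
    by (auto simp: negligible_iff_null_sets)
  have "{t \<in> {p..q}. w t < 0} \<subseteq> N" by (rule order_trans[OF _ N(2)]) (auto simp: not_le)
  then show "negligible {t \<in> {p..q}. w t < 0}" by (rule negligible_subset[OF N(1)])
  have aw: "(\<lambda>t. \<bar>w t\<bar>) absolutely_integrable_on {p..q}"
    using absolutely_integrable_norm[OF i] by (simp add: o_def)
  have mx: "(\<lambda>t. max (w t) 0) = (\<lambda>t. (1/2) * (\<bar>w t\<bar> + w t))" by (auto simp: fun_eq_iff)
  have mi: "(\<lambda>t. max (w t) 0) absolutely_integrable_on {p..q}"
    unfolding mx by (intro set_integrable_mult_right set_integral_add(1) aw i)
  have li: "integrable (lebesgue_on {p..q}) (\<lambda>t. max (w t) 0)"
    by (rule absolutely_integrable_imp_integrable[OF mi S])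
  have "integral\<^sup>L (lebesgue_on {p..q}) (\<lambda>t. max (w t) 0) \<noteq> 0"
  proof
    assume "integral\<^sup>L (lebesgue_on {p..q}) (\<lambda>t. max (w t) 0) = 0"
    then have "AE t in lebesgue_on {p..q}. max (w t) 0 = 0"
      using integral_nonneg_eq_0_iff_AE[OF li] by simp
    moreover have "AE t in lebesgue_on {p..q}. 0 \<le> w t" using w by (simp add: succ_zero_on_def)
    ultimately have "AE t in lebesgue_on {p..q}. w t = 0" by eventually_elim simp
    then show False using w by (simp add: succ_zero_on_def)
  qed
  then have "integral {p..q} (\<lambda>t. max (w t) 0) \<noteq> 0"
    using lebesgue_integral_eq_integral[OF li S] by simp
  moreover have "0 \<le> integral {p..q} (\<lambda>t. max (w t) 0)"
    using mi by (intro integral_nonneg) (auto simp: absolutely_integrable_on_def)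
  ultimately show "0 < integral {p..q} (\<lambda>t. max (w t) 0)" by simp
qed

lemma sign_on_pieces:
  shows "negligible {t \<in> {lft j..mid j}. B t \<noteq> 0}" "negligible {t \<in> {mid j..lft (j + 1)}. A t \<noteq> 0}"
    and "0 < integral {lft j..mid j} A" "0 < integral {mid j..lft (j + 1)} B"
proof -
  define i where "i = idx j"
  have i: "i \<in> {1..m}" using idx_range by (simp add: i_def)
  have p: "succ_zero_on {\<sigma> i..\<tau> i} a" "succ_zero_on {\<tau> i..\<sigma> (i + 1)} (\<lambda>t. - a t)"
    using pattern i by (auto simp: sign_pattern_def prec_zero_on_def)
  have ai: "a absolutely_integrable_on {p..q}" for p q using a_int by (auto simp: locally_integrable_def)
  have ani: "(\<lambda>t. - a t) absolutely_integrable_on {p..q}" for p q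
  proof -
    have "(\<lambda>t. (- 1) * a t) absolutely_integrable_on {p..q}" by (intro set_integrable_mult_right ai)
    then show ?thesis by simp
  qed
  have L: "lft (j + 1) = \<sigma> (i + 1) + of_int (j div int m) * T" using lft_next[of j] by (simp add: i_def)
  note s = succ_zero_on_interval[OF p(1) ai] succ_zero_on_interval[OF p(2) ani]
  have AB: "(\<lambda>t. max (a t) 0) = A" "(\<lambda>t. max (- a t) 0) = B" by (auto simp: fun_eq_iff pos_part_def neg_part_def)
  have eq: "{t \<in> S. a t < 0} = {t \<in> S. B t \<noteq> 0}" "{t \<in> S. - a t < 0} = {t \<in> S. A t \<noteq> 0}" for S
    by (auto simp: pos_part_def neg_part_def)
  show "negligible {t \<in> {lft j..mid j}. B t \<noteq> 0}"
    unfolding lft_def mid_def i_def[symmetric]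
    by (rule negligible_shift[OF s(1)[unfolded eq]]) (simp add: AB_shift)
  show "negligible {t \<in> {mid j..lft (j + 1)}. A t \<noteq> 0}"
    unfolding L mid_def i_def[symmetric]
    by (rule negligible_shift[OF s(3)[unfolded eq]]) (simp add: AB_shift)
  show "0 < integral {lft j..mid j} A"
    using s(2) unfolding lft_def mid_def i_def[symmetric] integral_shift_period AB_shift AB .
  show "0 < integral {mid j..lft (j + 1)} B"
    using s(4) unfolding L mid_def i_def[symmetric] integral_shift_period AB_shift AB .
qed

text \<open>By periodicity only \<open>m\<close> different values occur, so one
  \<open>\<kappa>\<close> serves all negativity intervals on the line. This is why the threshold for
  \<open>\<mu>\<close> ignores the length of an orbit's period.\<close>

lemma uniform_gain:
  obtains \<kappa> where "0 < \<kappa>"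
    "\<And>j. \<kappa> \<le> integral {mid j..lft (j + 1)} (\<lambda>t. integral {mid j..t} B)"
    "\<And>j. \<kappa> \<le> integral {mid j..lft (j + 1)} (\<lambda>t. integral {t..lft (j + 1)} B)"
proof -
  define F1 where "F1 i = integral {\<tau> i..\<sigma> (i + 1)} (\<lambda>t. integral {\<tau> i..t} B)" for i
  define F2 where "F2 i = integral {\<tau> i..\<sigma> (i + 1)} (\<lambda>t. integral {t..\<sigma> (i + 1)} B)" for i
  have L: "lft (j + 1) = \<sigma> (idx j + 1) + of_int (j div int m) * T" for j using lft_next[of j] by simp
  have F: "integral {mid j..lft (j + 1)} (\<lambda>t. integral {mid j..t} B) = F1 (idx j)"
    "integral {mid j..lft (j + 1)} (\<lambda>t. integral {t..lft (j + 1)} B) = F2 (idx j)" for j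
    unfolding L mid_def integral_shift_period AB_shift F1_def F2_def by simp_all
  have pos: "0 < F1 (idx j)" "0 < F2 (idx j)" for j
    unfolding F[symmetric]
    by (rule nested_integral_pos[OF AB_integrable(2) AB_nonneg(2) order(2) sign_on_pieces(4)])+
  define \<kappa> where "\<kappa> = Min ((\<lambda>i. min (F1 i) (F2 i)) ` {1..m})"
  have "0 < F1 i \<and> 0 < F2 i" if "i \<in> {1..m}" for i using pos[of "int (i - 1)"] base_hump(3)[OF that] by simp
  then have "0 < \<kappa>" unfolding \<kappa>_def using m by (subst Min_gr_iff) auto
  moreover have "\<kappa> \<le> min (F1 (idx j)) (F2 (idx j))" for j
    unfolding \<kappa>_def by (rule Min_le) (use idx_range in auto)
  ultimately show ?thesis using that[of \<kappa>] F by simp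
qed

definition \<nu> where "\<nu> = nu m \<sigma> \<tau> a \<epsilon>"

lemma eps_hump: "0 < \<epsilon>" "2 * \<epsilon> < mid j - lft j"
proof -
  show "0 < \<epsilon>" using eps by (simp add: eps_suitable_def)
  have "\<epsilon> < (\<tau> (idx j) - \<sigma> (idx j)) / 2" using eps idx_range[of j] unfolding eps_suitable_def by blast
  then show "2 * \<epsilon> < mid j - lft j" by (simp add: lft_def mid_def)
qed

lemma LINT_A: "(LINT t:{p..q}|lebesgue. A t) = integral {p..q} A"
  by (rule set_lebesgue_integral_eq_integral(2)[OF weight_absolutely_integrable(1)[OF a_int]])

lemma nu_bounds: "0 < \<nu>" "\<nu> \<le> integral {lft j + \<epsilon>..mid j - \<epsilon>} A"
proof -
  show "0 < \<nu>" unfolding \<nu>_def nu_def using eps m by (subst Min_gr_iff) (auto simp: eps_suitable_def)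
  have "\<nu> \<le> integral {\<sigma> (idx j) + \<epsilon>..\<tau> (idx j) - \<epsilon>} A"
    unfolding \<nu>_def nu_def LINT_A by (rule Min_le) (use idx_range in auto)
  also have "\<dots> = integral {(\<sigma> (idx j) + \<epsilon>) + of_int (j div int m) * T..(\<tau> (idx j) - \<epsilon>) + of_int (j div int m) * T} A"
    unfolding integral_shift_period AB_shift ..
  finally show "\<nu> \<le> integral {lft j + \<epsilon>..mid j - \<epsilon>} A" by (simp add: lft_def mid_def algebra_simps)
qed

lemma g_attains_min:
  assumes "0 < p" "p \<le> q"
  obtains \<gamma> where "0 < \<gamma>" "\<And>s. s \<in> {p..q} \<Longrightarrow> \<gamma> \<le> g s"
proof -
  have "continuous_on {p..q} g" using g_cont by (rule continuous_on_subset) (use assms in auto)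
  then obtain s0 where "s0 \<in> {p..q}" "\<And>s. s \<in> {p..q} \<Longrightarrow> g s0 \<le> g s"
    using continuous_attains_inf[of "{p..q}" g] assms by auto
  then show ?thesis using that[of "g s0"] g_pos[of s0] assms by auto
qed

text \<open>The lower end of the range in \<open>eta\<close> is the height that concavity guarantees
  for a hump of height \<open>\<rho>\<close> at distance at least \<open>\<epsilon>\<close> from its
  ends; the longest hump gives the smallest one.\<close>

lemma eta_bounds:
  shows "0 < eta m \<sigma> \<tau> g \<epsilon> \<rho>"
    and "\<And>j s. \<epsilon> * \<rho> / (mid j - lft j) \<le> s \<Longrightarrow> s \<le> \<rho> \<Longrightarrow> eta m \<sigma> \<tau> g \<epsilon> \<rho> \<le> g s"
proof -
  define W where "W = Max ((\<lambda>i. \<tau> i - \<sigma> i) ` {1..m})"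
  have Wj: "mid j - lft j \<le> W" for j
    unfolding W_def by (rule Max_ge) (use idx_range[of j] in \<open>auto simp: mid_def lft_def\<close>)
  have W0: "0 < W" "\<epsilon> \<le> W" using Wj[of 0] order(1)[of 0] eps_hump(1) eps_hump(2)[of 0] by auto
  then have q: "0 < \<epsilon> * \<rho> / W" "\<epsilon> * \<rho> / W \<le> \<rho>" using eps_hump(1) rho by (auto simp: divide_simps)
  obtain \<gamma> where \<gamma>: "0 < \<gamma>" "\<And>s. s \<in> {\<epsilon> * \<rho> / W..\<rho>} \<Longrightarrow> \<gamma> \<le> g s"
    using g_attains_min[OF q] by metis
  have "\<gamma> \<le> eta m \<sigma> \<tau> g \<epsilon> \<rho>"
    unfolding eta_def W_def[symmetric] by (rule cINF_greatest) (use q \<gamma> in auto)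
  then show "0 < eta m \<sigma> \<tau> g \<epsilon> \<rho>" using \<gamma>(1) by simp
  show "eta m \<sigma> \<tau> g \<epsilon> \<rho> \<le> g s" if s: "\<epsilon> * \<rho> / (mid j - lft j) \<le> s" "s \<le> \<rho>" for j s
    unfolding eta_def W_def[symmetric]
  proof (rule cINF_lower)
    show "bdd_below (g ` {\<epsilon> * \<rho> / W..\<rho>})" using \<gamma>(2) by (intro bdd_belowI[of _ \<gamma>]) auto
    have "\<epsilon> * \<rho> / W \<le> \<epsilon> * \<rho> / (mid j - lft j)"
      using Wj[of j] order(1)[of j] eps_hump(1) rho by (intro divide_left_mono) auto
    then show "s \<in> {\<epsilon> * \<rho> / W..\<rho>}" using s by auto
  qed
qed

lemma lam_large: "2 * \<rho> / \<epsilon> < lam * eta m \<sigma> \<tau> g \<epsilon> \<rho> * \<nu>" "0 < lam"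
proof -
  have p: "0 < \<epsilon> * \<nu> * eta m \<sigma> \<tau> g \<epsilon> \<rho>" using eps_hump(1) nu_bounds(1) eta_bounds(1) by simp
  have "2 * \<rho> / (\<epsilon> * \<nu> * eta m \<sigma> \<tau> g \<epsilon> \<rho>) < lam" using lam by (simp add: lambda_star_def \<nu>_def)
  then show "2 * \<rho> / \<epsilon> < lam * eta m \<sigma> \<tau> g \<epsilon> \<rho> * \<nu>"
    using p eps_hump(1) by (simp add: divide_less_eq pos_divide_less_eq algebra_simps)
  have "0 < 2 * \<rho> / (\<epsilon> * \<nu> * eta m \<sigma> \<tau> g \<epsilon> \<rho>)" using p rho by simp
  then show "0 < lam" using \<open>_ < lam\<close> by simp
qed

text \<open>Admissibility in the form of a force estimate: while \<open>x\<close> is between half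
  its maximum \<open>d\<close> and \<open>d\<close>, the force \<open>lam * g x\<close> is at most
  \<open>lam * (zeta g d * d)\<close>, and this rate of bending cannot cost \<open>d / 2\<close> of
  height over a hump and the negativity interval after it.\<close>

lemma zeta_bound:
  assumes d: "d = r \<or> d = R"
  shows "\<And>s. s \<in> {d / 2..d} \<Longrightarrow> g s \<le> zeta g d * d"
    and "lam * (zeta g d * d) * integral {lft j..mid j} A * (lft (j + 1) - lft j) < d / 2" and "0 \<le> zeta g d"
proof -
  have d0: "0 < d" using d radii by auto
  have "continuous_on {d / 2..d} (\<lambda>s. g s / s)"
    by (intro continuous_on_divide continuous_on_subset[OF g_cont]) (use d0 in auto)
  then have bdd: "bdd_above ((\<lambda>s. g s / s) ` {d / 2..d})"
    by (intro bounded_imp_bdd_above compact_imp_bounded compact_continuous_image) auto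
  have up: "g s / s \<le> zeta g d" if "s \<in> {d / 2..d}" for s
    unfolding zeta_def by (rule cSUP_upper[OF that bdd])
  show z0: "0 \<le> zeta g d" using up[of d] g_pos[of d] d0 by (auto intro: order_trans[rotated])
  show "g s \<le> zeta g d * d" if s: "s \<in> {d / 2..d}" for s
  proof -
    have "g s \<le> zeta g d * s" using up[OF s] s d0 by (simp add: divide_le_eq)
    also have "\<dots> \<le> zeta g d * d" using s z0 by (intro mult_left_mono) auto
    finally show ?thesis .
  qed
  define Q where "Q = Max ((\<lambda>i. ((\<tau> i - \<sigma> i) + (\<sigma> (i + 1) - \<tau> i)) * norm_plus \<sigma> \<tau> a i) ` {1..m})"
  have np: "norm_plus \<sigma> \<tau> a (idx j) = integral {lft j..mid j} A"
    unfolding norm_plus_def LINT_A lft_def mid_def integral_shift_period AB_shift ..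
  have len: "(\<tau> (idx j) - \<sigma> (idx j)) + (\<sigma> (idx j + 1) - \<tau> (idx j)) = lft (j + 1) - lft j"
    using lft_next[of j] by (simp add: lft_def)
  have "((\<tau> (idx j) - \<sigma> (idx j)) + (\<sigma> (idx j + 1) - \<tau> (idx j))) * norm_plus \<sigma> \<tau> a (idx j) \<le> Q"
    unfolding Q_def by (rule Max_ge) (use idx_range in auto)
  then have Qj: "(lft (j + 1) - lft j) * integral {lft j..mid j} A \<le> Q" unfolding np len .
  have Q0: "0 < Q"
  proof -
    have "0 < (lft (j + 1) - lft j) * integral {lft j..mid j} A" using order[of j] sign_on_pieces(3)[of j] by simp
    then show ?thesis using Qj by simp
  qed
  have "zeta g d < inverse (2 * lam * Q)" using adm d d0 unfolding admissible_def Q_def by auto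
  moreover have "0 < 2 * lam * Q" using Q0 lam_large(2) by simp
  ultimately have "zeta g d * (2 * lam * Q) < 1"
    by (simp add: inverse_eq_divide pos_less_divide_eq del: zero_less_mult_iff)
  then have "lam * zeta g d * Q < 1 / 2" by (simp add: algebra_simps)
  moreover have "lam * zeta g d * ((lft (j + 1) - lft j) * integral {lft j..mid j} A) \<le> lam * zeta g d * Q"
    using Qj z0 lam_large(2) by (intro mult_left_mono) auto
  ultimately have "lam * zeta g d * ((lft (j + 1) - lft j) * integral {lft j..mid j} A) < 1 / 2" by simp
  from mult_strict_right_mono[OF this d0]
  have "lam * zeta g d * ((lft (j + 1) - lft j) * integral {lft j..mid j} A) * d < d / 2" by simp
  also have "lam * zeta g d * ((lft (j + 1) - lft j) * integral {lft j..mid j} A) * d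
      = lam * (zeta g d * d) * integral {lft j..mid j} A * (lft (j + 1) - lft j)" by (simp only: ac_simps)
  finally show "lam * (zeta g d * d) * integral {lft j..mid j} A * (lft (j + 1) - lft j) < d / 2" .
qed


text \<open>\<open>\<phi>\<close> stands for \<open>lam * g x\<close>, which is what it is for a true solution; the bound \<open>R + 1\<close> instead of \<open>R\<close>
  leaves room for cutting off the nonlinearity.\<close>

definition gen_solution :: "real \<Rightarrow> (real \<Rightarrow> real) \<Rightarrow> (real \<Rightarrow> real) \<Rightarrow> (real \<Rightarrow> real) \<Rightarrow> bool" where
  "gen_solution \<mu> \<phi> x y \<longleftrightarrow>
     integral_solution (\<lambda>t. \<mu> * (B t * g (x t)) - A t * \<phi> t) x y \<and>
     (\<forall>t. 0 \<le> x t \<and> x t \<le> R + 1) \<and> (\<forall>t. 0 \<le> \<phi> t)"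

lemma gen_solutionD:
  assumes "gen_solution \<mu> \<phi> x y"
  shows "\<And>s t. s \<le> t \<Longrightarrow> (y has_integral x t - x s) {s..t}"
    and "\<And>S. continuous_on S x" "\<And>S. continuous_on S y"
    and "\<And>t. 0 \<le> x t" "\<And>t. x t \<le> R + 1" "\<And>t. 0 \<le> \<phi> t"
    and "\<And>j s t. lft j \<le> s \<Longrightarrow> s \<le> t \<Longrightarrow> t \<le> mid j \<Longrightarrow> ((\<lambda>t. - (A t * \<phi> t)) has_integral y t - y s) {s..t}"
    and "\<And>j s t. mid j \<le> s \<Longrightarrow> s \<le> t \<Longrightarrow> t \<le> lft (j + 1) \<Longrightarrow> ((\<lambda>t. \<mu> * (B t * g (x t))) has_integral y t - y s) {s..t}"
proof -
  have sol: "integral_solution (\<lambda>t. \<mu> * (B t * g (x t)) - A t * \<phi> t) x y"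
    using assms by (simp add: gen_solution_def)
  show "\<And>s t. s \<le> t \<Longrightarrow> (y has_integral x t - x s) {s..t}"
    "\<And>S. continuous_on S x" "\<And>S. continuous_on S y" using integral_solutionD[OF sol] by blast+
  show "\<And>t. 0 \<le> x t" "\<And>t. x t \<le> R + 1" "\<And>t. 0 \<le> \<phi> t"
    using assms by (auto simp: gen_solution_def)
  show "((\<lambda>t. - (A t * \<phi> t)) has_integral y t - y s) {s..t}" if st: "lft j \<le> s" "s \<le> t" "t \<le> mid j" for j s t
    by (rule has_integral_spike[OF sign_on_pieces(1)[of j] _ integral_solutionD(2)[OF sol st(2)]])
      (use st in auto)
  show "((\<lambda>t. \<mu> * (B t * g (x t))) has_integral y t - y s) {s..t}" if st: "mid j \<le> s" "s \<le> t" "t \<le> lft (j + 1)" for j s t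
    by (rule has_integral_spike[OF sign_on_pieces(2)[of j] _ integral_solutionD(2)[OF sol st(2)]])
      (use st in auto)
qed

lemma g_nonneg: "0 \<le> s \<Longrightarrow> 0 \<le> g s"
  using g_pos[of s] g_zero by (cases "s = 0") auto

text \<open>The slope is nondecreasing there, so its sign at \<open>t\<close> tells which end lies
  at least as high. This carries bounds on the humps over to all times.\<close>

lemma convex_between_humps:
  assumes sol: "gen_solution \<mu> \<phi> x y" and \<mu>: "0 \<le> \<mu>" and t: "t \<in> {mid j..lft (j + 1)}"
  shows "x t \<le> max (x (mid j)) (x (lft (j + 1)))"
proof -
  note D = gen_solutionD[OF sol]
  have mono: "y s \<le> y s'" if "mid j \<le> s" "s \<le> s'" "s' \<le> lft (j + 1)" for s s'
  proof -
    have "((\<lambda>r. 0) has_integral (0::real)) {s..s'}" by simp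
    then have "0 \<le> y s' - y s"
      by (rule has_integral_le[OF _ D(8)[OF that]]) (use \<mu> AB_nonneg g_nonneg D(4) in auto)
    then show ?thesis by simp
  qed
  show ?thesis
  proof (cases "0 \<le> y t")
    case True
    have "((\<lambda>r. 0) has_integral (0::real)) {t..lft (j + 1)}" by simp
    then have "0 \<le> x (lft (j + 1)) - x t"
      by (rule has_integral_le[OF _ D(1)]) (use t mono[of t] True in force)+
    then show ?thesis by simp
  next
    case False
    have z: "((\<lambda>r. 0) has_integral (0::real)) {mid j..t}" by simp
    have "x t - x (mid j) \<le> 0"
      by (rule has_integral_le[OF D(1) z]) (use t mono[of _ t] False in force)+
    then show ?thesis by simp
  qed
qed

text \<open>With such a small force the solution stays above half of its maximum up to the end of the next
  negativity interval, where convexity with large \<open>\<mu>\<close> drives it above \<open>R + 1\<close>. If it is already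
  decreasing at its maximum, then that is the left end of the interval, and the same happens on the
  preceding negativity interval, backwards in time.\<close>

lemma weak_hump_impossible:
  obtains \<mu>0 where "0 < \<mu>0"
    "\<And>\<mu> \<phi> x y j t0 b. \<mu> > \<mu>0 \<Longrightarrow> gen_solution \<mu> \<phi> x y \<Longrightarrow> t0 \<in> {lft j..mid j} \<Longrightarrow>
       (\<And>t. t \<in> {lft j..mid j} \<Longrightarrow> x t \<le> x t0) \<Longrightarrow> r \<le> x t0 \<Longrightarrow> 0 \<le> b \<Longrightarrow>
       (\<And>t. t \<in> {lft j..mid j} \<Longrightarrow> x t0 / 2 \<le> x t \<Longrightarrow> \<phi> t \<le> b) \<Longrightarrow>
       b * integral {lft j..mid j} A * (lft (j + 1) - lft j) < x t0 / 2 \<Longrightarrow> False"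
proof -
  define M where "M = R + 1"
  have r2: "0 < r / 2" "r / 2 \<le> M" using radii by (auto simp: M_def)
  obtain \<gamma> where \<gamma>: "0 < \<gamma>" "\<And>s. s \<in> {r / 2..M} \<Longrightarrow> \<gamma> \<le> g s" using g_attains_min[OF r2] by metis
  obtain \<kappa> where \<kappa>: "0 < \<kappa>" "\<And>j. \<kappa> \<le> integral {mid j..lft (j + 1)} (\<lambda>t. integral {mid j..t} B)"
    "\<And>j. \<kappa> \<le> integral {mid j..lft (j + 1)} (\<lambda>t. integral {t..lft (j + 1)} B)"
    using uniform_gain by metis
  \<comment> \<open>Here \<open>\<gamma>\<close> bounds \<open>g\<close> from below at the heights
    met and \<open>\<kappa>\<close> bounds the double integral of \<open>B\<close>. Beyond this
    value the convex gain exceeds \<open>2 * M\<close>: one \<open>M\<close> for the variation of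
    \<open>x\<close>, one for a descending initial slope.\<close>
  define \<mu>0 where "\<mu>0 = 2 * M / (\<gamma> * \<kappa>)"
  have M0: "0 < M" using radii by (simp add: M_def)
  have \<mu>0: "0 < \<mu>0" using M0 \<gamma>(1) \<kappa>(1) by (simp add: \<mu>0_def)
  have big: "2 * M < \<mu> * \<gamma> * I" if "\<mu> > \<mu>0" "\<kappa> \<le> I" for \<mu> I
  proof -
    have "2 * M = \<mu>0 * \<gamma> * \<kappa>" using \<gamma>(1) \<kappa>(1) by (simp add: \<mu>0_def)
    also have "\<dots> < \<mu> * \<gamma> * \<kappa>" using that \<gamma>(1) \<kappa>(1) by simp
    also have "\<dots> \<le> \<mu> * \<gamma> * I" using that \<gamma>(1) \<mu>0 by (intro mult_left_mono) auto
    finally show ?thesis .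
  qed
  show ?thesis
  proof (rule that[OF \<mu>0])
    fix \<mu> \<phi> x y j t0 b
    assume \<mu>: "\<mu> > \<mu>0" and sol: "gen_solution \<mu> \<phi> x y" and t0: "t0 \<in> {lft j..mid j}"
      and max: "\<And>t. t \<in> {lft j..mid j} \<Longrightarrow> x t \<le> x t0" and rD: "r \<le> x t0" and b: "0 \<le> b"
      and \<phi>b: "\<And>t. t \<in> {lft j..mid j} \<Longrightarrow> x t0 / 2 \<le> x t \<Longrightarrow> \<phi> t \<le> b"
      and small: "b * integral {lft j..mid j} A * (lft (j + 1) - lft j) < x t0 / 2"
    note D = gen_solutionD[OF sol]
    have \<mu>p: "0 \<le> \<mu>" using \<mu> \<mu>0 by simp
    have xM: "0 \<le> x t" "x t \<le> M" for t using D(4,5) by (auto simp: M_def)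
    define N where "N = integral {lft j..mid j} A"
    have N: "0 \<le> N" using sign_on_pieces(3)[of j] by (simp add: N_def)
    note ord = order[of j]
    show False
    proof (cases "0 \<le> y t0")
      case True
      have sub: "integral {t0..mid j} A \<le> N"
        unfolding N_def using t0 AB_nonneg by (intro integral_subset_le AB_integrable) auto
      have "b * N * (mid j - t0) \<le> b * N * (lft (j + 1) - lft j)"
        using b N t0 ord by (intro mult_left_mono) auto
      then have small': "b * N * (mid j - t0) < x t0 / 2" using small by (simp add: N_def)
      have "- (b * N) \<le> y (mid j)" and xm: "x t0 - b * N * (mid j - t0) \<le> x (mid j)"
        using slow_descent[of t0 "mid j" y x A \<phi> N b "x t0"] t0 D(1,2) D(7)[of j t0] AB_nonneg AB_integrable sub b \<phi>b True rD radii small'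
        by auto
      note ym = this(1)
      define q where "q = lft (j + 1)"
      have conv: "y (mid j) \<le> y s" if "s \<in> {mid j..q}" for s
      proof -
        have "((\<lambda>r. 0) has_integral (0::real)) {mid j..s}" by simp
        then have "0 \<le> y s - y (mid j)"
          by (rule has_integral_le[OF _ D(8)[of j]]) (use that \<mu>p AB_nonneg g_nonneg D(4) in \<open>auto simp: q_def\<close>)
        then show ?thesis by simp
      qed
      \<comment> \<open>Convexity keeps the rate of descent below \<open>b * N\<close> after
        \<open>mid j\<close> as well, so the estimate runs over both intervals at once.\<close>
      have above: "x t0 / 2 \<le> x s" if s: "s \<in> {mid j..q}" for s
      proof -
        have "(s - mid j) *\<^sub>R (- (b * N)) \<le> x s - x (mid j)"
          using has_integral_le[OF has_integral_const_real[of "- (b * N)" "mid j" s] D(1)[of "mid j" s]] s conv ym by force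
        then have "x t0 - b * N * (s - t0) \<le> x s" using xm by (simp add: algebra_simps)
        moreover have "b * N * (s - t0) \<le> b * N * (lft (j + 1) - lft j)"
          using b N t0 s by (intro mult_left_mono) (auto simp: q_def)
        ultimately show ?thesis using small by (simp add: N_def)
      qed
      have "y (mid j) * (q - mid j) + \<mu> * \<gamma> * integral {mid j..q} (\<lambda>t. integral {mid j..t} B) \<le> x q - x (mid j)"
      proof (rule convex_gain_right)
        show "((\<lambda>t. \<mu> * (B t * g (x t))) has_integral y t - y (mid j)) {mid j..t}" if "t \<in> {mid j..q}" for t
          using that by (intro D(8)) (auto simp: q_def)
        show "\<gamma> \<le> g (x t)" if "t \<in> {mid j..q}" for t using above[OF that] rD xM[of t] by (intro \<gamma>(2)) auto
      qed (use ord D(1) AB_nonneg AB_integrable \<mu>p in \<open>auto simp: q_def\<close>)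
      moreover have "- M \<le> y (mid j) * (q - mid j)"
      proof -
        have "b * N * (q - mid j) \<le> b * N * (lft (j + 1) - lft j)"
          using b N ord by (intro mult_left_mono) (auto simp: q_def)
        moreover have "- (b * N) * (q - mid j) \<le> y (mid j) * (q - mid j)"
          using ym ord by (intro mult_right_mono) (auto simp: q_def)
        ultimately show ?thesis using small xM[of t0] by (simp add: N_def)
      qed
      moreover have "2 * M < \<mu> * \<gamma> * integral {mid j..q} (\<lambda>t. integral {mid j..t} B)"
        unfolding q_def by (rule big[OF \<mu> \<kappa>(2)])
      ultimately show False using xM[of q] xM[of "mid j"] by linarith
    next
      case False
      have ydecr: "y t \<le> y s" if "lft j \<le> s" "s \<le> t" "t \<le> mid j" for s t
      proof -
        have "((\<lambda>r. 0) has_integral (0::real)) {s..t}" by simp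
        then have "y t - y s \<le> 0"
          by (rule has_integral_le[OF D(7)[OF that]]) (use AB_nonneg D(6) in auto)
        then show ?thesis by simp
      qed
      \<comment> \<open>At any other point of the hump a negative slope would make \<open>x\<close>
        larger just before \<open>t0\<close>.\<close>
      have t0l: "t0 = lft j"
      proof (rule ccontr)
        assume "t0 \<noteq> lft j"
        then have l: "lft j < t0" using t0 by auto
        have "continuous_on UNIV y" by (rule D(3))
        then have "isCont y t0" by (simp add: continuous_on_eq_continuous_at)
        then obtain d where d: "d > 0" "\<And>s. dist s t0 < d \<Longrightarrow> dist (y s) (y t0) < - y t0"
          using False unfolding continuous_at_eps_delta by (metis not_le neg_0_less_iff_less)
        define s where "s = max (lft j) (t0 - d / 2)"
        have s: "lft j \<le> s" "s < t0" "s \<le> t0" using l d(1) by (auto simp: s_def)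
        have neg: "y q < 0" if "q \<in> {s..t0}" for q
        proof -
          have "dist q t0 < d" using that d(1) by (auto simp: s_def dist_real_def)
          from d(2)[OF this] show ?thesis by (simp add: dist_real_def abs_less_iff)
        qed
        have ys: "y q \<le> y s" if "q \<in> {s..t0}" for q using ydecr[of s q] s that t0 by auto
        have "x t0 - x s \<le> (t0 - s) *\<^sub>R y s"
          using has_integral_le[OF D(1)[OF s(3)] has_integral_const_real[of "y s" s t0]] ys s by force
        also have "\<dots> < 0" using neg[of s] s by (simp add: mult_pos_neg)
        finally have "x t0 < x s" by simp
        then show False using max[of s] s t0 by auto
      qed
      define p where "p = mid (j - 1)"
      have pq: "p < lft j" using order(2)[of "j - 1"] by (simp add: p_def)
      have yneg: "y s \<le> 0" if s: "s \<in> {p..lft j}" for s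
      proof -
        have "((\<lambda>r. 0) has_integral (0::real)) {s..lft j}" by simp
        then have "0 \<le> y (lft j) - y s"
          by (rule has_integral_le[OF _ D(8)[of "j - 1"]]) (use s \<mu>p AB_nonneg g_nonneg D(4) in \<open>auto simp: p_def\<close>)
        then show ?thesis using False t0l by simp
      qed
      have above: "x t0 \<le> x s" if s: "s \<in> {p..lft j}" for s
      proof -
        have z: "((\<lambda>r. 0) has_integral (0::real)) {s..lft j}" by simp
        have "x (lft j) - x s \<le> 0"
          by (rule has_integral_le[OF D(1) z]) (use s yneg in auto)
        then show ?thesis using t0l by simp
      qed
      have "x (lft j) - x p \<le> y (lft j) * (lft j - p) - \<mu> * \<gamma> * integral {p..lft j} (\<lambda>t. integral {t..lft j} B)"
      proof (rule convex_gain_left)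
        show "((\<lambda>t. \<mu> * (B t * g (x t))) has_integral y (lft j) - y t) {t..lft j}" if "t \<in> {p..lft j}" for t
          using D(8)[of "j - 1" t "lft j"] that by (auto simp: p_def)
        show "\<gamma> \<le> g (x t)" if "t \<in> {p..lft j}" for t using above[OF that] rD xM[of t] radii by (intro \<gamma>(2)) auto
      qed (use pq D(1) AB_nonneg AB_integrable \<mu>p in auto)
      moreover have "y (lft j) * (lft j - p) \<le> 0" using yneg[of "lft j"] pq by (intro mult_nonpos_nonneg) auto
      moreover have "2 * M < \<mu> * \<gamma> * integral {p..lft j} (\<lambda>t. integral {t..lft j} B)"
        using big[OF \<mu> \<kappa>(3)[of "j - 1"]] by (simp add: p_def)
      ultimately show False using xM[of "lft j"] xM[of p] M0 by linarith
    qed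
  qed
qed

text \<open>Away from the ends the force is at least \<open>lam * eta\<close>, and concavity would
  force \<open>lam * eta * \<nu>\<close> to be at most \<open>2 * \<rho> / \<epsilon>\<close>. The
  inequality \<open>lam > lambda_star\<close> says the opposite.\<close>

lemma hump_at_rho_impossible:
  assumes sol: "gen_solution \<mu> \<phi> x y" and t0: "t0 \<in> {lft j..mid j}" "x t0 = \<rho>"
    and max: "\<And>t. t \<in> {lft j..mid j} \<Longrightarrow> x t \<le> \<rho>"
    and \<phi>: "\<And>t. t \<in> {lft j..mid j} \<Longrightarrow> lam * g (x t) \<le> \<phi> t"
  shows False
proof -
  note D = gen_solutionD[OF sol]
  define H where "H = eta m \<sigma> \<tau> g \<epsilon> \<rho>"
  have lower: "\<epsilon> * \<rho> / (mid j - lft j) \<le> x t" if "t \<in> {lft j + \<epsilon>..mid j - \<epsilon>}" for t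
    using concave_hump(2)[of \<epsilon> "mid j" "lft j" y x A \<phi> \<rho> t0 t] eps_hump(1) eps_hump(2)[of j] D(1) D(7)[of j]
      AB_nonneg(1) AB_integrable(1) D(4,6) max t0 that by auto
  have "lam * H \<le> \<phi> t" if t: "t \<in> {lft j + \<epsilon>..mid j - \<epsilon>}" for t
  proof -
    have tt: "t \<in> {lft j..mid j}" using t eps_hump(1) by auto
    have "H \<le> g (x t)" unfolding H_def using lower[OF t] max[OF tt] by (rule eta_bounds(2))
    then have "lam * H \<le> lam * g (x t)" using lam_large(2) by simp
    then show ?thesis using \<phi>[OF tt] by simp
  qed
  then have "lam * H * integral {lft j + \<epsilon>..mid j - \<epsilon>} A \<le> 2 * \<rho> / \<epsilon>"
    using concave_hump(1)[of \<epsilon> "mid j" "lft j" y x A \<phi> \<rho> "lam * H"] eps_hump(1) eps_hump(2)[of j] D(1) D(7)[of j]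
      AB_nonneg(1) AB_integrable(1) D(4,6) max by auto
  moreover have "lam * H * \<nu> \<le> lam * H * integral {lft j + \<epsilon>..mid j - \<epsilon>} A"
    using lam_large(2) eta_bounds(1) nu_bounds(2) by (intro mult_left_mono) (auto simp: H_def)
  ultimately show False using lam_large(1) by (simp add: H_def)
qed

text \<open>The same slope count with the crude height \<open>R + 1\<close> and without a lower
  bound on \<open>x\<close>. It dictates the cap on the coefficient: the additive force at the cap
  is unaffordable.\<close>

lemma strong_forcing_impossible:
  assumes sol: "gen_solution \<mu> \<phi> x y" and \<beta>: "2 * (R + 1) / \<epsilon> < \<beta> * \<nu>" "0 \<le> \<beta>"
    and \<phi>: "\<And>t. t \<in> {lft j..mid j} \<Longrightarrow> \<beta> \<le> \<phi> t"
  shows False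
proof -
  note D = gen_solutionD[OF sol]
  have "\<beta> * integral {lft j + \<epsilon>..mid j - \<epsilon>} A \<le> 2 * (R + 1) / \<epsilon>"
    using concave_hump(1)[of \<epsilon> "mid j" "lft j" y x A \<phi> "R + 1" \<beta>] eps_hump(1) eps_hump(2)[of j] D(1) D(7)[of j]
      AB_nonneg(1) AB_integrable(1) D(4,5,6) \<phi> by auto
  moreover have "\<beta> * \<nu> \<le> \<beta> * integral {lft j + \<epsilon>..mid j - \<epsilon>} A"
    using \<beta>(2) nu_bounds(2) by (intro mult_left_mono)
  ultimately show False using \<beta>(1) by simp
qed

end

section \<open>Maxima on humps and the levels they avoid\<close>

lemma SUP_close:
  fixes u v :: "real \<Rightarrow> real"
  assumes S: "S \<noteq> {}" and b: "\<And>t. t \<in> S \<Longrightarrow> u t \<le> c \<and> v t \<le> c" and e: "\<And>t. t \<in> S \<Longrightarrow> \<bar>u t - v t\<bar> \<le> e"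
  shows "\<bar>(SUP t\<in>S. u t) - (SUP t\<in>S. v t)\<bar> \<le> e"
proof -
  have bd: "bdd_above (u ` S)" "bdd_above (v ` S)" using b by (auto intro!: bdd_aboveI2)
  have "(SUP t\<in>S. u t) \<le> (SUP t\<in>S. v t) + e"
  proof (rule cSUP_least[OF S])
    show "u t \<le> (SUP t\<in>S. v t) + e" if "t \<in> S" for t
      using cSUP_upper[OF that bd(2)] e[OF that] by linarith
  qed
  moreover have "(SUP t\<in>S. v t) \<le> (SUP t\<in>S. u t) + e"
  proof (rule cSUP_least[OF S])
    show "v t \<le> (SUP t\<in>S. u t) + e" if "t \<in> S" for t
      using cSUP_upper[OF that bd(1)] e[OF that] by linarith
  qed
  ultimately show ?thesis by linarith
qed

context sign_changing_problem
begin

definition hmax :: "(real \<Rightarrow> real) \<Rightarrow> int \<Rightarrow> real" where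
  "hmax x j = (SUP t\<in>{lft j..mid j}. x t)"

lemma hmax_attained:
  assumes "continuous_on {lft j..mid j} x"
  obtains t0 where "t0 \<in> {lft j..mid j}" "x t0 = hmax x j" "\<And>t. t \<in> {lft j..mid j} \<Longrightarrow> x t \<le> hmax x j"
proof -
  obtain t0 where t0: "t0 \<in> {lft j..mid j}" "\<And>t. t \<in> {lft j..mid j} \<Longrightarrow> x t \<le> x t0"
    using continuous_attains_sup[OF _ _ assms] order(1)[of j] by auto
  have "hmax x j = x t0"
    unfolding hmax_def by (rule cSup_eq_maximum) (use t0 in auto)
  then show ?thesis using that t0 by simp
qed

text \<open>The only form, apart from its sign, in which the size of \<open>\<mu>\<close> enters
  from here on. It speaks about all solutions and all humps at once, with no reference to a period,
  so one threshold serves every itinerary.\<close>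

definition rigid :: "real \<Rightarrow> bool" where
  "rigid \<mu> \<longleftrightarrow> 0 < \<mu> \<and> (\<forall>\<phi> x y j b. gen_solution \<mu> \<phi> x y \<longrightarrow> r \<le> hmax x j \<longrightarrow> 0 \<le> b \<longrightarrow>
       (\<forall>t\<in>{lft j..mid j}. hmax x j / 2 \<le> x t \<longrightarrow> \<phi> t \<le> b) \<longrightarrow>
       b * integral {lft j..mid j} A * (lft (j + 1) - lft j) < hmax x j / 2 \<longrightarrow> False)"

lemma rigid_large: "\<exists>\<mu>0>0. \<forall>\<mu>>\<mu>0. rigid \<mu>"
proof -
  obtain \<mu>0 where \<mu>0: "0 < \<mu>0"
    and W: "\<And>\<mu> \<phi> x y j t0 b. \<mu> > \<mu>0 \<Longrightarrow> gen_solution \<mu> \<phi> x y \<Longrightarrow> t0 \<in> {lft j..mid j} \<Longrightarrow>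
       (\<And>t. t \<in> {lft j..mid j} \<Longrightarrow> x t \<le> x t0) \<Longrightarrow> r \<le> x t0 \<Longrightarrow> 0 \<le> b \<Longrightarrow>
       (\<And>t. t \<in> {lft j..mid j} \<Longrightarrow> x t0 / 2 \<le> x t \<Longrightarrow> \<phi> t \<le> b) \<Longrightarrow>
       b * integral {lft j..mid j} A * (lft (j + 1) - lft j) < x t0 / 2 \<Longrightarrow> False"
    by (rule weak_hump_impossible) blast
  have "rigid \<mu>" if \<mu>: "\<mu> > \<mu>0" for \<mu>
    unfolding rigid_def
  proof (intro conjI allI impI)
    show "0 < \<mu>" using \<mu> \<mu>0 by simp
    fix \<phi> x y j b
    assume sol: "gen_solution \<mu> \<phi> x y" and *: "r \<le> hmax x j" "0 \<le> b"
      "\<forall>t\<in>{lft j..mid j}. hmax x j / 2 \<le> x t \<longrightarrow> \<phi> t \<le> b"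
      "b * integral {lft j..mid j} A * (lft (j + 1) - lft j) < hmax x j / 2"
    obtain t0 where t0: "t0 \<in> {lft j..mid j}" "x t0 = hmax x j" "\<And>t. t \<in> {lft j..mid j} \<Longrightarrow> x t \<le> hmax x j"
      using hmax_attained[OF gen_solutionD(2)[OF sol]] by metis
    show False by (rule W[OF \<mu> sol t0(1)]) (use * t0 in auto)
  qed
  then show ?thesis using \<mu>0 by blast
qed

lemma rigidD:
  assumes "rigid \<mu>" "gen_solution \<mu> \<phi> x y" "r \<le> hmax x j" "0 \<le> b"
    "\<And>t. t \<in> {lft j..mid j} \<Longrightarrow> hmax x j / 2 \<le> x t \<Longrightarrow> \<phi> t \<le> b"
    "b * integral {lft j..mid j} A * (lft (j + 1) - lft j) < hmax x j / 2"
  shows False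
  using assms unfolding rigid_def by blast

text \<open>The one-sided hypotheses on \<open>\<phi>\<close> are those that a coefficient at most
  \<open>lam\<close>, respectively at least \<open>lam\<close>, provides. For a true solution both
  hold, so that all three levels are avoided.\<close>

lemma levels_avoided:
  assumes sol: "gen_solution \<mu> \<phi> x y"
  shows "rigid \<mu> \<Longrightarrow> hmax x j = r \<or> hmax x j = R \<Longrightarrow>
      (\<And>t. t \<in> {lft j..mid j} \<Longrightarrow> \<phi> t \<le> lam * g (x t)) \<Longrightarrow> False"
    and "hmax x j = \<rho> \<Longrightarrow> (\<And>t. t \<in> {lft j..mid j} \<Longrightarrow> lam * g (x t) \<le> \<phi> t) \<Longrightarrow> False"
proof -
  note D = gen_solutionD[OF sol]
  obtain t0 where t0: "t0 \<in> {lft j..mid j}" "x t0 = hmax x j" "\<And>t. t \<in> {lft j..mid j} \<Longrightarrow> x t \<le> hmax x j"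
    using hmax_attained[OF D(2)] by metis
  show False if \<mu>: "rigid \<mu>" and d: "hmax x j = r \<or> hmax x j = R"
    and \<phi>: "\<And>t. t \<in> {lft j..mid j} \<Longrightarrow> \<phi> t \<le> lam * g (x t)"
  proof (rule rigidD[OF \<mu> sol])
    define d where "d = hmax x j"
    have d: "d = r \<or> d = R" using that(2) by (simp add: d_def)
    note Z = zeta_bound[OF d]
    show "r \<le> hmax x j" using that(2) radii by auto
    \<comment> \<open>skip\<close>
    show "0 \<le> lam * (zeta g d * d)" using Z(3) lam_large(2) d radii by (auto intro!: mult_nonneg_nonneg)
    show "lam * (zeta g d * d) * integral {lft j..mid j} A * (lft (j + 1) - lft j) < hmax x j / 2"
      using Z(2) by (simp add: d_def)
    show "\<phi> t \<le> lam * (zeta g d * d)" if t: "t \<in> {lft j..mid j}" "hmax x j / 2 \<le> x t" for t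
    proof -
      have "g (x t) \<le> zeta g d * d" using t t0(3)[of t] by (intro Z(1)) (auto simp: d_def)
      then have "lam * g (x t) \<le> lam * (zeta g d * d)" using lam_large(2) by simp
      then show ?thesis using \<phi>[OF t(1)] by simp
    qed
  qed
  show False if h: "hmax x j = \<rho>" and \<phi>: "\<And>t. t \<in> {lft j..mid j} \<Longrightarrow> lam * g (x t) \<le> \<phi> t"
    by (rule hump_at_rho_impossible[OF sol t0(1)]) (use t0 h \<phi> in auto)
qed

definition in_band :: "nat \<Rightarrow> real \<Rightarrow> bool" where
  "in_band s h \<longleftrightarrow> (if s = 0 then h < r else if s = 1 then r < h \<and> h < \<rho> else \<rho> < h \<and> h < R)"

lemma lft_mono: "i \<le> j \<Longrightarrow> lft i \<le> lft j"
proof (induction j rule: int_ge_induct)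
  case (step k)
  then show ?case using order[of k] by simp
qed simp

lemma lft_mid_less: "i < j \<Longrightarrow> mid i < lft j"
  using order(2)[of i] lft_mono[of "i + 1" j] by simp

lemma lft_zero: "lft 0 = 0"
  using points(3) by (simp add: lft_def idx_def)

lemma cover: "\<exists>j. t \<in> {lft j..lft (j + 1)}"
proof -
  have *: "\<exists>j. t \<in> {lft j..lft (j + 1)}" if "lft i \<le> t" "t \<le> lft (i + int n)" for i n
    using that
  proof (induction n)
    case 0
    then show ?case using order[of i] by (intro exI[of _ i]) auto
  next
    case (Suc n)
    show ?case
    proof (cases "t \<le> lft (i + int n)")
      case True
      then show ?thesis using Suc by simp
    next
      case False
      then show ?thesis using Suc.prems by (intro exI[of _ "i + int n"]) (auto simp: algebra_simps)
    qed
  qed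
  define l where "l = \<lfloor>t / T\<rfloor>"
  have l: "of_int l * T \<le> t" "t \<le> of_int (l + 1) * T"
    using floor_divide_lower[OF T, of t] floor_divide_upper[OF T, of t] by (auto simp: l_def algebra_simps)
  have L: "lft (q * int m) = of_int q * T" for q using shift_m(1)[of 0 q] lft_zero by simp
  have "(l + 1) * int m = l * int m + int m" by (simp add: algebra_simps)
  then show ?thesis using *[of "l * int m" m] l L[of l] L[of "l + 1"] by simp
qed

lemma g_bounded:
  obtains G where "0 \<le> G" "\<And>s. 0 \<le> s \<Longrightarrow> s \<le> R + 1 \<Longrightarrow> g s \<le> G"
proof -
  have "continuous_on {0..R + 1} g" using g_cont by (rule continuous_on_subset) auto
  then obtain s0 where "s0 \<in> {0..R + 1}" "\<And>s. s \<in> {0..R + 1} \<Longrightarrow> g s \<le> g s0"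
    using continuous_attains_sup[of "{0..R + 1}" g] radii by auto
  then show ?thesis using that[of "g s0"] g_nonneg by auto
qed

lemma negligible_off_humps: "negligible (\<Union>j::int. {t \<in> {mid j..lft (j + 1)}. A t \<noteq> 0})"
proof (rule negligible_countable_Union)
  fix S assume "S \<in> range (\<lambda>j::int. {t \<in> {mid j..lft (j + 1)}. A t \<noteq> 0})"
  then show "negligible S" using sign_on_pieces(2) by blast
qed simp

text \<open>Off the humps \<open>A\<close> vanishes almost everywhere, so the values of
  \<open>\<phi>\<close> there are immaterial.\<close>

lemma true_solution:
  assumes sol: "gen_solution \<mu> \<phi> x y" and \<phi>: "\<And>j t. t \<in> {lft j..mid j} \<Longrightarrow> \<phi> t = lam * g (x t)"
  shows "integral_solution (\<lambda>t. - (weight a lam \<mu> t * g (x t))) x y"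
proof -
  have s: "integral_solution (\<lambda>t. \<mu> * (B t * g (x t)) - A t * \<phi> t) x y"
    using sol by (simp add: gen_solution_def)
  have eq: "- (weight a lam \<mu> t * g (x t)) = \<mu> * (B t * g (x t)) - A t * \<phi> t"
    if "t \<notin> (\<Union>j::int. {t \<in> {mid j..lft (j + 1)}. A t \<noteq> 0})" for t
  proof -
    obtain j where j: "t \<in> {lft j..lft (j + 1)}" using cover by blast
    have "A t = 0 \<or> \<phi> t = lam * g (x t)"
    proof (cases "t \<le> mid j")
      case True
      then show ?thesis using \<phi>[of t j] j by auto
    next
      case False
      then have "t \<in> {mid j..lft (j + 1)}" using j by auto
      then show ?thesis using that by blast
    qed
    then show ?thesis by (auto simp: weight_def algebra_simps)
  qed
  show ?thesis
    unfolding integral_solution_def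
  proof (intro allI impI conjI)
    fix s t :: real assume st: "s \<le> t"
    show "(y has_integral x t - x s) {s..t}" by (rule integral_solutionD(1)[OF \<open>integral_solution _ x y\<close> st])
    show "((\<lambda>t. - (weight a lam \<mu> t * g (x t))) has_integral y t - y s) {s..t}"
      by (rule has_integral_spike[OF negligible_off_humps _ integral_solutionD(2)[OF \<open>integral_solution _ x y\<close> st]])
        (use eq in blast)
  qed
qed

section \<open>Periodic orbits with prescribed itinerary\<close>


text \<open>It equals 1 up to \<open>R\<close> and 0 from \<open>R + 1\<close> on: the constant
  \<open>R + 1\<close> becomes a supersolution, and the force is unchanged on \<open>[0, R]\<close>,
  where the solutions turn out to lie.\<close>

definition cutoff :: "real \<Rightarrow> real" where "cutoff s = max 0 (min 1 (R + 1 - s))"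

text \<open>Below \<open>lam\<close> the parameter scales \<open>g\<close>; above it the surplus is
  a constant force, which acts even where \<open>g\<close> vanishes. Both regimes meet at
  \<open>p = lam\<close>, which gives the true force on \<open>[0, R]\<close>.\<close>

definition hump_force :: "real \<Rightarrow> real \<Rightarrow> real" where
  "hump_force p s = cutoff s * (min p lam * g s + max (p - lam) 0)"

lemma hump_force_nonneg: "0 \<le> p \<Longrightarrow> 0 \<le> s \<Longrightarrow> 0 \<le> hump_force p s"
  using lam_large(2) g_nonneg by (auto simp: hump_force_def cutoff_def intro!: mult_nonneg_nonneg add_nonneg_nonneg)

lemma g_tendsto:
  assumes "u \<longlonglongrightarrow> (l::real)" "\<And>n. 0 \<le> u n" "0 \<le> l"
  shows "(\<lambda>n. g (u n)) \<longlonglongrightarrow> g l"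
  by (rule continuous_on_tendsto_compose[OF g_cont assms(1)]) (use assms in auto)

lemma hump_force_tendsto:
  assumes "u \<longlonglongrightarrow> l" "\<And>n. 0 \<le> u n" "0 \<le> l" "p \<longlonglongrightarrow> p0"
  shows "(\<lambda>n. hump_force (p n) (u n)) \<longlonglongrightarrow> hump_force p0 l"
  unfolding hump_force_def cutoff_def by (intro tendsto_intros g_tendsto assms)

text \<open>The complementarity conditions are the variational inequality for the unknowns \<open>p h\<close>, with
  \<open>hmax u h - d h\<close>, and \<open>d h\<close>, with \<open>\<plusminus>(p h - lam)\<close>. The sign is the one for which each bound of \<open>d h\<close>
  contradicts the estimates at the levels \<open>r\<close>, \<open>\<rho>\<close>, \<open>R\<close>. For the symbol \<open>0\<close> the height is not
  prescribed: \<open>d h = r\<close> is only an upper bound, and \<open>p h \<le> lam\<close>.\<close>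

lemma periodic_system:
  fixes S :: "nat \<Rightarrow> nat" and k :: nat and \<mu> :: real
  assumes k: "k \<ge> 1" and \<mu>: "0 < \<mu>"
  defines "N \<equiv> k * m" and "P \<equiv> (\<lambda>h. if S h = 0 then lam else lam + (2 * (R + 1) / \<epsilon>) / \<nu> + 1)"
  obtains u y p d where
    "\<And>h. h < N \<Longrightarrow> 0 \<le> p h \<and> p h \<le> P h"
    "\<And>h. h < N \<Longrightarrow> (if S h = 2 then \<rho> else r) \<le> d h \<and> d h \<le> (if S h = 0 then r else if S h = 1 then \<rho> else R)"
    "\<And>t. t \<in> {0..real k * T} \<Longrightarrow> 0 \<le> u t \<and> u t \<le> R + 1" "u (real k * T) = u 0" "y (real k * T) = y 0"
    "\<And>s t. 0 \<le> s \<Longrightarrow> s \<le> t \<Longrightarrow> t \<le> real k * T \<Longrightarrow> (y has_integral u t - u s) {s..t}"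
    "\<And>s t. 0 \<le> s \<Longrightarrow> s \<le> t \<Longrightarrow> t \<le> real k * T \<Longrightarrow>
       ((\<lambda>t. \<mu> * (B t * g (u t)) - A t * (\<Sum>h<N. if t \<in> {lft (int h)..mid (int h)} then hump_force (p h) (u t) else 0))
          has_integral y t - y s) {s..t}"
    "\<And>h. h < N \<Longrightarrow> hmax u (int h) \<le> d h \<or> p h = 0" "\<And>h. h < N \<Longrightarrow> d h \<le> hmax u (int h) \<or> p h = P h"
    "\<And>h. h < N \<Longrightarrow> S h = 1 \<Longrightarrow> (lam \<le> p h \<or> d h = r) \<and> (p h \<le> lam \<or> d h = \<rho>)"
    "\<And>h. h < N \<Longrightarrow> S h = 2 \<Longrightarrow> (p h \<le> lam \<or> d h = \<rho>) \<and> (lam \<le> p h \<or> d h = R)"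
proof -
  define L where "L = real k * T"
  have L: "0 < L" using k T by (simp add: L_def)
  have LN: "lft (int N) = L" using shift_m(1)[of 0 "int k"] lft_zero by (simp add: N_def L_def)
  have hump_in: "{lft (int h)..mid (int h)} \<subseteq> {0..L}" if "h < N" for h
    using lft_mono[of 0 "int h"] lft_mid_less[of "int h" "int N"] LN lft_zero that by auto
  \<comment> \<open>The common bound for the caps \<open>P h\<close>. For symbol 0 the cap is
    \<open>lam\<close> itself, so a hump that stays strictly below its height bound obeys the true
    equation at once.\<close>
  define Pmax where "Pmax = lam + (2 * (R + 1) / \<epsilon>) / \<nu> + 1"
  have pos: "0 < 2 * (R + 1) / \<epsilon> / \<nu>" using radii eps_hump(1) nu_bounds(1) by simp
  have P: "0 \<le> P h" "P h \<le> Pmax" for h using pos lam_large(2) by (auto simp: P_def Pmax_def)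
  obtain G where G: "0 \<le> G" "\<And>s. 0 \<le> s \<Longrightarrow> s \<le> R + 1 \<Longrightarrow> g s \<le> G" using g_bounded by metis
  \<comment> \<open>Each hump gets its own truncated copy of \<open>A\<close>, to be multiplied by
    its own coefficient; the last index \<open>N\<close> carries \<open>B\<close>.\<close>
  define w where "w h t = (if h < N then (if t \<in> {lft (int h)..mid (int h)} then A t else 0) else B t)" for h t
  define f where "f h s c = (if h < N then hump_force (c h) s else - \<mu> * g s)" for h s and c :: "nat \<Rightarrow> real"
  \<comment> \<open>In the vector \<open>c\<close> the coefficients occupy the indices below
    \<open>N\<close>, and the heights follow from \<open>N\<close> on. The value 0 for symbol 0 is
    harmless, since that height ranges over a single point.\<close>
  define \<Phi> where "\<Phi> i u c = (if i < N then hmax u (int i) - c (N + i)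
      else if S (i - N) = 1 then lam - c (i - N) else if S (i - N) = 2 then c (i - N) - lam else 0)"
    for i u and c :: "nat \<Rightarrow> real"
  define lo where "lo i = (if i < N then 0 else if S (i - N) = 2 then \<rho> else r)" for i
  define hi where "hi i = (if i < N then P i else if S (i - N) = 0 then r else if S (i - N) = 1 then \<rho> else R)" for i
  define C where "C = lam * G + (Pmax + \<mu> * G)"
  define bx where "bx c \<longleftrightarrow> (\<forall>i<2 * N. lo i \<le> c i \<and> c i \<le> hi i)" for c
  have bxp: "0 \<le> c h" "c h \<le> Pmax" if "bx c" "h < N" for c h
  proof -
    have "lo h \<le> c h \<and> c h \<le> hi h" using that unfolding bx_def by auto
    then show "0 \<le> c h" "c h \<le> Pmax" using P(2)[of h] that(2) by (auto simp: lo_def hi_def)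
  qed
  interpret PP: periodic_problem L "R + 1" C "Suc N" "2 * N" w f \<Phi> lo hi bx
  proof
    show "bx c \<longleftrightarrow> (\<forall>i<2 * N. lo i \<le> c i \<and> c i \<le> hi i)" for c unfolding bx_def ..
    show "0 < L" by (rule L)
    show "0 < R + 1" using radii by simp
    show "w h absolutely_integrable_on {0..L}" for h
    proof (cases "h < N")
      case True
      have "A absolutely_integrable_on {lft (int h)..mid (int h)}" by (rule weight_absolutely_integrable(1)[OF a_int])
      then have "(\<lambda>t. if t \<in> {lft (int h)..mid (int h)} then A t else 0) absolutely_integrable_on UNIV"
        unfolding absolutely_integrable_restrict_UNIV .
      then have "(\<lambda>t. if t \<in> {lft (int h)..mid (int h)} then A t else 0) absolutely_integrable_on {0..L}"
        by (rule set_integrable_subset) auto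
      then show ?thesis unfolding w_def using True by (simp only: if_True)
    next
      case False
      then have "w h = B" by (simp add: w_def fun_eq_iff)
      then show ?thesis using weight_absolutely_integrable(2)[OF a_int] by simp
    qed
    show "0 \<le> w h t" for h t using AB_nonneg by (simp add: w_def)
    show "lo i \<le> hi i" for i using radii P by (simp add: lo_def hi_def)
    show "\<bar>f h s c\<bar> \<le> C" if "h < Suc N" "0 \<le> s" "s \<le> R + 1" "bx c" for h s c
    proof (cases "h < N")
      case True
      note c = bxp[OF that(4) True]
      have "0 \<le> cutoff s" "cutoff s \<le> 1" by (auto simp: cutoff_def)
      moreover have in0: "0 \<le> min (c h) lam * g s + max (c h - lam) 0"
        using c lam_large(2) g_nonneg[OF that(2)] by (intro add_nonneg_nonneg mult_nonneg_nonneg) auto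
      ultimately have "hump_force (c h) s \<le> min (c h) lam * g s + max (c h - lam) 0"
        unfolding hump_force_def by (intro mult_left_le_one_le)
      moreover have "min (c h) lam * g s \<le> lam * G"
        using c lam_large(2) g_nonneg[OF that(2)] G(2)[OF that(2,3)] by (intro mult_mono) auto
      moreover have "max (c h - lam) 0 \<le> Pmax" using c lam_large(2) by auto
      moreover have "0 \<le> \<mu> * G" using \<mu> G by simp
      moreover have "\<bar>f h s c\<bar> = hump_force (c h) s"
        using True hump_force_nonneg[OF c(1) that(2)] by (simp add: f_def)
      ultimately show ?thesis unfolding C_def by linarith
    next
      case False
      have "\<mu> * g s \<le> \<mu> * G" using \<mu> G(2)[OF that(2,3)] by simp
      moreover have "0 \<le> lam * G" "0 \<le> Pmax" using lam_large(2) G P[of 0] by auto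
      moreover have "0 \<le> \<mu> * g s" using \<mu> g_nonneg[OF that(2)] by simp
      ultimately show ?thesis using False by (simp add: f_def C_def abs_mult)
    qed
    show "0 \<le> f h 0 c" if "h < Suc N" "bx c" for h c
      using hump_force_nonneg[of "c h" 0] bxp[OF that(2)] g_zero by (simp add: f_def)
    show "f h (R + 1) c \<le> 0" if "h < Suc N" "bx c" for h c
      using \<mu> g_nonneg[of "R + 1"] radii by (simp add: f_def hump_force_def cutoff_def)
    show "(\<lambda>n. f h (s n) (c n)) \<longlonglongrightarrow> f h s0 c0"
      if "h < Suc N" "\<And>n. 0 \<le> s n \<and> s n \<le> R + 1" "0 \<le> s0 \<and> s0 \<le> R + 1" "s \<longlonglongrightarrow> s0"
        "\<And>i. i < 2 * N \<Longrightarrow> (\<lambda>n. c n i) \<longlonglongrightarrow> c0 i" for h s s0 c c0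
    proof (cases "h < N")
      case True
      then show ?thesis unfolding f_def using that by (simp add: hump_force_tendsto)
    next
      case False
      then show ?thesis unfolding f_def using that by (auto intro!: tendsto_mult_left tendsto_minus g_tendsto)
    qed
    show "(\<lambda>n. \<Phi> i (u n) (c n)) \<longlonglongrightarrow> \<Phi> i u0 c0"
      if i: "i < 2 * N" and ur: "\<And>n t. 0 \<le> u n t \<and> u n t \<le> R + 1"
        and u0r: "\<And>t. t \<in> {0..L} \<Longrightarrow> 0 \<le> u0 t \<and> u0 t \<le> R + 1"
        and ul: "uniform_limit {0..L} u u0 sequentially"
        and cl: "\<And>i. i < 2 * N \<Longrightarrow> (\<lambda>n. c n i) \<longlonglongrightarrow> c0 i" for i u u0 c c0
    proof (cases "i < N")
      case True
      have "(\<lambda>n. hmax (u n) (int i)) \<longlonglongrightarrow> hmax u0 (int i)"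
      proof (rule tendstoI)
        fix e :: real assume e: "e > 0"
        have "\<forall>\<^sub>F n in sequentially. \<forall>t\<in>{0..L}. dist (u n t) (u0 t) < e / 2"
          using uniform_limitD[OF ul, of "e / 2"] e by simp
        then show "\<forall>\<^sub>F n in sequentially. dist (hmax (u n) (int i)) (hmax u0 (int i)) < e"
        proof eventually_elim
          case (elim n)
          have "\<bar>hmax (u n) (int i) - hmax u0 (int i)\<bar> \<le> e / 2"
            unfolding hmax_def
          proof (rule SUP_close)
            show "{lft (int i)..mid (int i)} \<noteq> {}" using order(1)[of "int i"] by auto
            fix t assume "t \<in> {lft (int i)..mid (int i)}"
            then have t: "t \<in> {0..L}" using hump_in[OF True] by auto
            show "u n t \<le> R + 1 \<and> u0 t \<le> R + 1" using ur u0r[OF t] by blast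
            show "\<bar>u n t - u0 t\<bar> \<le> e / 2" using elim t by (auto simp: dist_real_def intro: less_imp_le)
          qed
          then show ?case using e by (simp add: dist_real_def)
        qed
      qed
      then show ?thesis using True cl[of "N + i"] unfolding \<Phi>_def by (auto intro!: tendsto_diff)
    next
      case False
      then show ?thesis using cl[of "i - N"] i unfolding \<Phi>_def by (auto intro!: tendsto_diff)
    qed
  qed
  obtain u y c where c: "bx c" and u: "\<And>t. t \<in> {0..L} \<Longrightarrow> 0 \<le> u t \<and> u t \<le> R + 1"
    and per: "u L = u 0" "y L = y 0"
    and du: "\<And>s t. 0 \<le> s \<Longrightarrow> s \<le> t \<Longrightarrow> t \<le> L \<Longrightarrow> (y has_integral u t - u s) {s..t}"
    and dy: "\<And>s t. 0 \<le> s \<Longrightarrow> s \<le> t \<Longrightarrow> t \<le> L \<Longrightarrow> ((\<lambda>t. - PP.force u c t) has_integral y t - y s) {s..t}"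
    and V: "\<And>i. i < 2 * N \<Longrightarrow> \<Phi> i u c \<le> 0 \<or> c i = lo i" "\<And>i. i < 2 * N \<Longrightarrow> 0 \<le> \<Phi> i u c \<or> c i = hi i"
    by (rule PP.solution_exists) blast
  have force: "- PP.force u c t = \<mu> * (B t * g (u t)) -
      A t * (\<Sum>h<N. if t \<in> {lft (int h)..mid (int h)} then hump_force (c h) (u t) else 0)" for t
  proof -
    have "(\<Sum>h<N. w h t * f h (u t) c) = (\<Sum>h<N. A t * (if t \<in> {lft (int h)..mid (int h)} then hump_force (c h) (u t) else 0))"
      by (rule sum.cong) (auto simp: w_def f_def)
    then show ?thesis unfolding PP.force_def by (simp add: w_def f_def sum_distrib_left)
  qed
  have Nh: "N + h - N = h" "\<not> N + h < N" for h by simp_all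
  show ?thesis
  proof (rule that[of c "\<lambda>h. c (N + h)" u y])
    show "0 \<le> c h \<and> c h \<le> P h" if "h < N" for h
    proof -
      have "lo h \<le> c h \<and> c h \<le> hi h" using c that unfolding bx_def by auto
      then show ?thesis using that by (simp add: lo_def hi_def)
    qed
    show "(if S h = 2 then \<rho> else r) \<le> c (N + h) \<and> c (N + h) \<le> (if S h = 0 then r else if S h = 1 then \<rho> else R)"
      if "h < N" for h
    proof -
      have "lo (N + h) \<le> c (N + h) \<and> c (N + h) \<le> hi (N + h)" using c that unfolding bx_def by auto
      then show ?thesis unfolding lo_def hi_def Nh by (simp only: Nh if_False)
    qed
    show "((\<lambda>t. \<mu> * (B t * g (u t)) - A t * (\<Sum>h<N. if t \<in> {lft (int h)..mid (int h)} then hump_force (c h) (u t) else 0))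
          has_integral y t - y s) {s..t}" if "0 \<le> s" "s \<le> t" "t \<le> real k * T" for s t
      using dy[of s t] that unfolding force L_def by blast
    show "hmax u (int h) \<le> c (N + h) \<or> c h = 0" "c (N + h) \<le> hmax u (int h) \<or> c h = P h" if "h < N" for h
      using V[of h] that by (auto simp: \<Phi>_def lo_def hi_def)
    show "(lam \<le> c h \<or> c (N + h) = r) \<and> (c h \<le> lam \<or> c (N + h) = \<rho>)" if "h < N" "S h = 1" for h
      using V[of "N + h"] that unfolding \<Phi>_def lo_def hi_def Nh by auto
    show "(c h \<le> lam \<or> c (N + h) = \<rho>) \<and> (lam \<le> c h \<or> c (N + h) = R)" if "h < N" "S h = 2" for h
      using V[of "N + h"] that unfolding \<Phi>_def lo_def hi_def Nh by auto
  qed (use u per du in \<open>auto simp: L_def\<close>)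
qed


definition orbit :: "real \<Rightarrow> (real \<Rightarrow> real) \<Rightarrow> (real \<Rightarrow> real) \<Rightarrow> bool" where
  "orbit \<mu> x y \<longleftrightarrow> integral_solution (\<lambda>t. - (weight a lam \<mu> t * g (x t))) x y \<and> (\<forall>t. 0 \<le> x t \<and> x t \<le> R)"

lemma hmax_shift:
  assumes "\<And>t. x (t + of_int l * T) = x t"
  shows "hmax x (j + l * int m) = hmax x j"
proof -
  have "x ` {lft j + of_int l * T..mid j + of_int l * T} = x ` {lft j..mid j}"
  proof
    show "x ` {lft j + of_int l * T..mid j + of_int l * T} \<subseteq> x ` {lft j..mid j}"
    proof clarify
      fix t assume "t \<in> {lft j + of_int l * T..mid j + of_int l * T}"
      then show "x t \<in> x ` {lft j..mid j}"
        using assms[of "t - of_int l * T"] by (intro image_eqI[of _ _ "t - of_int l * T"]) auto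
    qed
    show "x ` {lft j..mid j} \<subseteq> x ` {lft j + of_int l * T..mid j + of_int l * T}"
    proof clarify
      fix t assume "t \<in> {lft j..mid j}"
      then show "x t \<in> x ` {lft j + of_int l * T..mid j + of_int l * T}"
        using assms[of t] by (intro image_eqI[of _ _ "t + of_int l * T"]) auto
    qed
  qed
  then show ?thesis unfolding hmax_def shift_m by simp
qed

text \<open>Once every coefficient is shown to equal \<open>lam\<close> and every hump to stay below
  \<open>R\<close>, the coupled system is the original equation. The work lies in excluding all
  other outcomes of the complementarity conditions.\<close>

lemma periodic_orbit:
  fixes S :: "int \<Rightarrow> nat" and k :: nat
  assumes rig: "rigid \<mu>" and k: "k \<ge> 1" and S: "\<And>j. S j \<in> {0, 1, 2}"
    and Sper: "\<And>j. S (j + int k * int m) = S j"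
  shows "\<exists>x y. orbit \<mu> x y \<and> (\<forall>t. x (t + real k * T) = x t) \<and> (\<forall>j. in_band (S j) (hmax x j))"
proof -
  define N where "N = k * m"
  define L where "L = real k * T"
  have L: "0 < L" using k T by (simp add: L_def)
  have \<mu>: "0 < \<mu>" using rig by (simp add: rigid_def)
  have LN: "lft (int N) = L" using shift_m(1)[of 0 "int k"] lft_zero by (simp add: N_def L_def)
  have N0: "0 < N" using k m by (simp add: N_def)
  define P where "P = (\<lambda>h. if S (int h) = 0 then lam else lam + (2 * (R + 1) / \<epsilon>) / \<nu> + 1)"
  obtain u y p d where
    p: "\<And>h. h < N \<Longrightarrow> 0 \<le> p h \<and> p h \<le> P h"
    and d: "\<And>h. h < N \<Longrightarrow> (if S (int h) = 2 then \<rho> else r) \<le> d h \<and>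
        d h \<le> (if S (int h) = 0 then r else if S (int h) = 1 then \<rho> else R)"
    and u: "\<And>t. t \<in> {0..L} \<Longrightarrow> 0 \<le> u t \<and> u t \<le> R + 1" and uL: "u L = u 0" "y L = y 0"
    and du: "\<And>s t. 0 \<le> s \<Longrightarrow> s \<le> t \<Longrightarrow> t \<le> L \<Longrightarrow> (y has_integral u t - u s) {s..t}"
    and dy: "\<And>s t. 0 \<le> s \<Longrightarrow> s \<le> t \<Longrightarrow> t \<le> L \<Longrightarrow>
       ((\<lambda>t. \<mu> * (B t * g (u t)) - A t * (\<Sum>h<N. if t \<in> {lft (int h)..mid (int h)} then hump_force (p h) (u t) else 0))
          has_integral y t - y s) {s..t}"
    and V1: "\<And>h. h < N \<Longrightarrow> hmax u (int h) \<le> d h \<or> p h = 0" "\<And>h. h < N \<Longrightarrow> d h \<le> hmax u (int h) \<or> p h = P h"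
    and V2: "\<And>h. h < N \<Longrightarrow> S (int h) = 1 \<Longrightarrow> (lam \<le> p h \<or> d h = r) \<and> (p h \<le> lam \<or> d h = \<rho>)"
    and V3: "\<And>h. h < N \<Longrightarrow> S (int h) = 2 \<Longrightarrow> (p h \<le> lam \<or> d h = \<rho>) \<and> (lam \<le> p h \<or> d h = R)"
    unfolding N_def L_def P_def by (rule periodic_system[OF k \<mu>, of "\<lambda>h. S (int h)"]) blast
  \<comment> \<open>Reduction to one period. The values land in \<open>[0, L)\<close>, so
    \<open>L\<close> goes to 0, which is consistent as \<open>u\<close> and \<open>y\<close> agree
    at both ends.\<close>
  define fr where "fr t = t - of_int \<lfloor>t / L\<rfloor> * L" for t
  have fr_range: "fr t \<in> {0..L}" for t
    using floor_divide_lower[OF L, of t] floor_divide_upper[OF L, of t] by (simp add: fr_def algebra_simps)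
  have fr_eq: "fr t = t - of_int l * L" if "0 \<le> t - of_int l * L" "t - of_int l * L < L" for t l
  proof -
    have "\<lfloor>t / L\<rfloor> = l" using that L by (intro floor_unique) (auto simp: field_simps)
    then show ?thesis by (simp add: fr_def)
  qed
  have fr_per: "fr (t + L) = fr t" for t
  proof -
    have "(t + L) / L = t / L + 1" using L by (simp add: add_divide_distrib)
    then show ?thesis by (simp add: fr_def algebra_simps)
  qed
  have fr_id: "fr t = t" if "0 \<le> t" "t < L" for t using fr_eq[of t 0] that by simp
  have fr_L: "fr L = 0" using fr_eq[of L 1] L by simp
  define x where "x t = u (fr t)" for t
  define v where "v t = y (fr t)" for t
  define \<phi> where "\<phi> t = (\<Sum>h<N. if fr t \<in> {lft (int h)..mid (int h)} then hump_force (p h) (x t) else 0)" for t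
  have xu: "x t = u t" "v t = y t" if "0 \<le> t" "t \<le> L" for t
    using fr_id[of t] fr_L uL that by (cases "t = L"; simp add: x_def v_def)+
  have xper: "x (t + L) = x t" "v (t + L) = v t" "\<phi> (t + L) = \<phi> t" for t
    by (simp_all only: x_def v_def \<phi>_def fr_per)
  have ABper: "A (t + L) = A t" "B (t + L) = B t" for t
    using AB_shift[of t "int k"] by (simp_all add: L_def)
  have sol: "gen_solution \<mu> \<phi> x v"
    unfolding gen_solution_def integral_solution_def
  proof (intro conjI allI impI)
    fix s t :: real assume st: "s \<le> t"
    show "(v has_integral x t - x s) {s..t}"
    proof (rule periodic_has_integral[where f = v and F = x, OF L xper(2,1) _ st])
      fix s t assume *: "0 \<le> s" "s \<le> t" "t \<le> L"
      have "(v has_integral u t - u s) {s..t}"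
        by (rule has_integral_eq[OF _ du[OF *]]) (use xu(2) * in auto)
      then show "(v has_integral x t - x s) {s..t}" using xu * by auto
    qed
    show "((\<lambda>t. \<mu> * (B t * g (x t)) - A t * \<phi> t) has_integral v t - v s) {s..t}"
    proof (rule periodic_has_integral[where f = "\<lambda>t. \<mu> * (B t * g (x t)) - A t * \<phi> t" and F = v, OF L _ xper(2) _ st])
      show "\<mu> * (B (t + L) * g (x (t + L))) - A (t + L) * \<phi> (t + L) = \<mu> * (B t * g (x t)) - A t * \<phi> t" for t
        by (simp only: xper ABper)
      fix s t assume *: "0 \<le> s" "s \<le> t" "t \<le> L"
      have "((\<lambda>t. \<mu> * (B t * g (x t)) - A t * \<phi> t) has_integral y t - y s) {s..t}"
      \<comment> \<open>Since \<open>fr L = 0\<close>, the formula for \<open>\<phi>\<close> need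
        not match at the single point \<open>L\<close>.\<close>
      proof (rule has_integral_spike[OF negligible_sing[of L] _ dy[OF *]])
        fix q assume q: "q \<in> {s..t} - {L}"
        then have "fr q = q" "x q = u q" using fr_id[of q] xu(1)[of q] * by auto
        then show "\<mu> * (B q * g (x q)) - A q * \<phi> q = \<mu> * (B q * g (u q)) -
            A q * (\<Sum>h<N. if q \<in> {lft (int h)..mid (int h)} then hump_force (p h) (u q) else 0)"
          by (simp only: \<phi>_def)
      qed
      then show "((\<lambda>t. \<mu> * (B t * g (x t)) - A t * \<phi> t) has_integral v t - v s) {s..t}" using xu * by auto
    qed
  next
    show "0 \<le> x t" "x t \<le> R + 1" for t using u[OF fr_range[of t]] by (simp_all add: x_def)
    show "0 \<le> \<phi> t" for t
      unfolding \<phi>_def using p u[OF fr_range[of t]] by (intro sum_nonneg) (auto intro!: hump_force_nonneg simp: x_def)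
  qed
  note D = gen_solutionD[OF sol]
  have shiftN: "x (t + of_int l * (real k * T)) = x t" for t l
  proof (induction l rule: int_induct[of _ 0])
    case (step1 i)
    then show ?case using xper(1)[of "t + of_int i * (real k * T)"] by (simp add: algebra_simps L_def)
  next
    case (step2 i)
    then show ?case using xper(1)[of "t + of_int (i - 1) * (real k * T)"] by (simp add: algebra_simps L_def)
  qed simp
  define ix where "ix j = nat (j mod int N)" for j
  have ix: "ix j < N" "j = int (ix j) + (j div int N * int k) * int m" for j
  proof -
    have *: "0 \<le> j mod int N" "j mod int N < int N" using N0 by auto
    then show "ix j < N" unfolding ix_def by linarith
    have "int (ix j) = j mod int N" using * by (simp add: ix_def)
    moreover have "j mod int N + j div int N * int N = j" by simp
    moreover have "int N = int k * int m" by (simp add: N_def)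
    ultimately show "j = int (ix j) + (j div int N * int k) * int m" by (simp only: mult.assoc)
  qed
  have hx: "hmax x j = hmax x (int (ix j))" for j
    using hmax_shift[of x "j div int N * int k" "int (ix j)"] shiftN[of _ "j div int N"] ix(2)[of j]
    by (simp add: mult.assoc)
  have SN: "S j = S (int (ix j))" for j
  proof -
    have "S (i + q * (int k * int m)) = S i" for i q
    proof (induction q rule: int_induct[of _ 0])
      case (step1 q)
      then show ?case using Sper[of "i + q * (int k * int m)"] by (simp add: algebra_simps)
    next
      case (step2 q)
      then show ?case using Sper[of "i + (q - 1) * (int k * int m)"] by (simp add: algebra_simps)
    qed simp
    from this[of "int (ix j)" "j div int N"] show ?thesis using ix(2)[of j] by (simp add: mult.assoc)
  qed
  have hump_in: "0 \<le> t \<and> t < L" if "h < N" "t \<in> {lft (int h)..mid (int h)}" for h t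
    using lft_mono[of 0 "int h"] lft_mid_less[of "int h" "int N"] LN lft_zero that by auto
  have hu: "hmax x (int h) = hmax u (int h)" if h: "h < N" for h
  proof -
    have "x t = u t" if "t \<in> {lft (int h)..mid (int h)}" for t
      using hump_in[OF h that] by (intro xu(1)) auto
    then show ?thesis unfolding hmax_def by (intro SUP_cong) auto
  qed
  have \<phi>_hump: "\<phi> t = hump_force (p (ix j)) (x t)" if t: "t \<in> {lft j..mid j}" for t j
  proof -
    define l where "l = j div int N"
    have j: "j = int (ix j) + (l * int k) * int m" using ix(2)[of j] by (simp add: l_def)
    have "lft j = lft (int (ix j)) + of_int l * L" "mid j = mid (int (ix j)) + of_int l * L"
      using shift_m(1,2)[of "int (ix j)" "l * int k"] j by (simp_all add: L_def mult.assoc)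
    then have tl: "t - of_int l * L \<in> {lft (int (ix j))..mid (int (ix j))}" using t by auto
    then have fr: "fr t = t - of_int l * L" using hump_in[OF ix(1) tl] by (intro fr_eq) auto
    \<comment> \<open>Distinct humps are disjoint, so exactly one summand survives.\<close>
    have "(if fr t \<in> {lft (int h)..mid (int h)} then hump_force (p h) (x t) else 0)
        = (if h = ix j then hump_force (p h) (x t) else 0)" for h
    proof (cases "h = ix j")
      case False
      have "fr t \<notin> {lft (int h)..mid (int h)}"
      proof
        assume *: "fr t \<in> {lft (int h)..mid (int h)}"
        consider "h < ix j" | "ix j < h" using False by linarith
        then show False using lft_mid_less[of "int h" "int (ix j)"] lft_mid_less[of "int (ix j)" "int h"] * tl fr by cases auto
      qed
      then show ?thesis unfolding if_not_P[OF False] by (rule if_not_P)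
    qed (use tl fr in auto)
    then show ?thesis unfolding \<phi>_def using ix(1)[of j] by simp
  qed
  have decode: "p h = lam \<and> in_band (S (int h)) (hmax x (int h)) \<and> hmax x (int h) \<le> R" if h: "h < N" for h
  proof -
    define H where "H = hmax x (int h)"
    have ixh: "ix (int h) = h" using h by (simp add: ix_def)
    have \<phi>h: "\<phi> t = hump_force (p h) (x t)" if "t \<in> {lft (int h)..mid (int h)}" for t
      using \<phi>_hump[OF that] ixh by simp
    obtain t0 where t0: "t0 \<in> {lft (int h)..mid (int h)}" "x t0 = H" and
      max: "\<And>t. t \<in> {lft (int h)..mid (int h)} \<Longrightarrow> x t \<le> H"
      using hmax_attained[OF D(2)] unfolding H_def by metis
    have Ppos: "0 < P h" "lam \<le> P h"
      using lam_large(2) radii eps_hump(1) nu_bounds(1) by (auto simp: P_def intro!: add_nonneg_pos add_nonneg_nonneg divide_nonneg_pos)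
    have dr: "r \<le> d h" "d h \<le> R" using d[OF h] radii by (auto split: if_splits)
    have VI: "H \<le> d h \<or> p h = 0" "d h \<le> H \<or> p h = P h" using V1[OF h] hu[OF h] by (auto simp: H_def)
    \<comment> \<open>With \<open>p h = 0\<close>, which is below the cap, complementarity makes the
      hump at least as high as \<open>d h\<close>, hence at least \<open>r\<close>. But then no
      force acts on it, against rigidity with \<open>b = 0\<close>.\<close>
    have p0: "p h \<noteq> 0"
    proof
      assume p0: "p h = 0"
      then have Hr: "r \<le> H" using VI(2) Ppos dr by auto
      have "hump_force 0 (x t) = 0" for t using lam_large(2) by (simp add: hump_force_def)
      then show False
        using rigidD[OF rig sol, of "int h" 0] \<phi>h p0 Hr radii by (auto simp: H_def)
    qed
    then have Hd: "H \<le> d h" using VI by simp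
    then have HR: "H \<le> R" using dr by simp
    have \<phi>1: "\<phi> t = min (p h) lam * g (x t) + max (p h - lam) 0" if "t \<in> {lft (int h)..mid (int h)}" for t
      using \<phi>h[OF that] max[OF that] HR by (simp add: hump_force_def cutoff_def)
    have low: False if "H = r \<or> H = R" "p h \<le> lam"
      by (rule levels_avoided(1)[OF sol rig, of "int h"])
        (use that \<phi>1 g_nonneg D(4) in \<open>auto simp: H_def[symmetric] intro!: mult_right_mono\<close>)
    have high: False if "H = \<rho>" "lam \<le> p h"
      by (rule levels_avoided(2)[OF sol, of "int h"]) (use that \<phi>1 in \<open>auto simp: H_def[symmetric]\<close>)
    show ?thesis
    \<comment> \<open>For symbol 0 the maximum is at most \<open>r\<close>, and \<open>r\<close>
      itself is excluded as the coefficient is at most \<open>lam\<close>. Being strictly lower than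
      \<open>d h\<close>, the hump has its coefficient at the cap, which is
      \<open>lam\<close>.\<close>
    proof (cases "S (int h) = 0")
      case True
      then have "d h = r" using d[OF h] by simp
      moreover have pl: "p h \<le> lam" using p[OF h] True by (simp add: P_def)
      ultimately have "H < r" using low Hd by (cases "H = r") auto
      moreover from this have "p h = lam" using VI(2) \<open>d h = r\<close> True by (simp add: P_def)
      ultimately show ?thesis using True HR by (simp add: in_band_def H_def)
    next
      case False
      \<comment> \<open>A hump lower than its prescribed height would have its coefficient at the
        cap, whose additive force is too strong.\<close>
      have Hd2: "H = d h"
      proof (rule ccontr)
        assume "H \<noteq> d h"
        then have pP: "p h = P h" using VI Hd by auto
        define \<beta> where "\<beta> = (2 * (R + 1) / \<epsilon>) / \<nu> + 1"
        have \<beta>: "0 \<le> \<beta>" "2 * (R + 1) / \<epsilon> < \<beta> * \<nu>"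
          using radii eps_hump(1) nu_bounds(1) by (auto simp: \<beta>_def field_simps)
        have "\<beta> \<le> \<phi> t" if "t \<in> {lft (int h)..mid (int h)}" for t
          using \<phi>1[OF that] pP False lam_large(2) g_nonneg[OF D(4)[of t]] \<beta>(1) by (simp add: P_def \<beta>_def)
        then show False using strong_forcing_impossible[OF sol \<beta>(2,1)] by blast
      qed
      \<comment> \<open>A coefficient below \<open>lam\<close> would put the height at
        \<open>r\<close>, or at \<open>R\<close> for symbol 2; one above \<open>lam\<close> would
        put it at \<open>\<rho>\<close>. These are the cases closed by \<open>low\<close> and
        \<open>high\<close>, which at \<open>p h = lam\<close> also make the band inequalities
        strict.\<close>
      consider "S (int h) = 1" | "S (int h) = 2" using S[of "int h"] False by auto
      then show ?thesis
      proof cases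
        case 1
        have "p h = lam"
          using V2[OF h 1] low high Hd2 by (metis linorder_linear order_antisym)
        moreover have "r \<le> H" "H \<le> \<rho>" using d[OF h] 1 Hd2 by auto
        moreover have "H \<noteq> r" "H \<noteq> \<rho>" using low high \<open>p h = lam\<close> by auto
        ultimately show ?thesis using 1 HR by (simp add: in_band_def H_def)
      next
        case 2
        have "p h = lam"
          using V3[OF h 2] low high Hd2 by (metis linorder_linear order_antisym)
        moreover have "\<rho> \<le> H" "H \<le> R" using d[OF h] 2 Hd2 by auto
        moreover have "H \<noteq> R" "H \<noteq> \<rho>" using low high \<open>p h = lam\<close> by auto
        ultimately show ?thesis using 2 HR by (simp add: in_band_def H_def)
      qed
    qed
  qed
  have on_hump: "x t \<le> R" "\<phi> t = lam * g (x t)" if t: "t \<in> {lft j..mid j}" for j t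
  proof -
    note dec = decode[OF ix(1)[of j]]
    obtain t0 where "\<And>t. t \<in> {lft j..mid j} \<Longrightarrow> x t \<le> hmax x j" using hmax_attained[OF D(2)] by metis
    then show "x t \<le> R" using t dec hx[of j] by force
    then show "\<phi> t = lam * g (x t)" using \<phi>_hump[OF t] dec by (simp add: hump_force_def cutoff_def)
  qed
  have xR: "x t \<le> R" for t
  proof -
    obtain j where j: "t \<in> {lft j..lft (j + 1)}" using cover by blast
    show ?thesis
    proof (cases "t \<le> mid j")
      case True
      then show ?thesis using on_hump(1)[of t j] j by auto
    next
      case False
      have "x t \<le> max (x (mid j)) (x (lft (j + 1)))"
        by (rule convex_between_humps[OF sol]) (use False j \<mu> in auto)
      moreover have "x (mid j) \<le> R" "x (lft (j + 1)) \<le> R"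
        using on_hump(1)[of "mid j" j] on_hump(1)[of "lft (j + 1)" "j + 1"] order(1)[of j] order(1)[of "j + 1"] by auto
      ultimately show ?thesis by simp
    qed
  qed
  have "integral_solution (\<lambda>t. - (weight a lam \<mu> t * g (x t))) x v"
    by (rule true_solution[OF sol on_hump(2)])
  then have "orbit \<mu> x v" unfolding orbit_def using D(4) xR by blast
  moreover have "x (t + real k * T) = x t" for t using xper(1)[of t] by (simp add: L_def)
  moreover have "in_band (S j) (hmax x j)" for j using decode[OF ix(1)[of j]] hx[of j] SN[of j] by simp
  ultimately show ?thesis by blast
qed

end

section \<open>Arbitrary itineraries\<close>

text \<open>Pointwise convergence is enough for passing to the limit in the integrated equations, so
  convergence at rational times only has to be spread by equicontinuity.\<close>

lemma equicontinuous_convergent: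
  fixes f :: "nat \<Rightarrow> real \<Rightarrow> real"
  assumes Q: "\<And>q. q \<in> \<rat> \<Longrightarrow> convergent (\<lambda>n. f n q)"
    and E: "\<And>e. e > 0 \<Longrightarrow> \<exists>d>0. \<forall>s n. \<bar>s - t\<bar> < d \<longrightarrow> \<bar>f n s - f n t\<bar> < e"
  shows "convergent (\<lambda>n. f n t)"
proof -
  have "Cauchy (\<lambda>n. f n t)"
  proof (rule metric_CauchyI)
    fix e :: real assume e: "e > 0"
    obtain d where d: "d > 0" "\<And>s n. \<bar>s - t\<bar> < d \<Longrightarrow> \<bar>f n s - f n t\<bar> < e / 3" using E[of "e / 3"] e by auto
    obtain q where q: "q \<in> \<rat>" "t < q" "q < t + d" using Rats_dense_in_real[of t "t + d"] d(1) by auto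
    have qd: "\<bar>f n q - f n t\<bar> < e / 3" for n using q by (intro d(2)) auto
    have "Cauchy (\<lambda>n. f n q)" using Q[OF q(1)] by (rule convergent_Cauchy)
    then obtain M where M: "\<And>m n. m \<ge> M \<Longrightarrow> n \<ge> M \<Longrightarrow> dist (f m q) (f n q) < e / 3"
      using e metric_CauchyD[of "\<lambda>n. f n q" "e / 3"] by auto
    have "dist (f m t) (f n t) < e" if "m \<ge> M" "n \<ge> M" for m n
      using M[OF that] qd[of m] qd[of n] unfolding dist_real_def by linarith
    then show "\<exists>M. \<forall>m\<ge>M. \<forall>n\<ge>M. dist (f m t) (f n t) < e" by blast
  qed
  then show ?thesis by (simp add: Cauchy_convergent_iff)
qed

context sign_changing_problem
begin

lemma solution_gen:
  assumes "orbit \<mu> x y"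
  shows "gen_solution \<mu> (\<lambda>t. lam * g (x t)) x y"
proof -
  have "(\<lambda>t. - (weight a lam \<mu> t * g (x t))) = (\<lambda>t. \<mu> * (B t * g (x t)) - A t * (lam * g (x t)))"
    by (auto simp: weight_def algebra_simps)
  moreover have "x t \<le> R + 1" "0 \<le> lam * g (x t)" for t
    using assms g_nonneg[of "x t"] lam_large(2) by (auto simp: orbit_def add_increasing2)
  ultimately show ?thesis using assms unfolding gen_solution_def orbit_def by simp
qed

lemma solution_levels:
  assumes "rigid \<mu>" "orbit \<mu> x y"
  shows "hmax x j \<noteq> r" "hmax x j \<noteq> \<rho>" "hmax x j < R"
proof -
  note sol = solution_gen[OF assms(2)]
  have orbit_range: "x t \<le> R" for t using assms(2) by (simp add: orbit_def)
  obtain t0 where t0: "x t0 = hmax x j" using hmax_attained[OF gen_solutionD(2)[OF sol]] by metis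
  have "hmax x j \<noteq> r" "hmax x j \<noteq> R" "hmax x j \<noteq> \<rho>"
    using levels_avoided[OF sol, of j] assms(1) by auto
  then show "hmax x j \<noteq> r" "hmax x j \<noteq> \<rho>" "hmax x j < R" using orbit_range[of t0] t0 by auto
qed

lemma abs_weight_integrable: "(\<lambda>t. \<bar>weight a lam \<mu> t\<bar>) integrable_on {s..t}"
  using absolutely_integrable_norm[OF weight_absolutely_integrable(3)[OF a_int, of s t lam \<mu>]]
  by (simp add: o_def absolutely_integrable_on_def)

lemma weight_shift: "weight a lam \<mu> (t + of_int l * T) = weight a lam \<mu> t"
  by (simp add: weight_def AB_shift)

text \<open>The mean of \<open>y\<close> over a window of length \<open>T\<close> is a difference
  quotient of \<open>x\<close>, at most \<open>R / T\<close> in size, and \<open>y\<close>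
  oscillates within the window by at most an integral of the weight. Such a window lies inside two
  consecutive periods, whence the integral over \<open>{0..2 * T}\<close>.\<close>

lemma orbit_bounds:
  "\<exists>G Y. 0 \<le> G \<and> 0 \<le> Y \<and>
     (\<forall>x y s t. orbit \<mu> x y \<longrightarrow> s \<le> t \<longrightarrow> \<bar>y t - y s\<bar> \<le> G * integral {s..t} (\<lambda>t. \<bar>weight a lam \<mu> t\<bar>)) \<and>
     (\<forall>x y t. orbit \<mu> x y \<longrightarrow> \<bar>y t\<bar> \<le> Y) \<and>
     (\<forall>x t. 0 \<le> x \<longrightarrow> x \<le> R \<longrightarrow> \<bar>- (weight a lam \<mu> t * g x)\<bar> \<le> G * \<bar>weight a lam \<mu> t\<bar>)"
proof -
  obtain G where G: "0 \<le> G" "\<And>s. 0 \<le> s \<Longrightarrow> s \<le> R + 1 \<Longrightarrow> g s \<le> G" using g_bounded by metis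
  have fb: "\<bar>- (weight a lam \<mu> t * g x)\<bar> \<le> G * \<bar>weight a lam \<mu> t\<bar>" if "0 \<le> x" "x \<le> R" for x t
    using G(2)[of x] that g_nonneg[of x] mult_left_mono[of "g x" G "\<bar>weight a lam \<mu> t\<bar>"] by (simp add: abs_mult mult.commute)
  define Y where "Y = R / T + G * integral {0..2 * T} (\<lambda>t. \<bar>weight a lam \<mu> t\<bar>)"
  have diff: "\<bar>y t - y s\<bar> \<le> G * integral {s..t} (\<lambda>t. \<bar>weight a lam \<mu> t\<bar>)"
    if sol: "integral_solution (\<lambda>t. - (weight a lam \<mu> t * g (x t))) x y" and x: "\<And>t. 0 \<le> x t \<and> x t \<le> R" and st: "s \<le> t" for x y s t
  proof -
    note I = integral_solutionD(2)[OF sol st]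
    have "norm (integral {s..t} (\<lambda>t. - (weight a lam \<mu> t * g (x t)))) \<le> integral {s..t} (\<lambda>t. G * \<bar>weight a lam \<mu> t\<bar>)"
    proof (rule integral_norm_bound_integral)
      show "(\<lambda>t. - (weight a lam \<mu> t * g (x t))) integrable_on {s..t}" using I by blast
      show "(\<lambda>t. G * \<bar>weight a lam \<mu> t\<bar>) integrable_on {s..t}" by (intro integrable_on_mult_right abs_weight_integrable)
      show "norm (- (weight a lam \<mu> t * g (x t))) \<le> G * \<bar>weight a lam \<mu> t\<bar>" for t
        unfolding real_norm_def using x[of t] by (intro fb) auto
    qed
    then show ?thesis using integral_unique[OF I] by simp
  qed
  have win: "integral {t..s} (\<lambda>t. \<bar>weight a lam \<mu> t\<bar>) \<le> integral {0..2 * T} (\<lambda>t. \<bar>weight a lam \<mu> t\<bar>)"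
    if "t \<le> s" "s \<le> t + T" for s t
  proof -
    define l where "l = \<lfloor>t / T\<rfloor>"
    have l: "of_int l * T \<le> t" "t \<le> of_int (l + 1) * T"
      using floor_divide_lower[OF T, of t] floor_divide_upper[OF T, of t] by (auto simp: l_def algebra_simps)
    have "integral {t..s} (\<lambda>t. \<bar>weight a lam \<mu> t\<bar>) \<le> integral {0 + of_int l * T..2 * T + of_int l * T} (\<lambda>t. \<bar>weight a lam \<mu> t\<bar>)"
      using l that by (intro integral_subset_le abs_weight_integrable) (auto simp: algebra_simps)
    then show ?thesis unfolding integral_shift_period weight_shift .
  qed
  have bound: "\<bar>y t\<bar> \<le> Y"
    if sol: "integral_solution (\<lambda>t. - (weight a lam \<mu> t * g (x t))) x y" and x: "\<And>t. 0 \<le> x t \<and> x t \<le> R" for x y t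
  proof -
    define W where "W = G * integral {0..2 * T} (\<lambda>t. \<bar>weight a lam \<mu> t\<bar>)"
    have near: "\<bar>y s - y t\<bar> \<le> W" if "s \<in> {t..t + T}" for s
      using diff[OF sol x, of t s] win[of t s] that mult_left_mono[OF win[of t s] G(1)] by (force simp: W_def)
    note I = integral_solutionD(1)[OF sol, of t "t + T"]
    have "x (t + T) - x t \<le> T *\<^sub>R (y t + W)" "T *\<^sub>R (y t - W) \<le> x (t + T) - x t"
      using has_integral_le[OF I has_integral_const_real[of "y t + W" t "t + T"]]
        has_integral_le[OF has_integral_const_real[of "y t - W" t "t + T"] I] T near by (force simp: abs_le_iff)+
    then have "- R \<le> T * (y t + W)" "T * (y t - W) \<le> R" using x[of t] x[of "t + T"] by auto
    then have "- (R / T) \<le> y t + W" "y t - W \<le> R / T" using T by (auto simp: field_simps)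
    then show ?thesis by (simp add: Y_def W_def abs_le_iff)
  qed
  have "0 \<le> Y" unfolding Y_def using radii T G(1) abs_weight_integrable
    by (intro add_nonneg_nonneg mult_nonneg_nonneg integral_nonneg divide_nonneg_pos) auto
  moreover have "\<forall>x y s t. orbit \<mu> x y \<longrightarrow> s \<le> t \<longrightarrow> \<bar>y t - y s\<bar> \<le> G * integral {s..t} (\<lambda>t. \<bar>weight a lam \<mu> t\<bar>)"
    using diff unfolding orbit_def by blast
  moreover have "\<forall>x y t. orbit \<mu> x y \<longrightarrow> \<bar>y t\<bar> \<le> Y" using bound unfolding orbit_def by blast
  moreover have "\<forall>x t. 0 \<le> x \<longrightarrow> x \<le> R \<longrightarrow> \<bar>- (weight a lam \<mu> t * g x)\<bar> \<le> G * \<bar>weight a lam \<mu> t\<bar>"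
    using fb by blast
  ultimately show ?thesis using G(1) by (intro exI[of _ G] exI[of _ Y] conjI)
qed

text \<open>In the limit the strict band inequalities survive only as weak ones. They become strict
  again because the limit is itself a solution and so avoids the levels.\<close>

lemma orbit_limit:
  assumes rig: "rigid \<mu>" and orb: "\<And>n. orbit \<mu> (x n) (y n)"
    and band: "\<And>j. \<forall>\<^sub>F n in sequentially. in_band (S j) (hmax (x n) j)"
  shows "\<exists>x' y'. orbit \<mu> x' y' \<and> (\<forall>j. in_band (S j) (hmax x' j))"
proof -
  have sol: "integral_solution (\<lambda>t. - (weight a lam \<mu> t * g (x n t))) (x n) (y n)" and xR: "0 \<le> x n t \<and> x n t \<le> R" for n t
    using orb[of n] by (auto simp: orbit_def)
  obtain G Y where G: "0 \<le> G" and Y: "0 \<le> Y"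
    and all: "\<forall>x y s t. orbit \<mu> x y \<longrightarrow> s \<le> t \<longrightarrow> \<bar>y t - y s\<bar> \<le> G * integral {s..t} (\<lambda>t. \<bar>weight a lam \<mu> t\<bar>)"
      "\<forall>x y t. orbit \<mu> x y \<longrightarrow> \<bar>y t\<bar> \<le> Y"
      "\<forall>x t. 0 \<le> x \<longrightarrow> x \<le> R \<longrightarrow> \<bar>- (weight a lam \<mu> t * g x)\<bar> \<le> G * \<bar>weight a lam \<mu> t\<bar>"
    using orbit_bounds[of \<mu>] by (elim exE conjE)
  note diff = all(1)[rule_format, OF orb] and yY = all(2)[rule_format, OF orb] and fb = all(3)[rule_format]
  have lip: "\<bar>x n t - x n s\<bar> \<le> Y * \<bar>t - s\<bar>" for n s t
  proof -
    have *: "\<bar>x n t - x n s\<bar> \<le> Y * (t - s)" if "s \<le> t" for s t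
    proof -
      note I = integral_solutionD(1)[OF sol[of n] that]
      have c: "((\<lambda>r. z) has_integral (t - s) * z) {s..t}" for z
        using has_integral_const_real[of z s t] that by simp
      have "x n t - x n s \<le> (t - s) * Y"
        by (rule has_integral_le[OF I c]) (use yY[of n] in \<open>simp add: abs_le_iff\<close>)
      moreover have "(t - s) * (- Y) \<le> x n t - x n s"
        by (rule has_integral_le[OF c I]) (use yY[of n] in \<open>simp add: abs_le_iff minus_le_iff\<close>)
      ultimately show ?thesis by (simp add: abs_le_iff algebra_simps)
    qed
    show ?thesis using *[of s t] *[of t s] by (cases "s \<le> t") (auto simp: abs_minus_commute)
  qed
  have nb: "norm (x n t, y n t) \<le> R + Y" for n t
    using norm_Pair_le[of "x n t" "y n t"] xR[of n t] yY[of n t] by simp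
  obtain k :: "nat \<Rightarrow> nat" where k: "strict_mono k" and kl: "\<And>q. q \<in> \<rat> \<Longrightarrow> \<exists>l. (\<lambda>n. (x (k n) q, y (k n) q)) \<longlonglongrightarrow> l"
    by (rule function_convergent_subsequence[of \<rat> "\<lambda>n t. (x n t, y n t)" "R + Y"]) (use nb countable_rat in auto)
  have Q: "convergent (\<lambda>n. x (k n) q)" "convergent (\<lambda>n. y (k n) q)" if "q \<in> \<rat>" for q
    using kl[OF that] tendsto_fst tendsto_snd unfolding convergent_def by fastforce+
  have cx: "convergent (\<lambda>n. x (k n) t)" for t
  proof (rule equicontinuous_convergent[OF Q(1)])
    fix e :: real assume e: "e > 0"
    have "\<bar>x (k n) s - x (k n) t\<bar> < e" if "\<bar>s - t\<bar> < e / (Y + 1)" for s n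
    proof -
      have "\<bar>x (k n) s - x (k n) t\<bar> \<le> Y * \<bar>s - t\<bar>" by (rule lip)
      also have "\<dots> \<le> Y * (e / (Y + 1))" using that Y by (intro mult_left_mono) auto
      also have "\<dots> < e" using e Y by (simp add: field_simps)
      finally show ?thesis .
    qed
    then show "\<exists>d>0. \<forall>s n. \<bar>s - t\<bar> < d \<longrightarrow> \<bar>x (k n) s - x (k n) t\<bar> < e"
      using e Y by (intro exI[of _ "e / (Y + 1)"]) auto
  qed
  have cy: "convergent (\<lambda>n. y (k n) t)" for t
  proof (rule equicontinuous_convergent[OF Q(2)])
    fix e :: real assume e: "e > 0"
    define J where "J s = integral {t - 1..s} (\<lambda>t. \<bar>weight a lam \<mu> t\<bar>)" for s
    have "continuous_on {t - 1..t + 1} J"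
      unfolding J_def by (rule indefinite_integral_continuous_1[OF abs_weight_integrable])
    moreover have "e / (G + 1) > 0" using e G by simp
    moreover have "t \<in> {t - 1..t + 1}" by simp
    ultimately obtain d where d: "d > 0" "\<And>s. s \<in> {t - 1..t + 1} \<Longrightarrow> dist s t < d \<Longrightarrow> dist (J s) (J t) < e / (G + 1)"
      unfolding continuous_on_iff by blast
    have J: "integral {p..q} (\<lambda>t. \<bar>weight a lam \<mu> t\<bar>) = J q - J p" if "t - 1 \<le> p" "p \<le> q" for p q
    proof -
      have "J p + integral {p..q} (\<lambda>t. \<bar>weight a lam \<mu> t\<bar>) = J q"
        unfolding J_def by (rule Henstock_Kurzweil_Integration.integral_combine[OF that abs_weight_integrable])
      then show ?thesis by simp
    qed
    have "\<bar>y (k n) s - y (k n) t\<bar> < e" if s: "\<bar>s - t\<bar> < min d 1" for s n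
    proof -
      have "\<bar>y (k n) s - y (k n) t\<bar> \<le> G * \<bar>J s - J t\<bar>"
      proof (cases "s \<le> t")
        case True
        then have "\<bar>y (k n) t - y (k n) s\<bar> \<le> G * (J t - J s)" using diff[OF True, of "k n"] J[of s t] s by auto
        moreover have "G * (J t - J s) \<le> G * \<bar>J s - J t\<bar>" using G by (intro mult_left_mono) auto
        ultimately show ?thesis by (simp add: abs_minus_commute)
      next
        case False
        then have "\<bar>y (k n) s - y (k n) t\<bar> \<le> G * (J s - J t)" using diff[of t s "k n"] J[of t s] by auto
        moreover have "G * (J s - J t) \<le> G * \<bar>J s - J t\<bar>" using G by (intro mult_left_mono) auto
        ultimately show ?thesis by simp
      qed
      also have "\<dots> \<le> G * (e / (G + 1))"
        using d(2)[of s] s G by (intro mult_left_mono) (auto simp: dist_real_def abs_less_iff)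
      also have "\<dots> < e" using e G by (simp add: field_simps)
      finally show ?thesis .
    qed
    then show "\<exists>d>0. \<forall>s n. \<bar>s - t\<bar> < d \<longrightarrow> \<bar>y (k n) s - y (k n) t\<bar> < e"
      using d(1) by (intro exI[of _ "min d 1"]) auto
  qed
  define x' y' where "x' t = lim (\<lambda>n. x (k n) t)" and "y' t = lim (\<lambda>n. y (k n) t)" for t
  have lx: "(\<lambda>n. x (k n) t) \<longlonglongrightarrow> x' t" and ly: "(\<lambda>n. y (k n) t) \<longlonglongrightarrow> y' t" for t
    using cx[of t] cy[of t] unfolding x'_def y'_def by (auto simp: convergent_LIMSEQ_iff)
  have x'R: "0 \<le> x' t \<and> x' t \<le> R" for t
    using LIMSEQ_le_const[OF lx[of t]] LIMSEQ_le_const2[OF lx[of t]] xR by blast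
  have lim_int: "(F has_integral P t - P s) {s..t}"
    if I: "\<And>n. (f n has_integral p n t - p n s) {s..t}" and b: "h integrable_on {s..t}"
      "\<And>n r. \<bar>f n r\<bar> \<le> h r" and l: "\<And>r. (\<lambda>n. f n r) \<longlonglongrightarrow> F r" "\<And>r. (\<lambda>n. p n r) \<longlonglongrightarrow> P r"
    for f p :: "nat \<Rightarrow> real \<Rightarrow> real" and F P h s t
  proof -
    have fi: "f n integrable_on {s..t}" for n using I by blast
    have 2: "norm (f n r) \<le> h r" for n r using b(2) by simp
    note dc = dominated_convergence[OF fi b(1) 2 l(1)]
    have "(\<lambda>n. p n t - p n s) \<longlonglongrightarrow> integral {s..t} F" using dc(2) integral_unique[OF I] by simp
    moreover have "(\<lambda>n. p n t - p n s) \<longlonglongrightarrow> P t - P s" by (intro tendsto_diff l)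
    ultimately have "integral {s..t} F = P t - P s" by (rule LIMSEQ_unique)
    then show ?thesis using integrable_integral[OF dc(1)] by simp
  qed
  have sol': "integral_solution (\<lambda>t. - (weight a lam \<mu> t * g (x' t))) x' y'"
    unfolding integral_solution_def
  proof (intro allI impI conjI)
    fix s t :: real assume st: "s \<le> t"
    show "(y' has_integral x' t - x' s) {s..t}"
      by (rule lim_int[OF integral_solutionD(1)[OF sol[of "k _"] st] _ _ ly lx, of "\<lambda>_. Y"]) (use yY in auto)
    show "((\<lambda>t. - (weight a lam \<mu> t * g (x' t))) has_integral y' t - y' s) {s..t}"
    proof (rule lim_int[OF integral_solutionD(2)[OF sol[of "k _"] st] _ _ _ ly, of "\<lambda>t. G * \<bar>weight a lam \<mu> t\<bar>"])
      show "(\<lambda>t. G * \<bar>weight a lam \<mu> t\<bar>) integrable_on {s..t}" by (intro integrable_on_mult_right abs_weight_integrable)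
      show "\<bar>- (weight a lam \<mu> r * g (x (k n) r))\<bar> \<le> G * \<bar>weight a lam \<mu> r\<bar>" for n r using xR by (intro fb) auto
      show "(\<lambda>n. - (weight a lam \<mu> r * g (x (k n) r))) \<longlonglongrightarrow> - (weight a lam \<mu> r * g (x' r))" for r
        using xR x'R by (intro tendsto_minus tendsto_mult_left g_tendsto lx) auto
    qed
  qed
  have band': "\<forall>\<^sub>F n in sequentially. in_band (S j) (hmax (x (k n)) j)" for j
    using band[of j] k by (rule eventually_subseq[rotated])
  have upper: "hmax x' j \<le> c" if "\<forall>\<^sub>F n in sequentially. hmax (x (k n)) j \<le> c" for j c
    unfolding hmax_def
  proof (rule cSUP_least)
    show "{lft j..mid j} \<noteq> {}" using order(1)[of j] by auto
    fix t assume t: "t \<in> {lft j..mid j}"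
    have "x n t \<le> hmax (x n) j" for n
      unfolding hmax_def using xR by (intro cSUP_upper[OF t] bdd_aboveI2[where M = R]) auto
    then have "\<forall>\<^sub>F n in sequentially. x (k n) t \<le> c" using that by (auto elim!: eventually_mono intro: order_trans)
    then show "x' t \<le> c" using tendsto_upperbound[OF lx[of t]] by simp
  qed
  \<comment> \<open>The maximum points may move with \<open>n\<close>; a subsequence of them
    converges inside the compact hump, and the common Lipschitz constant \<open>Y\<close> transfers
    the bound to the limit point.\<close>
  have lower: "c \<le> hmax x' j" if ev: "\<forall>\<^sub>F n in sequentially. c \<le> hmax (x (k n)) j" for j c
  proof -
    have "\<exists>t. t \<in> {lft j..mid j} \<and> x (k n) t = hmax (x (k n)) j" for n
      using hmax_attained[OF integral_solutionD(3)[OF sol[of "k n"]]] by metis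
    then obtain \<theta> where \<theta>: "\<And>n. \<theta> n \<in> {lft j..mid j}" "\<And>n. x (k n) (\<theta> n) = hmax (x (k n)) j" by metis
    obtain l q where l: "l \<in> {lft j..mid j}" and q: "strict_mono (q :: nat \<Rightarrow> nat)" "(\<theta> \<circ> q) \<longlonglongrightarrow> l"
      using \<theta>(1) compact_imp_seq_compact[OF compact_Icc] unfolding seq_compact_def by metis
    have "\<forall>\<^sub>F n in sequentially. c \<le> hmax (x (k (q n))) j" using eventually_subseq[OF q(1) ev] .
    then have "\<forall>\<^sub>F n in sequentially. c \<le> x (k (q n)) l + Y * \<bar>\<theta> (q n) - l\<bar>"
    proof eventually_elim
      case (elim n)
      then show ?case using lip[of "k (q n)" "\<theta> (q n)" l] \<theta>(2)[of "q n"] by linarith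
    qed
    moreover have "(\<lambda>n. x (k (q n)) l + Y * \<bar>\<theta> (q n) - l\<bar>) \<longlonglongrightarrow> x' l + Y * \<bar>l - l\<bar>"
      using LIMSEQ_subseq_LIMSEQ[OF lx[of l] q(1)] q(2) by (intro tendsto_intros) (auto simp: o_def)
    ultimately have "c \<le> x' l + Y * \<bar>l - l\<bar>" using tendsto_lowerbound by (metis sequentially_bot)
    also have "\<dots> \<le> hmax x' j"
      unfolding hmax_def using x'R by (simp, intro cSUP_upper[OF l] bdd_aboveI2[where M = R]) auto
    finally show ?thesis .
  qed
  have orb': "orbit \<mu> x' y'" using sol' x'R by (simp add: orbit_def)
  have "in_band (S j) (hmax x' j)" for j
  proof -
    note lev = solution_levels[OF rig orb', of j]
    have i: "\<forall>\<^sub>F n in sequentially. in_band (S j) (hmax (x (k n)) j)" by (rule band')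
    consider "S j = 0" | "S j = 1" | "S j \<noteq> 0" "S j \<noteq> 1" by blast
    then show ?thesis
    proof cases
      case 1
      then have "hmax x' j \<le> r" using i by (intro upper) (auto simp: in_band_def elim!: eventually_mono)
      then show ?thesis using 1 lev by (simp add: in_band_def)
    next
      case 2
      then have "hmax x' j \<le> \<rho>" "r \<le> hmax x' j" using i
        by (intro upper lower; auto simp: in_band_def elim!: eventually_mono)+
      then show ?thesis using 2 lev by (simp add: in_band_def)
    next
      case 3
      then have "\<rho> \<le> hmax x' j" using i by (intro lower) (auto simp: in_band_def elim!: eventually_mono)
      then show ?thesis using 3 lev by (simp add: in_band_def)
    qed
  qed
  then show ?thesis using orb' by blast
qed

text \<open>Rigidity involves no period, so the same \<open>\<mu>\<close> gives periodic orbits for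
  all periodic truncations of the itinerary.\<close>

lemma orbit_exists:
  fixes S :: "int \<Rightarrow> nat"
  assumes rig: "rigid \<mu>" and S: "\<And>j. S j \<in> {0, 1, 2}"
  shows "\<exists>x y. orbit \<mu> x y \<and> (\<forall>j. in_band (S j) (hmax x j))"
proof -
  \<comment> \<open>\<open>Sn n\<close> repeats the block of \<open>S\<close> from
    \<open>- n * m\<close> to \<open>(n + 1) * m - 1\<close>, that is, \<open>2 * n + 1\<close>
    periods of the weight, and so agrees with \<open>S\<close> at \<open>j\<close> as soon as
    \<open>n\<close> is at least \<open>|j|\<close>.\<close>
  define Sn where "Sn n j = S ((j + int n * int m) mod (int (2 * n + 1) * int m) - int n * int m)" for n :: nat and j
  have "\<exists>x y. orbit \<mu> x y \<and> (\<forall>j. in_band (Sn n j) (hmax x j))" for n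
  proof -
    have per: "Sn n (j + int (2 * n + 1) * int m) = Sn n j" for j
    proof -
      have "j + int (2 * n + 1) * int m + int n * int m = (j + int n * int m) + int (2 * n + 1) * int m"
        by (simp only: ac_simps)
      then show ?thesis unfolding Sn_def by (simp only: mod_add_self2)
    qed
    have S3: "Sn n j \<in> {0, 1, 2}" for j unfolding Sn_def by (rule S)
    have "1 \<le> 2 * n + 1" by simp
    from periodic_orbit[where S = "Sn n", OF rig this S3 per] show ?thesis by blast
  qed
  then obtain x y where xy: "\<And>n. orbit \<mu> (x n) (y n)" "\<And>n j. in_band (Sn n j) (hmax (x n) j)" by metis
  have "\<forall>\<^sub>F n in sequentially. in_band (S j) (hmax (x n) j)" for j
  proof (rule eventually_sequentiallyI[of "nat \<bar>j\<bar>"])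
    fix n assume n: "nat \<bar>j\<bar> \<le> n"
    have "\<bar>j\<bar> \<le> int n * 1" using n by simp
    also have "\<dots> \<le> int n * int m" using m by (intro mult_left_mono) auto
    finally have j: "\<bar>j\<bar> \<le> int n * int m" .
    have "int (2 * n + 1) * int m = 2 * (int n * int m) + int m" by (simp add: algebra_simps)
    moreover have "0 < int m" using m by simp
    ultimately have "0 \<le> j + int n * int m" "j + int n * int m < int (2 * n + 1) * int m" using j by linarith+
    then have "(j + int n * int m) mod (int (2 * n + 1) * int m) = j + int n * int m"
      by (rule mod_pos_pos_trivial)
    then have "Sn n j = S j" by (simp add: Sn_def)
    then show "in_band (S j) (hmax (x n) j)" using xy(2)[of n j] by simp
  qed
  then show ?thesis by (rule orbit_limit[OF rig xy(1)])
qed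

end

section \<open>The coding map\<close>

lemma X_dist_controls_sup:
  assumes "0 < \<delta>"
  obtains e where "0 < e" "\<And>z z' t. z \<in> X_space \<Longrightarrow> z' \<in> X_space \<Longrightarrow> X_dist z z' < e \<Longrightarrow> \<bar>t\<bar> \<le> real N \<Longrightarrow>
    \<bar>fst (z t) - fst (z' t)\<bar> < \<delta>"
proof -
  \<comment> \<open>A single summand of the metric suffices: the summand with index \<open>N\<close>
    has weight \<open>(1/2) ^ Suc N\<close> and measures the distance on
    \<open>|t| \<le> Suc N\<close>.\<close>
  define e where "e = (1/2) ^ Suc N * (\<delta> / (1 + \<delta>))"
  have "\<bar>fst (z t) - fst (z' t)\<bar> < \<delta>"
    if z: "z \<in> X_space" "z' \<in> X_space" and d: "X_dist z z' < e" and t: "\<bar>t\<bar> \<le> real N" for z z' t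
  proof -
    define v where "v = vartheta (Suc N) z z'"
    have v0: "0 \<le> v" using vartheta_nonneg[OF z] by (simp add: v_def)
    have "(\<Sum>n\<in>{N}. (1/2) ^ Suc n * (vartheta (Suc n) z z' / (1 + vartheta (Suc n) z z'))) \<le> X_dist z z'"
      unfolding X_dist_eq[OF z]
      by (rule sum_le_suminf[OF X_dist_summable[OF z]]) (use vartheta_nonneg[OF z] in auto)
    then have "(1/2) ^ Suc N * (v / (1 + v)) < (1/2) ^ Suc N * (\<delta> / (1 + \<delta>))" using d by (simp add: v_def e_def)
    then have "v / (1 + v) < \<delta> / (1 + \<delta>)" by (rule mult_less_cancel_left_pos[THEN iffD1, rotated]) simp
    then have "v < \<delta>" using v0 assms by (simp add: divide_simps algebra_simps)
    moreover have "\<bar>fst (z t) - fst (z' t)\<bar> \<le> v"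
      using vartheta_upper[OF z, of t "Suc N"] t by (simp add: v_def)
    ultimately show ?thesis by simp
  qed
  moreover have "0 < e" using assms by (simp add: e_def)
  ultimately show ?thesis using that by blast
qed

context sign_changing_problem
begin

lemma zero_extension_eq: "0 \<le> s \<Longrightarrow> zero_extension g s = g s"
  by (simp add: zero_extension_def g_zero)

lemma zero_extension_continuous: "continuous_on UNIV (zero_extension g)"
proof -
  have "zero_extension g = (\<lambda>s. g (max s 0))" by (auto simp: zero_extension_def g_zero max_def fun_eq_iff)
  moreover have "continuous_on UNIV (\<lambda>s. g (max s 0))"
    by (rule continuous_on_compose2[OF g_cont]) (auto intro!: continuous_intros)
  ultimately show ?thesis by simp
qed

lemma Y0_orbit:
  assumes "z \<in> Y0 a g lam \<mu> R"
  shows "orbit \<mu> (\<lambda>t. fst (z t)) (\<lambda>t. snd (z t))"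
proof -
  have b: "0 \<le> fst (z t) \<and> fst (z t) \<le> R" for t using assms by (auto simp: Y0_def)
  have "integral_solution (\<lambda>t. - (weight a lam \<mu> t * zero_extension g (fst (z t)))) (\<lambda>t. fst (z t)) (\<lambda>t. snd (z t))"
    using assms by (intro system_solution_imp_integral) (auto simp: Y0_def)
  then show ?thesis using b by (simp add: orbit_def zero_extension_eq)
qed

lemma orbit_Y0:
  assumes "orbit \<mu> x y"
  shows "(\<lambda>t. (x t, y t)) \<in> Y0 a g lam \<mu> R" "second_order_solution (weight a lam \<mu>) g x"
proof -
  have sol: "integral_solution (\<lambda>t. - (weight a lam \<mu> t * zero_extension g (x t))) x y"
    and b: "\<And>t. 0 \<le> x t \<and> x t \<le> R"
    using assms by (auto simp: orbit_def zero_extension_eq)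
  note s = integral_imp_system_solution[OF sol weight_absolutely_integrable(3)[OF a_int] zero_extension_continuous]
  have "continuous_on UNIV (\<lambda>t. (x t, y t))" using integral_solutionD(3,4)[OF sol] by (intro continuous_on_Pair)
  then show "(\<lambda>t. (x t, y t)) \<in> Y0 a g lam \<mu> R" using s(1) b by (simp add: Y0_def X_space_def)
  show "second_order_solution (weight a lam \<mu>) g x" by (rule s(2)) (use b in \<open>simp add: zero_extension_eq\<close>)
qed

text \<open>The inverse of \<open>j \<mapsto> (idx j, j div int m)\<close>, translating from pairs
  to the consecutive numbering.\<close>

definition hump_no :: "nat \<Rightarrow> int \<Rightarrow> int" where "hump_no i l = int (i - 1) + l * int m"

lemma max_on_hump_eq: "i \<in> {1..m} \<Longrightarrow> max_on_hump T \<sigma> \<tau> z i l = hmax (\<lambda>t. fst (z t)) (hump_no i l)"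
  unfolding max_on_hump_def hmax_def hump_no_def by (simp only: base_hump(1,2))

definition symbol :: "real \<Rightarrow> nat" where
  "symbol h = (if h < r then 0 else if r < h \<and> h < \<rho> then 1 else if \<rho> < h \<and> h < R then 2 else undefined)"

lemma coding_eq: "coding m T \<sigma> \<tau> r \<rho> R z = (\<lambda>l. \<lambda>i\<in>{1..m}. symbol (hmax (\<lambda>t. fst (z t)) (hump_no i l)))"
  unfolding coding_def symbol_def Let_def by (intro ext restrict_ext) (simp add: max_on_hump_eq)

lemma symbol_in_band: "in_band s h \<Longrightarrow> s \<in> {0, 1, 2} \<Longrightarrow> symbol h = s"
  using radii by (auto simp: in_band_def symbol_def split: if_splits)

lemma symbol_range: "h \<noteq> r \<Longrightarrow> h \<noteq> \<rho> \<Longrightarrow> h < R \<Longrightarrow> symbol h \<in> {0, 1, 2}"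
  by (auto simp: symbol_def)

text \<open>The bands are open and the value \<open>h\<close> lies on none of the levels that
  separate them.\<close>

lemma symbol_locally_constant:
  assumes "h \<noteq> r" "h \<noteq> \<rho>" "h < R"
  shows "\<exists>\<delta>>0. \<forall>h'. \<bar>h' - h\<bar> < \<delta> \<longrightarrow> symbol h' = symbol h"
proof (intro exI conjI allI impI)
  let ?d = "min (min \<bar>h - r\<bar> \<bar>h - \<rho>\<bar>) (R - h)"
  show "0 < ?d" using assms by auto
  fix h' assume "\<bar>h' - h\<bar> < ?d"
  then have "\<bar>h' - h\<bar> < \<bar>h - r\<bar>" "\<bar>h' - h\<bar> < \<bar>h - \<rho>\<bar>" "\<bar>h' - h\<bar> < R - h" by auto
  then have "h' < r \<longleftrightarrow> h < r" "r < h' \<longleftrightarrow> r < h" "h' < \<rho> \<longleftrightarrow> h < \<rho>" "\<rho> < h' \<longleftrightarrow> \<rho> < h" "h' < R \<longleftrightarrow> h < R"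
    by (auto simp: abs_if split: if_splits)
  then show "symbol h' = symbol h" by (simp add: symbol_def)
qed

lemma topspace_Sigma: "topspace (Sigma_topology m) = {S. \<forall>l. S l \<in> alphabet m}"
  by (auto simp: Sigma_topology_def PiE_def Pi_def)

lemma hump_no_div: 
  assumes "i \<in> {1..m}"
  shows "hump_no i l div int m = l" "idx (hump_no i l) = i"
proof -
  have "int (i - 1) div int m = 0" using assms by auto
  then show "hump_no i l div int m = l" using m by (simp add: hump_no_def)
  show "idx (hump_no i l) = i" unfolding hump_no_def shift_m(3) using assms by (rule base_hump(3))
qed

lemma coding_eqI:
  assumes S: "S \<in> topspace (Sigma_topology m)"
    and band: "\<And>j. in_band (S (j div int m) (idx j)) (hmax (\<lambda>t. fst (z t)) j)"
  shows "coding m T \<sigma> \<tau> r \<rho> R z = S"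
proof (intro ext)
  fix l i
  have Sl: "S l \<in> {1..m} \<rightarrow>\<^sub>E {0, 1, 2}" using S by (simp add: topspace_Sigma alphabet_def)
  show "coding m T \<sigma> \<tau> r \<rho> R z l i = S l i"
  proof (cases "i \<in> {1..m}")
    case True
    have "S l i \<in> {0, 1, 2}" using Sl True by (rule PiE_mem)
    then show ?thesis using band[of "hump_no i l"] True by (simp add: coding_eq hump_no_div symbol_in_band)
  next
    case False
    then show ?thesis unfolding coding_eq PiE_arb[OF Sl False] restrict_apply by (rule if_not_P)
  qed
qed

lemma coding_shift: "coding m T \<sigma> \<tau> r \<rho> R (psi T z) = bernoulli_shift (coding m T \<sigma> \<tau> r \<rho> R z)"
proof -
  have "max_on_hump T \<sigma> \<tau> (psi T z) i l = max_on_hump T \<sigma> \<tau> z i (l + 1)" for i l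
  proof -
    have "(\<lambda>t. fst (z (t + T))) ` {p..q} = (\<lambda>t. fst (z t)) ` ((\<lambda>t. t + T) ` {p..q})" for p q
      by (simp only: image_image)
    also have "(\<lambda>t. t + T) ` {p..q} = {p + T..q + T}" for p q :: real by simp
    finally have "(\<lambda>t. fst (z (t + T))) ` {\<sigma> i + of_int l * T..\<tau> i + of_int l * T}
        = (\<lambda>t. fst (z t)) ` {\<sigma> i + of_int l * T + T..\<tau> i + of_int l * T + T}" .
    then show ?thesis by (simp add: max_on_hump_def psi_def algebra_simps)
  qed
  then show ?thesis by (simp add: coding_def bernoulli_shift_def)
qed

lemma Y0_levels:
  assumes "rigid \<mu>" "z \<in> Y0 a g lam \<mu> R"
  shows "hmax (\<lambda>t. fst (z t)) j \<noteq> r" "hmax (\<lambda>t. fst (z t)) j \<noteq> \<rho>" "hmax (\<lambda>t. fst (z t)) j < R"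
  using solution_levels[OF assms(1) Y0_orbit[OF assms(2)]] by auto

lemma coding_in_Sigma:
  assumes "rigid \<mu>" "z \<in> Y0 a g lam \<mu> R"
  shows "coding m T \<sigma> \<tau> r \<rho> R z \<in> topspace (Sigma_topology m)"
  using symbol_range[OF Y0_levels[OF assms]] unfolding topspace_Sigma alphabet_def coding_eq by (auto simp: PiE_iff)

text \<open>It suffices to treat one coordinate \<open>l\<close>, which has values in a discrete
  space. It depends on \<open>m\<close> maxima over a bounded time window, each of which stays away
  from the levels and moves continuously with the orbit.\<close>

lemma coding_continuous:
  assumes rig: "rigid \<mu>"
  shows "continuous_map (subtopology X_topology (Y0 a g lam \<mu> R)) (Sigma_topology m) (coding m T \<sigma> \<tau> r \<rho> R)"
proof -
  interpret Metric_space X_space X_dist by (rule Metric_space_X)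
  let ?Y = "Y0 a g lam \<mu> R" and ?cod = "coding m T \<sigma> \<tau> r \<rho> R"
  have YX: "?Y \<subseteq> X_space" by (auto simp: Y0_def)
  have local: "\<exists>e>0. \<forall>z'\<in>?Y. X_dist z z' < e \<longrightarrow> ?cod z' l = ?cod z l" if z: "z \<in> ?Y" for z l
  proof -
    define h where "h i = hmax (\<lambda>t. fst (z t)) (hump_no i l)" for i
    have "\<forall>i. \<exists>\<delta>>0. \<forall>h'. \<bar>h' - h i\<bar> < \<delta> \<longrightarrow> symbol h' = symbol (h i)"
      unfolding h_def using symbol_locally_constant[OF Y0_levels[OF rig z]] by blast
    then obtain \<delta> where \<delta>: "\<And>i. 0 < \<delta> i" "\<And>i h'. \<bar>h' - h i\<bar> < \<delta> i \<Longrightarrow> symbol h' = symbol (h i)" by metis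
    \<comment> \<open>Half of the smallest radius, because comparing suprema yields only a weak
      inequality.\<close>
    define d where "d = Min (\<delta> ` {1..m}) / 2"
    have d0: "0 < d" unfolding d_def using \<delta>(1) m by (simp add: Min_gr_iff)
    have dd: "d < \<delta> i" if "i \<in> {1..m}" for i
    proof -
      have "Min (\<delta> ` {1..m}) \<le> \<delta> i" using that by (intro Min_le) auto
      then show ?thesis using d0 by (simp add: d_def)
    qed
    obtain N where N: "\<bar>of_int l\<bar> * T + T \<le> real N" using real_arch_simple by blast
    obtain e where e: "0 < e" "\<And>z z' t. z \<in> X_space \<Longrightarrow> z' \<in> X_space \<Longrightarrow> X_dist z z' < e \<Longrightarrow> \<bar>t\<bar> \<le> real N \<Longrightarrow>
        \<bar>fst (z t) - fst (z' t)\<bar> < d"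
      using X_dist_controls_sup[OF d0] by metis
    have "?cod z' l = ?cod z l" if z': "z' \<in> ?Y" and dist: "X_dist z z' < e" for z'
    proof -
      have "symbol (hmax (\<lambda>t. fst (z' t)) (hump_no i l)) = symbol (h i)" if i: "i \<in> {1..m}" for i
      proof (rule \<delta>(2))
        have "\<bar>hmax (\<lambda>t. fst (z' t)) (hump_no i l) - h i\<bar> \<le> d"
          unfolding h_def hmax_def
        proof (rule SUP_close)
          show "{lft (hump_no i l)..mid (hump_no i l)} \<noteq> {}" using order(1)[of "hump_no i l"] by auto
          fix t assume t: "t \<in> {lft (hump_no i l)..mid (hump_no i l)}"
          show "fst (z' t) \<le> R \<and> fst (z t) \<le> R" using z z' by (auto simp: Y0_def)
          have "lft (l * int m) \<le> lft (hump_no i l)" unfolding hump_no_def by (rule lft_mono) simp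
          moreover have "mid (hump_no i l) < lft ((l + 1) * int m)"
            using i by (intro lft_mid_less) (auto simp: hump_no_def algebra_simps)
          ultimately have "of_int l * T \<le> t" "t \<le> of_int (l + 1) * T"
            using t shift_m(1)[of 0 l] shift_m(1)[of 0 "l + 1"] lft_zero by auto
          moreover have "\<bar>of_int l * T\<bar> = \<bar>of_int l\<bar> * T" using T by (simp add: abs_mult)
          moreover have "of_int (l + 1) * T = of_int l * T + T" by (simp add: algebra_simps)
          ultimately have "\<bar>t\<bar> \<le> real N" using N T by linarith
          then show "\<bar>fst (z' t) - fst (z t)\<bar> \<le> d"
            using e(2)[of z z' t] z z' YX dist by (auto simp: abs_minus_commute intro: less_imp_le)
        qed
        then show "\<bar>hmax (\<lambda>t. fst (z' t)) (hump_no i l) - h i\<bar> < \<delta> i" using dd[OF i] by simp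
      qed
      then show ?thesis unfolding coding_eq h_def by (intro restrict_ext) simp
    qed
    then show ?thesis using e(1) by blast
  qed
  show ?thesis
    unfolding Sigma_topology_def continuous_map_componentwise_UNIV
  proof
    fix l
    have top: "topspace (subtopology X_topology ?Y) = ?Y"
      using YX by (auto simp: X_topology_def)
    show "continuous_map (subtopology X_topology ?Y) (discrete_topology (alphabet m)) (\<lambda>z. ?cod z l)"
      unfolding continuous_map_def top
    proof (intro conjI allI impI)
      show "(\<lambda>z. ?cod z l) \<in> ?Y \<rightarrow> topspace (discrete_topology (alphabet m))"
        using coding_in_Sigma[OF rig] by (auto simp: topspace_Sigma)
      fix U assume "openin (discrete_topology (alphabet m)) U"
      show "openin (subtopology X_topology ?Y) {z \<in> ?Y. ?cod z l \<in> U}"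
      proof (subst openin_subopen, intro ballI)
        fix z assume z: "z \<in> {z \<in> ?Y. ?cod z l \<in> U}"
        then obtain e where e: "e > 0" "\<And>z'. z' \<in> ?Y \<Longrightarrow> X_dist z z' < e \<Longrightarrow> ?cod z' l = ?cod z l"
          using local[of z l] by auto
        show "\<exists>V. openin (subtopology X_topology ?Y) V \<and> z \<in> V \<and> V \<subseteq> {z \<in> ?Y. ?cod z l \<in> U}"
        proof (intro exI conjI)
          show "openin (subtopology X_topology ?Y) (mball z e \<inter> ?Y)"
            unfolding X_topology_def by (intro openin_subtopology_Int openin_mball)
          show "z \<in> mball z e \<inter> ?Y" using z e(1) YX by auto
          show "mball z e \<inter> ?Y \<subseteq> {z \<in> ?Y. ?cod z l \<in> U}" using z e(2) by auto
        qed
      qed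
    qed
  qed
qed

end

theorem theorem6p5:
  fixes g a :: "real \<Rightarrow> real" and T \<epsilon> \<rho> lam r R :: real
    and m :: nat and \<sigma> \<tau> :: "nat \<Rightarrow> real"
  assumes "continuous_on {0..} g" and "g 0 = 0" and "\<And>s. s > 0 \<Longrightarrow> g s > 0"
    and "((\<lambda>s. g s / s) \<longlongrightarrow> 0) (at_right 0)"
    and "((\<lambda>s. g s / s) \<longlongrightarrow> 0) at_top"
    and "locally_integrable a" and "minimal_period a T"
    and "m \<ge> 1" and "sign_pattern m T \<sigma> \<tau> a"
    and "eps_suitable m \<sigma> \<tau> a \<epsilon>"
    and "\<rho> > 0" and "lam > lambda_star m \<sigma> \<tau> a g \<epsilon> \<rho>"
    and "admissible m \<sigma> \<tau> a g \<rho> lam r R"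
  shows "\<exists>\<mu>\<^sub>0>0. \<forall>\<mu>>\<mu>\<^sub>0.
    (let Y = Y0 a g lam \<mu> R; cod = coding m T \<sigma> \<tau> r \<rho> R in
      coding_well_defined m T \<sigma> \<tau> r \<rho> R Y \<and>
      continuous_map (subtopology X_topology Y) (Sigma_topology m) cod \<and>
      cod ` Y = topspace (Sigma_topology m) \<and>
      (\<forall>z\<in>Y. cod (psi T z) = bernoulli_shift (cod z)) \<and>
      (\<forall>k\<ge>1. \<forall>S\<in>topspace (Sigma_topology m). (\<forall>l. S (l + int k) = S l) \<longrightarrow>
        (\<exists>u y. (\<lambda>t. (u t, y t)) \<in> Y \<and> cod (\<lambda>t. (u t, y t)) = S \<and>
           (\<forall>t. u (t + real k * T) = u t) \<and>
           second_order_solution (weight a lam \<mu>) g u)))"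
proof -
  interpret sign_changing_problem g a T \<epsilon> \<rho> lam r R m \<sigma> \<tau>
    by unfold_locales (use assms in \<open>auto simp: minimal_period_def\<close>)
  let ?cod = "coding m T \<sigma> \<tau> r \<rho> R"
  obtain \<mu>0 where \<mu>0: "0 < \<mu>0" "\<And>\<mu>. \<mu> > \<mu>0 \<Longrightarrow> rigid \<mu>" using rigid_large by blast
  have digits: "S (j div int m) (idx j) \<in> {0, 1, 2}" if "S \<in> topspace (Sigma_topology m)" for S j
  proof -
    have "S (j div int m) \<in> {1..m} \<rightarrow>\<^sub>E {0, 1, 2}" using that by (simp add: topspace_Sigma alphabet_def)
    then show ?thesis using idx_range by (rule PiE_mem)
  qed
  show ?thesis
    unfolding Let_def
  proof (intro exI[of _ \<mu>0] conjI allI impI ballI \<mu>0(1))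
    fix \<mu> assume "\<mu> > \<mu>0"
    then have rig: "rigid \<mu>" by (rule \<mu>0(2))
    let ?Y = "Y0 a g lam \<mu> R"
    show "coding_well_defined m T \<sigma> \<tau> r \<rho> R ?Y"
      unfolding coding_well_defined_def
    proof (intro ballI allI)
      fix z i l assume z: "z \<in> ?Y" and i: "i \<in> {1..m}"
      show "max_on_hump T \<sigma> \<tau> z i l < r \<or> (r < max_on_hump T \<sigma> \<tau> z i l \<and> max_on_hump T \<sigma> \<tau> z i l < \<rho>) \<or>
        (\<rho> < max_on_hump T \<sigma> \<tau> z i l \<and> max_on_hump T \<sigma> \<tau> z i l < R)"
        using Y0_levels[OF rig z, of "hump_no i l"] unfolding max_on_hump_eq[OF i] by linarith
    qed
    show "continuous_map (subtopology X_topology ?Y) (Sigma_topology m) ?cod" by (rule coding_continuous[OF rig])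
    show "?cod ` ?Y = topspace (Sigma_topology m)"
    proof
      show "?cod ` ?Y \<subseteq> topspace (Sigma_topology m)" using coding_in_Sigma[OF rig] by blast
      show "topspace (Sigma_topology m) \<subseteq> ?cod ` ?Y"
      proof
        fix S assume S: "S \<in> topspace (Sigma_topology m)"
        obtain x y where xy: "orbit \<mu> x y" "\<And>j. in_band (S (j div int m) (idx j)) (hmax x j)"
          using orbit_exists[where S = "\<lambda>j. S (j div int m) (idx j)", OF rig digits[OF S]] by blast
        have "?cod (\<lambda>t. (x t, y t)) = S" by (rule coding_eqI[OF S]) (use xy(2) in simp)
        then show "S \<in> ?cod ` ?Y" using orbit_Y0(1)[OF xy(1)] by blast
      qed
    qed
    show "?cod (psi T z) = bernoulli_shift (?cod z)" for z by (rule coding_shift)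
    fix k :: nat and S assume k: "1 \<le> k" and S: "S \<in> topspace (Sigma_topology m)" and per: "\<forall>l. S (l + int k) = S l"
    \<comment> \<open>One step in \<open>l\<close> passes \<open>m\<close> humps, so a
      \<open>k\<close>-periodic sequence has period \<open>k * m\<close> in the consecutive
      numbering.\<close>
    have "S ((j + int k * int m) div int m) (idx (j + int k * int m)) = S (j div int m) (idx j)" for j
    proof -
      have "(j + int k * int m) div int m = j div int m + int k" using m by simp
      then show ?thesis unfolding shift_m(3) by (simp only: per)
    qed
    then obtain x y where xy: "orbit \<mu> x y" "\<And>t. x (t + real k * T) = x t"
      "\<And>j. in_band (S (j div int m) (idx j)) (hmax x j)"
      using periodic_orbit[where S = "\<lambda>j. S (j div int m) (idx j)", OF rig k digits[OF S]] by blast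
    have "?cod (\<lambda>t. (x t, y t)) = S" by (rule coding_eqI[OF S]) (use xy(3) in simp)
    then show "\<exists>u y. (\<lambda>t. (u t, y t)) \<in> ?Y \<and> ?cod (\<lambda>t. (u t, y t)) = S \<and>
           (\<forall>t. u (t + real k * T) = u t) \<and> second_order_solution (weight a lam \<mu>) g u"
      using orbit_Y0[OF xy(1)] xy(2) by blast
  qed
qed

end
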